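(* Let $\varepsilon,\delta>0$, let $d\geq 4$ be an integer with $d\geq 2\delta^{-2}\varepsilon^{-1}$, let $\mathbb{X}^d=\mathbb{R}^d$ or $\mathbb{X}^d=\mathbb{C}^d$, let $\{b_1,\ldots,b_d\}$ be any orthonormal basis of $\mathbb{X}^d$, let $R$ be a random element of $G$ with distribution $u_G$, and let $\varphi\in L^2(\mathbb{S}(\mathbb{X}^d),u,\mathbb{R})$. Then $$\mathbb{P}\biggl(\Bigl|\frac1d\sum_{j=1}^d\varphi(R(b_j))-\mathbb{E}_u(\varphi)\Bigr|\leq\delta\sqrt{\operatorname{Var}_u(\varphi)}\biggr)\geq 1-\varepsilon.$$
   Context: $\mathbb{X}^d$ denotes $\mathbb{R}^d$ or $\mathbb{C}^d$ with its standard inner product; $\mathbb{S}(\mathbb{X}^d)$ is its unit sphere; $u$ is the uniform probability measure (normalized surface area) on $\mathbb{S}(\mathbb{X}^d)$. $G$ is the orthogonal group $O(d)$ if $\mathbb{X}^d=\mathbb{R}^d$ and the unitary group $U(d)$ if $\mathbb{X}^d=\mathbb{C}^d$; $u_G$ is the normalized Haar measure on $G$. $L^2(\mathbb{S}(\mathbb{X}^d),u,\mathbb{R})$ is the space of real-valued square-integrable functions with respect to $u$; $\mathbb{E}_u(\varphi)$ and $\operatorname{Var}_u(\varphi)$ are the mean and variance of $\varphi$ with respect to $u$. *)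

theory Defs
  imports "HOL-Probability.Probability"
begin

text \<open>
  Surface area on the unit sphere of a Euclidean space, defined through cones over the origin:
  the area of a Borel set \<open>A\<close> is the dimension times the Lebesgue measure of
  \<open>{r x | 0 < r \<le> 1, x \<in> A}\<close> (see \<open>emeasure_sphere_area\<close> below). For the type
  \<open>complex ^ 'n\<close> the dimension is the real one, i.e. twice the cardinality of \<open>'n\<close>.
\<close>

definition sphere_area :: "'a::euclidean_space measure" where
  "sphere_area =
     scale_measure (of_nat DIM('a))
       (restrict_space
         (distr (restrict_space lborel (cball 0 1)) borel (\<lambda>x. x /\<^sub>R norm x))
         (sphere 0 1))"

definition uniform_sphere :: "'a::euclidean_space measure" where
  "uniform_sphere = uniform_measure sphere_area (sphere 0 1)"

lemma space_sphere_area [simp]: "space (sphere_area :: 'a::euclidean_space measure) = sphere 0 1"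
  by (simp add: sphere_area_def space_scale_measure space_restrict_space)

lemma sets_sphere_area [simp, measurable_cong]:
  "sets (sphere_area :: 'a::euclidean_space measure) = sets (restrict_space borel (sphere 0 1))"
  unfolding sphere_area_def sets_scale_measure by (intro sets_restrict_space_cong) simp

lemma space_uniform_sphere [simp]:
  "space (uniform_sphere :: 'a::euclidean_space measure) = sphere 0 1"
  by (simp add: uniform_sphere_def)

lemma sets_uniform_sphere [simp, measurable_cong]:
  "sets (uniform_sphere :: 'a::euclidean_space measure) = sets (restrict_space borel (sphere 0 1))"
  by (simp add: uniform_sphere_def)

lemma emeasure_sphere_area:
  fixes A :: "'a::euclidean_space set"
  assumes A: "A \<in> sets borel" "A \<subseteq> sphere 0 1"
  shows "emeasure sphere_area A =
           of_nat DIM('a) * emeasure lborel {r *\<^sub>R x | r x. 0 < r \<and> r \<le> 1 \<and> x \<in> A}"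
proof -
  let ?f = "\<lambda>x::'a. x /\<^sub>R norm x"
  have eq: "?f -` A \<inter> cball 0 1 = {r *\<^sub>R x | r x. 0 < r \<and> r \<le> 1 \<and> x \<in> A}" (is "?L = ?R")
  proof (intro equalityI subsetI)
    fix y assume y: "y \<in> ?L"
    then have "?f y \<in> sphere 0 1" using A(2) by blast
    then have "y \<noteq> 0" by auto
    then have "y = norm y *\<^sub>R ?f y" "0 < norm y" "norm y \<le> 1" "?f y \<in> A"
      using y by auto
    then show "y \<in> ?R" by blast
  next
    fix y assume "y \<in> ?R"
    then obtain r x where "y = r *\<^sub>R x" "0 < r" "r \<le> 1" "x \<in> A" by blast
    moreover from this A(2) have "norm x = 1" by auto
    ultimately show "y \<in> ?L" by simp
  qed
  have f: "?f \<in> restrict_space lborel (cball 0 1) \<rightarrow>\<^sub>M borel"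
    by (intro measurable_restrict_space1) simp
  have "emeasure (restrict_space (distr (restrict_space lborel (cball 0 1)) borel ?f) (sphere 0 1)) A
      = emeasure (distr (restrict_space lborel (cball 0 1)) borel ?f) A"
    using A(2) by (intro emeasure_restrict_space) auto
  also have "\<dots> = emeasure (restrict_space lborel (cball 0 1)) (?f -` A \<inter> cball 0 1)"
    using A(1) f by (subst emeasure_distr) (auto simp: space_restrict_space)
  also have "\<dots> = emeasure lborel (?f -` A \<inter> cball 0 1)"
    by (intro emeasure_restrict_space) auto
  finally show ?thesis
    by (simp add: sphere_area_def eq)
qed

lemma emeasure_sphere_area_sphere:
  "emeasure (sphere_area :: 'a::euclidean_space measure) (sphere 0 1) =
     of_nat DIM('a) * emeasure lborel (cball (0::'a) 1)"
proof -
  have eq: "{r *\<^sub>R x | r x. 0 < r \<and> r \<le> 1 \<and> x \<in> sphere 0 1} = cball (0::'a) 1 - {0}" (is "?L = ?R")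
  proof (intro equalityI subsetI)
    fix y :: 'a assume "y \<in> ?R"
    then have "y = norm y *\<^sub>R (y /\<^sub>R norm y)" "0 < norm y" "norm y \<le> 1" "y /\<^sub>R norm y \<in> sphere 0 1"
      by auto
    then show "y \<in> ?L" by blast
  qed auto
  have "emeasure lborel (cball (0::'a) 1 - {0}) = emeasure lborel (cball (0::'a) 1)"
    by (intro emeasure_Diff_null_set) (auto simp: null_sets_def)
  then show ?thesis
    by (subst emeasure_sphere_area) (simp_all only: eq, auto)
qed

lemma prob_space_uniform_sphere: "prob_space (uniform_sphere :: 'a::euclidean_space measure)"
  unfolding uniform_sphere_def
proof (rule prob_space_uniform_measure)
  have "0 < measure lebesgue (cball (0::'a) 1)" by (simp add: content_cball_pos)
  then have "emeasure lborel (cball (0::'a) 1) \<noteq> 0"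
    by (auto simp: measure_def)
  then show "emeasure (sphere_area :: 'a measure) (sphere 0 1) \<noteq> 0"
    by (simp add: emeasure_sphere_area_sphere)
  show "emeasure (sphere_area :: 'a measure) (sphere 0 1) \<noteq> \<infinity>"
    using emeasure_lborel_cball_finite[of "0::'a" 1]
    by (simp add: emeasure_sphere_area_sphere ennreal_mult_eq_top_iff)
qed

definition hermitian_inner :: "complex ^ 'n \<Rightarrow> complex ^ 'n \<Rightarrow> complex" where
  "hermitian_inner x y = (\<Sum>i\<in>UNIV. x $ i * cnj (y $ i))"

definition conj_transpose :: "complex ^ 'n ^ 'm \<Rightarrow> complex ^ 'm ^ 'n" where
  "conj_transpose A = (\<chi> i j. cnj (A $ j $ i))"

definition orthogonal_group :: "(real ^ 'n ^ 'n) set" where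
  "orthogonal_group = {Q. orthogonal_matrix Q}"

definition unitary_group :: "(complex ^ 'n ^ 'n) set" where
  "unitary_group = {U. conj_transpose U ** U = mat 1 \<and> U ** conj_transpose U = mat 1}"

definition real_orthonormal_basis :: "nat \<Rightarrow> (nat \<Rightarrow> real ^ 'n) \<Rightarrow> bool" where
  "real_orthonormal_basis d b \<longleftrightarrow>
     (\<forall>i\<in>{1..d}. \<forall>j\<in>{1..d}. b i \<bullet> b j = (if i = j then 1 else 0)) \<and>
     span (b ` {1..d}) = UNIV"

text \<open>Here \<^const>\<open>vec.span\<close> is the span with complex coefficients.\<close>

definition complex_orthonormal_basis :: "nat \<Rightarrow> (nat \<Rightarrow> complex ^ 'n) \<Rightarrow> bool" where
  "complex_orthonormal_basis d b \<longleftrightarrow>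
     (\<forall>i\<in>{1..d}. \<forall>j\<in>{1..d}. hermitian_inner (b i) (b j) = (if i = j then 1 else 0)) \<and>
     vec.span (b ` {1..d}) = UNIV"

text \<open>
  \<open>\<mu>\<close> is the normalized Haar measure of the compact matrix group \<open>G\<close>: a left-invariant Borel
  probability measure on \<open>G\<close>. Regularity is automatic, \<open>G\<close> being compact and metrizable.
\<close>

definition normalized_haar ::
    "('a::real_normed_field ^ 'n ^ 'n) set \<Rightarrow> ('a ^ 'n ^ 'n) measure \<Rightarrow> bool" where
  "normalized_haar G \<mu> \<longleftrightarrow>
     prob_space \<mu> \<and> sets \<mu> = sets (restrict_space borel G) \<and>
     (\<forall>g\<in>G. \<forall>A\<in>sets \<mu>. emeasure \<mu> ((\<lambda>h. g ** h) ` A) = emeasure \<mu> A)"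

end

theory Submission
  imports Defs
begin

text \<open>
  By Chebyshev it suffices that two entries \<open>R x\<close>, \<open>R y\<close> of the random frame satisfy
  \<open>Cov (\<phi> (R x)) (\<phi> (R y)) \<le> Var \<phi> / (d - 1)\<close>. This covariance is \<open>\<langle>\<phi>, T \<phi>\<rangle>\<close> for the self-adjoint
  operator \<open>T\<close> that averages a function over the unit vectors orthogonal to its argument, so one
  needs \<open>\<parallel>T\<parallel> \<le> \<kappa> = 1 / (d - 1)\<close> on mean zero functions.

  No spherical harmonics are needed. On functions of the form \<open>f (\<bar>\<langle>a, x\<rangle>\<bar>\<^sup>2)\<close> the operator acts as
  \<open>(S f) s = E (f ((1 - s) B))\<close> with \<open>B = \<bar>\<langle>v, Y\<rangle>\<bar>\<^sup>2\<close>, \<open>Y\<close> uniform on the unit sphere of a hyperplane and \<open>v\<close> a unit vector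
  in it. As \<open>E B = \<kappa>\<close>, \<open>S\<close> contracts Lipschitz constants by the factor \<open>\<kappa>\<close>. Hence \<open>\<bar>T\<^sup>n \<psi>\<bar> \<le> C \<kappa>\<^sup>n\<close> for every mixture
  \<open>\<psi>\<close> of such functions with mean zero weights, where \<open>C\<close> may depend on \<open>\<psi>\<close>; and since \<open>n \<mapsto> \<parallel>T\<^sup>n \<psi>\<parallel>\<^sup>2\<close>
  is log-convex, this already forces \<open>\<parallel>T \<psi>\<parallel> \<le> \<kappa> \<parallel>\<psi>\<parallel>\<close>. These mixtures approximate all continuous
  phase invariant functions, in particular \<open>T \<phi>\<close> for continuous \<open>\<phi>\<close>; self-adjointness then gives
  \<open>\<parallel>T \<phi>\<parallel>\<^sup>2 = \<langle>\<phi>, T\<^sup>2 \<phi>\<rangle> \<le> \<kappa> \<parallel>\<phi>\<parallel> \<parallel>T \<phi>\<parallel>\<close>, and density of the continuous functions does the rest.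
\<close>

section \<open>Scalar fields with conjugation and their unitary groups\<close>

text \<open>The instances are the reals with the identity and the complex numbers with conjugation.\<close>


locale conj_field =
  fixes cj :: "'a::{real_normed_field,euclidean_space} \<Rightarrow> 'a"
  assumes linear_cj: "linear cj"
    and cj_mult: "cj (a * b) = cj a * cj b"
    and cj_cj [simp]: "cj (cj a) = a"
    and mult_cj: "a * cj a = of_real ((norm a)\<^sup>2)"
begin

lemma cj_add: "cj (a + b) = cj a + cj b"
  and cj_diff: "cj (a - b) = cj a - cj b"
  and cj_sum: "cj (sum f I) = (\<Sum>i\<in>I. cj (f i))"
  and cj_0 [simp]: "cj 0 = 0"
  using linear_cj by (simp_all add: linear_add linear_diff linear_sum linear_0)

lemma cj_1 [simp]: "cj 1 = 1"
  using mult_cj[of 1] by simp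

lemma cj_of_real [simp]: "cj (of_real r) = of_real r"
  using linear_scale[OF linear_cj, of r 1] by (simp add: of_real_def)

lemma norm_cj [simp]: "norm (cj a) = norm a"
proof (cases "a = 0")
  case False
  have "norm a * norm (cj a) = norm a * norm a"
    using arg_cong[OF mult_cj[of a], of norm] by (simp add: norm_mult power2_eq_square)
  with False show ?thesis by simp
qed simp

lemma continuous_on_cj [continuous_intros]:
  "continuous_on S f \<Longrightarrow> continuous_on S (\<lambda>x. cj (f x))"
  by (rule bounded_linear.continuous_on[OF linear_conv_bounded_linear[THEN iffD1, OF linear_cj]])

text \<open>The Hermitian form, linear in the first argument and conjugate linear in the second.
  With the identity as \<open>cj\<close> it is the real inner product.\<close>

definition h :: "'a ^ 'n \<Rightarrow> 'a ^ 'n \<Rightarrow> 'a" where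
  "h x y = (\<Sum>i\<in>UNIV. x $ i * cj (y $ i))"

lemma h_add_left: "h (x + y) z = h x z + h y z"
  and h_diff_left: "h (x - y) z = h x z - h y z"
  and h_diff_right: "h z (x - y) = h z x - h z y"
  and h_scale_left: "h (c *s x) z = c * h x z"
  and h_scale_right: "h z (c *s x) = cj c * h z x"
  by (simp_all add: h_def cj_add cj_diff cj_mult algebra_simps sum.distrib sum_subtractf
      sum_distrib_left)

lemma h_0 [simp]: "h 0 x = 0" "h x 0 = 0"
  by (simp_all add: h_def)

lemma scaleR_eq_vscale: "r *\<^sub>R (x :: 'a ^ 'n) = of_real r *s x"
  by (simp add: vec_eq_iff scaleR_conv_of_real[where 'a='a])

lemma h_scaleR_left: "h (r *\<^sub>R x) z = of_real r * h x z"
  and h_scaleR_right: "h z (r *\<^sub>R x) = of_real r * h z x"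
  by (simp_all add: scaleR_eq_vscale h_scale_left h_scale_right)

lemma h_commute: "h x y = cj (h y x)"
  by (simp add: h_def cj_sum cj_mult mult.commute)

lemma h_self: "h x x = of_real ((norm x)\<^sup>2)"
proof -
  have "h x x = of_real (\<Sum>i\<in>UNIV. (norm (x $ i))\<^sup>2)"
    by (simp add: h_def mult_cj)
  also have "(\<Sum>i\<in>UNIV. (norm (x $ i))\<^sup>2) = (norm x)\<^sup>2"
    by (simp add: norm_vec_def L2_set_def sum_nonneg)
  finally show ?thesis .
qed

lemma h_self_unit: "norm x = 1 \<Longrightarrow> h x x = 1"
  by (simp add: h_self)

lemma norm_eq_1_if_h_self: assumes "h x x = 1" shows "norm x = 1"
proof -
  have "of_real ((norm x)\<^sup>2) = (of_real (1\<^sup>2) :: 'a)"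
    using assms by (simp add: h_self)
  then have "(norm x)\<^sup>2 = 1\<^sup>2" by (simp only: of_real_eq_iff)
  then show ?thesis by (rule power2_eq_imp_eq) simp_all
qed

lemma norm_vscale: "norm (c *s (x :: 'a ^ 'n)) = norm c * norm x"
proof -
  have "of_real ((norm (c *s x))\<^sup>2) = (of_real ((norm c * norm x)\<^sup>2) :: 'a)"
    unfolding h_self[symmetric] h_scale_left h_scale_right
    using mult_cj[of c] by (simp add: h_self power_mult_distrib mult.commute[of "cj c"] flip: mult.assoc)
  then have "(norm (c *s x))\<^sup>2 = (norm c * norm x)\<^sup>2"
    by (simp only: of_real_eq_iff)
  then show ?thesis by (simp add: power2_eq_iff_nonneg)
qed

lemma continuous_on_h [continuous_intros]:
  "continuous_on S f \<Longrightarrow> continuous_on S g \<Longrightarrow> continuous_on S (\<lambda>x. h (f x) (g x))"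
  unfolding h_def by (intro continuous_intros)

text \<open>For a unit vector \<open>x\<close>, the component of \<open>z\<close> orthogonal to
  \<open>x\<close>.\<close>

definition rej :: "'a ^ 'n \<Rightarrow> 'a ^ 'n \<Rightarrow> 'a ^ 'n" where
  "rej x z = z - h z x *s x"

lemma h_rej: "norm x = 1 \<Longrightarrow> h (rej x z) x = 0" "norm x = 1 \<Longrightarrow> h x (rej x z) = 0"
  using h_commute[of x z]
  by (auto simp: rej_def h_diff_left h_diff_right h_scale_left h_scale_right h_self_unit)

lemma norm_rej:
  assumes "norm x = 1"
  shows "(norm (rej x z))\<^sup>2 = (norm z)\<^sup>2 - (norm (h z x))\<^sup>2"
proof -
  have "h (rej x z) (rej x z) = h (rej x z) z"
    by (subst (2) rej_def) (simp add: h_diff_right h_scale_right h_rej assms)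
  also have "\<dots> = h z z - h z x * cj (h z x)"
    using h_commute[of x z] by (simp add: rej_def h_diff_left h_scale_left)
  also have "\<dots> = of_real ((norm z)\<^sup>2 - (norm (h z x))\<^sup>2)"
    by (simp add: h_self mult_cj)
  finally show ?thesis
    by (simp only: h_self of_real_eq_iff)
qed

lemma norm_h_le:
  assumes "norm x = 1" "norm z = 1" shows "(norm (h z x))\<^sup>2 \<le> 1"
  using norm_rej[OF assms(1), of z] zero_le_power2[of "norm (rej x z)"] assms by simp

section \<open>Conjugate transpose, the unitary group and its transitivity on orthonormal
  pairs\<close>

definition ctr :: "'a ^ 'n ^ 'm \<Rightarrow> 'a ^ 'm ^ 'n" where
  "ctr A = (\<chi> i j. cj (A $ j $ i))"

definition G :: "('a ^ 'n ^ 'n) set" where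
  "G = {A. ctr A ** A = mat 1 \<and> A ** ctr A = mat 1}"

lemma ctr_ctr [simp]: "ctr (ctr A) = A"
  by (simp add: ctr_def vec_eq_iff)

lemma ctr_mat_1 [simp]: "ctr (mat 1) = mat 1"
  by (simp add: ctr_def mat_def vec_eq_iff)

lemma ctr_mult: "ctr (A ** B) = ctr B ** ctr A"
  by (simp add: ctr_def matrix_matrix_mult_def vec_eq_iff cj_sum cj_mult mult.commute)

lemma h_adj: "h (A *v x) y = h x (ctr A *v y)"
proof -
  have "h (A *v x) y = (\<Sum>i\<in>UNIV. \<Sum>j\<in>UNIV. A $ i $ j * x $ j * cj (y $ i))"
    by (simp add: h_def matrix_vector_mult_def sum_distrib_right)
  also have "\<dots> = (\<Sum>j\<in>UNIV. \<Sum>i\<in>UNIV. A $ i $ j * x $ j * cj (y $ i))"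
    by (rule sum.swap)
  also have "\<dots> = h x (ctr A *v y)"
    by (simp add: h_def matrix_vector_mult_def ctr_def cj_sum cj_mult sum_distrib_left mult_ac)
  finally show ?thesis .
qed

lemma h_G: "A \<in> G \<Longrightarrow> h (A *v x) (A *v y) = h x y"
  by (simp add: h_adj matrix_vector_mul_assoc G_def)

lemma norm_G: assumes "A \<in> G" shows "norm (A *v x) = norm x"
proof -
  have "(norm (A *v x))\<^sup>2 = (norm x)\<^sup>2"
    using h_G[OF assms, of x x] by (simp only: h_self of_real_eq_iff)
  then show ?thesis by (simp add: power2_eq_iff_nonneg)
qed

lemma G_mult: assumes "A \<in> G" "B \<in> G" shows "A ** B \<in> G"
proof -
  have "ctr B ** ctr A ** (A ** B) = ctr B ** (ctr A ** A) ** B"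
    "A ** B ** (ctr B ** ctr A) = A ** (B ** ctr B) ** ctr A"
    by (simp_all add: matrix_mul_assoc)
  then show ?thesis using assms by (simp add: G_def ctr_mult)
qed

lemma G_ctr: "A \<in> G \<Longrightarrow> ctr A \<in> G"
  by (simp add: G_def)

lemma G_rej: "A \<in> G \<Longrightarrow> A *v rej x z = rej (A *v x) (A *v z)"
  by (simp add: rej_def h_G matrix_vector_mult_diff_distrib vector_scalar_commute)

text \<open>For \<open>c = -1\<close> this is the Householder reflection along \<open>w\<close>; over the complex numbers the
  additional phases are needed for transitivity on the sphere.\<close>

definition reflect :: "'a ^ 'n \<Rightarrow> 'a \<Rightarrow> 'a ^ 'n ^ 'n" where
  "reflect w c = (\<chi> i j. (if i = j then 1 else 0) + (c - 1) * w $ i * cj (w $ j))"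

lemma reflect_mult_vec: "reflect w c *v z = z + ((c - 1) * h z w) *s w"
proof -
  have "(\<Sum>j\<in>UNIV. ((if i = j then 1 else 0) + (c - 1) * w $ i * cj (w $ j)) * z $ j) =
      z $ i + (c - 1) * h z w * w $ i" for i
  proof -
    have "(\<Sum>j\<in>UNIV. ((if i = j then 1 else 0) + (c - 1) * w $ i * cj (w $ j)) * z $ j)
        = (\<Sum>j\<in>UNIV. (if i = j then z $ j else 0)) + (\<Sum>j\<in>UNIV. (c - 1) * w $ i * cj (w $ j) * z $ j)"
      unfolding sum.distrib[symmetric] by (intro sum.cong) (auto simp: algebra_simps)
    also have "\<dots> = z $ i + (c - 1) * h z w * w $ i"
      by (simp add: h_def sum_distrib_left sum_distrib_right mult_ac)
    finally show ?thesis .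
  qed
  then show ?thesis
    by (simp add: vec_eq_iff matrix_vector_mult_def reflect_def)
qed

text \<open>For a unit vector \<open>w\<close> the map multiplies the direction \<open>w\<close> by
  \<open>c\<close> and fixes its orthogonal complement. Hence for fixed \<open>w\<close> such maps
  compose like the scalars \<open>c\<close>, and the adjoint belongs to the scalar
  \<open>cj c\<close>.\<close>

lemma reflect_in_G:
  assumes "norm w = 1" "norm c = 1"
  shows "reflect w c \<in> G"
proof -
  have ctr: "ctr (reflect w c) = reflect w (cj c)" for c
    by (simp add: ctr_def reflect_def vec_eq_iff cj_add cj_mult cj_diff mult_ac)
  have mul: "reflect w c ** reflect w c' = mat 1" if "c * c' = 1" for c c'
  proof -
    have "c' - 1 + ((c - 1) + (c - 1) * (c' - 1)) = 0"
      using that by (simp add: algebra_simps)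
    then have "reflect w c *v (reflect w c' *v z) = z" for z
    proof -
      have "reflect w c *v (reflect w c' *v z) =
          z + ((c' - 1 + ((c - 1) + (c - 1) * (c' - 1))) * h z w) *s w"
        by (simp add: reflect_mult_vec h_add_left h_scale_left h_self_unit assms
          vec_eq_iff algebra_simps)
      then show ?thesis using \<open>c' - 1 + _ = 0\<close> by (simp only:) simp
    qed
    then show ?thesis
      by (simp add: matrix_eq matrix_vector_mul_assoc[symmetric])
  qed
  have "c * cj c = 1" using mult_cj[of c] assms by simp
  then show ?thesis
    by (simp add: G_def ctr mul mult.commute)
qed

text \<open>A generalized reflection along \<open>w\<close>, the normalized difference
  \<open>x - y\<close>, moves \<open>x\<close> along \<open>w\<close>; the right phase moves it
  exactly to \<open>y\<close>. A vector orthogonal to both \<open>x\<close> and \<open>y\<close> is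
  orthogonal to \<open>w\<close> and stays fixed.\<close>

lemma ex_reflect:
  assumes "norm x = 1" "norm y = 1"
  obtains A where "A \<in> G" "A *v x = y" "\<And>z. h z x = 0 \<Longrightarrow> h z y = 0 \<Longrightarrow> A *v z = z"
proof (cases "x = y")
  case True
  have "mat 1 \<in> G" by (simp add: G_def)
  then show ?thesis using that[of "mat 1"] True by simp
next
  case False
  define t where "t = h x y"
  define n where "n = norm (x - y)"
  have n: "n > 0" using False by (simp add: n_def)
  define w where "w = (1 / n) *\<^sub>R (x - y)"
  have w: "norm w = 1" using n by (simp add: w_def n_def)
  have n2: "of_real (n\<^sup>2) = 2 - t - cj t"
    using h_self[of "x - y"] h_commute[of y x]
    by (simp add: n_def t_def h_diff_left h_diff_right h_self_unit assms algebra_simps)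
  have t1: "1 - t \<noteq> 0"
  proof
    assume "1 - t = 0"
    then have "t = 1" by simp
    then have "of_real (n\<^sup>2) = (0::'a)" using n2 by simp
    then show False using n by simp
  qed
  then have t2: "1 - cj t \<noteq> 0" by (metis cj_1 cj_cj cj_diff eq_iff_diff_eq_0)
  have "norm (1 - t) = norm (1 - cj t)" by (metis norm_cj cj_1 cj_diff)
  have cj_w: "h x w = of_real (1 / n) * (1 - t)"
    by (simp add: w_def h_scaleR_right h_diff_right h_self_unit assms t_def)
  have "((c' - 1) * h x w) *s w = ((c' - 1) * (1 - t) / of_real (n\<^sup>2)) *s (x - y)" for c'
    unfolding cj_w by (simp add: w_def vec_eq_iff scaleR_conv_of_real[where 'a='a] power2_eq_square
      right_diff_distrib diff_divide_distrib)
  \<comment> \<open>The solution of \<open>(c' - 1) * (1 - t) = - of_real (n\<^sup>2)\<close>. It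
    has norm 1 because numerator and denominator are conjugate to each other.\<close>
  moreover define c' where "c' = - ((1 - cj t) / (1 - t))"
  have "(c' - 1) * (1 - t) = - (2 - t - cj t)"
    using t1 by (simp add: c'_def field_simps)
  then have "(c' - 1) * (1 - t) = - of_real (n\<^sup>2)"
    by (simp only: n2)
  ultimately have "((c' - 1) * h x w) *s w = y - x"
    using n by simp
  then have "reflect w c' *v x = y" by (simp add: reflect_mult_vec)
  moreover have "norm c' = 1"
    using t1 t2 \<open>norm (1 - t) = _\<close> by (simp add: c'_def norm_divide)
  moreover have "reflect w c' *v z = z" if "h z x = 0" "h z y = 0" for z
    using that by (simp add: reflect_mult_vec w_def h_scaleR_right h_diff_right)
  ultimately show ?thesis using that[of "reflect w c'"] w reflect_in_G by blast
qed

text \<open>Two reflections: the first carries \<open>x\<close> to \<open>x'\<close>, the second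
  carries the image of \<open>y\<close> to \<open>y'\<close>. The second leaves \<open>x'\<close>
  alone, since \<open>x'\<close> is orthogonal to both vectors it was built from.\<close>

lemma ex_G_pair:
  assumes "norm x = 1" "norm y = 1" "h x y = 0" "norm x' = 1" "norm y' = 1" "h x' y' = 0"
  obtains A where "A \<in> G" "A *v x = x'" "A *v y = y'"
proof -
  obtain A where A: "A \<in> G" "A *v x = x'" using ex_reflect assms by metis
  obtain B where B: "B \<in> G" "B *v (A *v y) = y'"
    "\<And>z. h z (A *v y) = 0 \<Longrightarrow> h z y' = 0 \<Longrightarrow> B *v z = z"
    using ex_reflect[of "A *v y" y'] assms norm_G[OF A(1), of y] by metis
  have "h x' (A *v y) = 0" using h_G[OF A(1), of x y] A assms by simp
  then have "B *v x' = x'" using B(3) assms by blast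
  then show ?thesis using that[of "B ** A"] A B(1,2) G_mult[OF B(1) A(1)]
    by (simp add: matrix_vector_mul_assoc[symmetric])
qed

text \<open>For \<open>z\<close> uniform on the sphere, \<open>Y x z\<close> is uniform on the unit vectors orthogonal to the unit
  vector \<open>x\<close>. It is \<open>0\<close> on the null set of \<open>z\<close> parallel to \<open>x\<close>.\<close>

definition Y :: "'a ^ 'n \<Rightarrow> 'a ^ 'n \<Rightarrow> 'a ^ 'n" where
  "Y x z = (1 / norm (rej x z)) *\<^sub>R rej x z"

lemma G_scaleR: "A *v (r *\<^sub>R x) = r *\<^sub>R (A *v (x :: 'a ^ 'n))"
  by (simp add: scaleR_eq_vscale vector_scalar_commute)

lemma G_Y: "A \<in> G \<Longrightarrow> A *v Y x z = Y (A *v x) (A *v z)"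
  by (simp add: Y_def G_scaleR G_rej[symmetric] norm_G)

lemma norm_Y: "rej x z \<noteq> 0 \<Longrightarrow> norm (Y x z) = 1"
  by (simp add: Y_def)

lemma h_Y: "norm x = 1 \<Longrightarrow> h (Y x z) x = 0" "norm x = 1 \<Longrightarrow> h x (Y x z) = 0"
  by (simp_all add: Y_def h_scaleR_left h_scaleR_right h_rej)

text \<open>The projection along \<open>x\<close> depends only on the line spanned by
  \<open>x\<close>. This makes every function \<open>T \<phi>\<close> phase invariant.\<close>

lemma Y_phase:
  assumes "norm c = 1" shows "Y (c *s x) z = Y x z"
proof -
  have "cj c * c = 1" using mult_cj[of c] assms by (simp add: mult.commute)
  then have "(cj c * h z x) *s (c *s x) = h z x *s x"
    by (simp add: vec_eq_iff mult_ac)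
  then have "rej (c *s x) z = rej x z" by (simp add: rej_def h_scale_right)
  then show ?thesis by (simp add: Y_def)
qed

end


section \<open>Haar measure and the law of an orthonormal pair\<close>

lemma emeasure_distr_nn_integral:
  assumes f: "f \<in> M \<rightarrow>\<^sub>M N" and A: "A \<in> sets N"
  shows "emeasure (distr M N f) A = (\<integral>\<^sup>+x. indicator A (f x) \<partial>M)"
proof -
  have "emeasure (distr M N f) A = (\<integral>\<^sup>+y. indicator A y \<partial>distr M N f)"
    using A by simp
  also have "\<dots> = (\<integral>\<^sup>+x. indicator A (f x) \<partial>M)"
    by (rule nn_integral_distr[OF f]) (use A in measurable)
  finally show ?thesis .
qed

context conj_field
begin

lemma borel_measurable_matrix_vector_mult [measurable (raw)]:
  fixes f :: "'b \<Rightarrow> 'a ^ 'n ^ 'm"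
  assumes "f \<in> borel_measurable M" "g \<in> borel_measurable M"
  shows "(\<lambda>x. f x *v g x) \<in> borel_measurable M"
  by (rule borel_measurable_continuous_Pair[OF assms])
     (auto simp: matrix_vector_mult_def intro!: continuous_intros)

lemma borel_measurable_matrix_mult [measurable (raw)]:
  fixes f :: "'b \<Rightarrow> 'a ^ 'n ^ 'm"
  assumes "f \<in> borel_measurable M" "g \<in> borel_measurable M"
  shows "(\<lambda>x. f x ** g x) \<in> borel_measurable M"
  by (rule borel_measurable_continuous_Pair[OF assms])
     (auto simp: matrix_matrix_mult_def intro!: continuous_intros)

lemma borel_measurable_ctr [measurable (raw)]:
  fixes f :: "'b \<Rightarrow> 'a ^ 'n ^ 'm"
  assumes "f \<in> borel_measurable M"
  shows "(\<lambda>x. ctr (f x)) \<in> borel_measurable M"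
  by (rule borel_measurable_continuous_on[OF _ assms])
     (auto simp: ctr_def intro!: continuous_intros)

lemma borel_measurable_h [measurable (raw)]:
  fixes f :: "'b \<Rightarrow> 'a ^ 'n"
  assumes "f \<in> borel_measurable M" "g \<in> borel_measurable M"
  shows "(\<lambda>x. h (f x) (g x)) \<in> borel_measurable M"
  by (rule borel_measurable_continuous_Pair[OF assms]) (auto intro!: continuous_intros)

lemma continuous_on_rej [continuous_intros]:
  "continuous_on S f \<Longrightarrow> continuous_on S g \<Longrightarrow> continuous_on S (\<lambda>x. rej (f x) (g x))"
  unfolding rej_def vector_scalar_mult_def by (intro continuous_intros)

lemma borel_measurable_rej [measurable (raw)]:
  fixes f :: "'b \<Rightarrow> 'a ^ 'n"
  assumes "f \<in> borel_measurable M" "g \<in> borel_measurable M"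
  shows "(\<lambda>x. rej (f x) (g x)) \<in> borel_measurable M"
  by (rule borel_measurable_continuous_Pair[OF assms]) (auto intro!: continuous_intros)

lemma borel_measurable_Y [measurable (raw)]:
  fixes f :: "'b \<Rightarrow> 'a ^ 'n"
  assumes [measurable]: "f \<in> borel_measurable M" "g \<in> borel_measurable M"
  shows "(\<lambda>x. Y (f x) (g x)) \<in> borel_measurable M"
  unfolding Y_def by measurable

end

text \<open>Both measures are pushed forward to the full matrix and vector space, so that measurability is
  plain Borel measurability.\<close>

locale haar_sphere = conj_field cj
  for cj :: "'a::{real_normed_field,euclidean_space} \<Rightarrow> 'a" +
  fixes \<mu> :: "('a ^ 'n ^ 'n) measure" and U :: "('a ^ 'n) measure"
  assumes prob_mu: "prob_space \<mu>"
    and sets_mu [measurable_cong, simp]: "sets \<mu> = sets borel"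
    and AE_mu: "AE g in \<mu>. g \<in> G"
    and inv_mu: "g \<in> G \<Longrightarrow> distr \<mu> borel ((**) g) = \<mu>"
    and prob_U: "prob_space U"
    and sets_U [measurable_cong, simp]: "sets U = sets borel"
    and AE_U: "AE x in U. norm x = 1"
    and inv_U: "g \<in> G \<Longrightarrow> distr U borel ((*v) g) = U"
    and card: "2 \<le> CARD('n)"
begin

sublocale mu: prob_space \<mu> by (fact prob_mu)
sublocale U: prob_space U by (fact prob_U)
sublocale mu_U: pair_sigma_finite \<mu> U ..
sublocale mu_mu: pair_sigma_finite \<mu> \<mu> ..
sublocale U_U: pair_prob_space U U ..

lemma space_mu [simp]: "space \<mu> = UNIV" and space_U [simp]: "space U = UNIV"
  using sets_eq_imp_space_eq[OF sets_mu] sets_eq_imp_space_eq[OF sets_U] by auto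

lemma emeasure_mu_UNIV [simp]: "emeasure \<mu> UNIV = 1" and emeasure_U_UNIV [simp]: "emeasure U UNIV = 1"
  using mu.emeasure_space_1 U.emeasure_space_1 by simp_all

lemma nn_integral_mu_left:
  assumes [measurable]: "F \<in> borel_measurable borel" and "g \<in> G"
  shows "(\<integral>\<^sup>+R. F (g ** R) \<partial>\<mu>) = (\<integral>\<^sup>+R. F R \<partial>\<mu>)"
  by (subst (2) inv_mu[OF assms(2), symmetric]) (simp add: nn_integral_distr)

text \<open>Integrate \<open>F (ctr S ** R)\<close> over both variables. Left invariance in
  \<open>R\<close> yields the integral of \<open>F\<close>; after rewriting the argument as
  \<open>ctr (ctr R ** S)\<close>, left invariance in \<open>S\<close> yields the integral of
  \<open>F (ctr S)\<close>.\<close>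

lemma nn_integral_mu_ctr:
  assumes [measurable]: "F \<in> borel_measurable borel"
  shows "(\<integral>\<^sup>+R. F (ctr R) \<partial>\<mu>) = (\<integral>\<^sup>+R. F R \<partial>\<mu>)"
proof -
  have "(\<integral>\<^sup>+R. F R \<partial>\<mu>) = (\<integral>\<^sup>+S. (\<integral>\<^sup>+R. F R \<partial>\<mu>) \<partial>\<mu>)"
    by simp
  also have "\<dots> = (\<integral>\<^sup>+S. (\<integral>\<^sup>+R. F (ctr S ** R) \<partial>\<mu>) \<partial>\<mu>)"
    by (rule nn_integral_cong_AE) (use AE_mu in eventually_elim, simp add: nn_integral_mu_left G_ctr)
  also have "\<dots> = (\<integral>\<^sup>+R. (\<integral>\<^sup>+S. F (ctr S ** R) \<partial>\<mu>) \<partial>\<mu>)"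
    by (rule mu_mu.Fubini') measurable
  also have "\<dots> = (\<integral>\<^sup>+R. (\<integral>\<^sup>+S. F (ctr (ctr R ** S)) \<partial>\<mu>) \<partial>\<mu>)"
    by (simp add: ctr_mult)
  also have "\<dots> = (\<integral>\<^sup>+R. (\<integral>\<^sup>+S. F (ctr S) \<partial>\<mu>) \<partial>\<mu>)"
  proof (rule nn_integral_cong_AE)
    have *: "(\<integral>\<^sup>+S. F (ctr (ctr R ** S)) \<partial>\<mu>) = (\<integral>\<^sup>+S. F (ctr S) \<partial>\<mu>)" if "R \<in> G" for R
      by (rule nn_integral_mu_left[of "\<lambda>S. F (ctr S)"]) (use that in \<open>simp_all add: G_ctr\<close>)
    show "AE R in \<mu>. (\<integral>\<^sup>+S. F (ctr (ctr R ** S)) \<partial>\<mu>) = (\<integral>\<^sup>+S. F (ctr S) \<partial>\<mu>)"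
      using AE_mu by eventually_elim (rule *)
  qed
  also have "\<dots> = (\<integral>\<^sup>+S. F (ctr S) \<partial>\<mu>)"
    by simp
  finally show ?thesis ..
qed

text \<open>Inversion exchanges right and left translations.\<close>

lemma nn_integral_mu_right:
  assumes [measurable]: "F \<in> borel_measurable borel" and "g \<in> G"
  shows "(\<integral>\<^sup>+R. F (R ** g) \<partial>\<mu>) = (\<integral>\<^sup>+R. F R \<partial>\<mu>)"
proof -
  have "(\<integral>\<^sup>+R. F (R ** g) \<partial>\<mu>) = (\<integral>\<^sup>+R. F (ctr R ** g) \<partial>\<mu>)"
    by (rule nn_integral_mu_ctr[symmetric]) measurable
  also have "\<dots> = (\<integral>\<^sup>+R. F (ctr (ctr g ** R)) \<partial>\<mu>)"
    by (simp add: ctr_mult)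
  also have "\<dots> = (\<integral>\<^sup>+R. F (ctr R) \<partial>\<mu>)"
    by (rule nn_integral_mu_left[of "\<lambda>S. F (ctr S)"]) (use assms in \<open>simp_all add: G_ctr\<close>)
  also have "\<dots> = (\<integral>\<^sup>+R. F R \<partial>\<mu>)"
    by (rule nn_integral_mu_ctr) measurable
  finally show ?thesis .
qed

lemma nn_integral_U:
  assumes [measurable]: "F \<in> borel_measurable borel" and "g \<in> G"
  shows "(\<integral>\<^sup>+x. F (g *v x) \<partial>U) = (\<integral>\<^sup>+x. F x \<partial>U)"
  by (subst (2) inv_U[OF assms(2), symmetric]) (simp add: nn_integral_distr)

lemma integral_U:
  fixes F :: "'a ^ 'n \<Rightarrow> real"
  assumes [measurable]: "F \<in> borel_measurable borel" and "g \<in> G"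
  shows "(\<integral>x. F (g *v x) \<partial>U) = (\<integral>x. F x \<partial>U)"
  by (subst (2) inv_U[OF assms(2), symmetric]) (simp add: integral_distr)

lemma ex_axes: obtains i j :: 'n where "i \<noteq> j"
proof -
  have "\<not> (\<forall>i j :: 'n. i = j)"
  proof
    assume *: "\<forall>i j :: 'n. i = j"
    then have "(UNIV :: 'n set) = {undefined}" by auto
    then have "CARD('n) = card {undefined :: 'n}" by (rule arg_cong)
    with card show False by simp
  qed
  then show ?thesis using that by blast
qed

text \<open>There are infinitely many pairwise nonparallel unit vectors. The sets of nonzero vectors
  on the lines they span are disjoint and, by rotation invariance, have equal measure, which a
  finite measure allows only if this measure is 0.\<close>

lemma AE_rej:
  assumes x: "norm x = 1"
  shows "AE z in U. rej x z \<noteq> 0"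
proof -
  obtain i j :: 'n where ij: "i \<noteq> j" by (rule ex_axes)
  \<comment> \<open>The quotient of the coordinates \<open>j\<close> and \<open>i\<close> of any
    nonzero multiple of \<open>y t\<close> recovers \<open>t\<close>, so distinct \<open>t\<close>
    give distinct lines.\<close>
  define y where "y t = axis i 1 + of_real (real t) *s axis j (1 :: 'a)" for t
  have yi: "y t $ i = 1" and yj: "y t $ j = of_real (real t)" for t
    using ij by (auto simp: y_def axis_def)
  have y0: "y t \<noteq> 0" for t
    using yi[of t] by (metis zero_index zero_neq_one)
  define v where "v t = (1 / norm (y t)) *\<^sub>R y t" for t
  have v: "norm (v t) = 1" for t
    using y0 by (simp add: v_def)
  define N where "N t = {z. rej (v t) z = 0 \<and> z \<noteq> 0}" for t
  have [measurable]: "N t \<in> sets borel" for t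
    unfolding N_def by measurable
  have N_ratio: "z $ i \<noteq> 0 \<and> z $ j = of_real (real t) * z $ i" if z: "z \<in> N t" for t z
  proof -
    define c where "c = h z (v t) * of_real (1 / norm (y t))"
    have "z = h z (v t) *s v t" and "z \<noteq> 0" using z by (auto simp: N_def rej_def)
    moreover have "h z (v t) *s v t = c *s y t"
      by (simp add: v_def c_def scaleR_eq_vscale)
    ultimately have zc: "z = c *s y t" and "c \<noteq> 0" by auto
    have "z $ i = c" "z $ j = of_real (real t) * c"
      unfolding zc by (simp_all add: yi yj)
    with \<open>c \<noteq> 0\<close> show ?thesis by simp
  qed
  have disj: "disjoint_family N"
    unfolding disjoint_family_on_def
  proof (intro ballI impI)
    fix s t :: nat assume "s \<noteq> t"
    show "N s \<inter> N t = {}"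
    proof (rule ccontr)
      assume "N s \<inter> N t \<noteq> {}"
      then obtain z where "z \<in> N s" "z \<in> N t" by blast
      from N_ratio[OF this(1)] N_ratio[OF this(2)]
      have "(of_real (real s) :: 'a) = of_real (real t)" by simp
      then have "real s = real t" by (simp only: of_real_eq_iff)
      with \<open>s \<noteq> t\<close> show False by simp
    qed
  qed
  have const: "measure U (N t) = measure U {z. rej x z = 0 \<and> z \<noteq> 0}" for t
  proof -
    obtain A where A: "A \<in> G" "A *v x = v t" using ex_reflect x v by metis
    have eq: "A *v z \<in> N t \<longleftrightarrow> rej x z = 0 \<and> z \<noteq> 0" for z
    proof -
      have "rej (v t) (A *v z) = 0 \<longleftrightarrow> rej x z = 0"
        using norm_G[OF A(1), of "rej x z"] G_rej[OF A(1), of x z] A(2) by (metis norm_eq_zero)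
      moreover have "A *v z = 0 \<longleftrightarrow> z = 0"
        using norm_G[OF A(1), of z] by (metis norm_eq_zero)
      ultimately show ?thesis by (simp add: N_def)
    qed
    have "measure U (N t) = measure (distr U borel ((*v) A)) (N t)"
      by (simp add: inv_U A)
    also have "\<dots> = measure U ((*v) A -` N t \<inter> space U)"
      by (rule measure_distr) measurable
    also have "(*v) A -` N t \<inter> space U = {z. rej x z = 0 \<and> z \<noteq> 0}"
      using eq by auto
    finally show ?thesis .
  qed
  have "(\<lambda>t. measure U (N t)) sums measure U (\<Union>t. N t)"
    by (rule U.finite_measure_UNION) (use disj in auto)
  then have "summable (\<lambda>t::nat. measure U {z. rej x z = 0 \<and> z \<noteq> 0})"
    by (simp add: const sums_iff)
  then have "measure U {z. rej x z = 0 \<and> z \<noteq> 0} = 0"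
    by (simp add: summable_const_iff)
  then have "AE z in U. \<not> (rej x z = 0 \<and> z \<noteq> 0)"
    by (subst (asm) U.prob_eq_0) auto
  with AE_U show ?thesis by eventually_elim auto
qed

lemma ex_orthogonal:
  assumes "norm x = 1" obtains y :: "'a ^ 'n" where "norm y = 1" "h x y = 0"
proof -
  have "\<exists>z. rej x z \<noteq> 0"
    using AE_rej[OF assms] U.AE_False by (metis (mono_tags, lifting) eventually_mono)
  then obtain z where "rej x z \<noteq> 0" by blast
  then show ?thesis using that[of "Y x z"] norm_Y h_Y assms by blast
qed

text \<open>By right invariance the left hand side does not depend on the orthonormal pair; average it over
  the pairs \<open>(x, Y x z)\<close> and use the rotation invariance of \<open>U\<close>.\<close>

lemma nn_integral_pair:
  assumes [measurable]: "\<Phi> \<in> borel_measurable borel"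
    and xy: "norm x = 1" "norm y = 1" "h x y = 0"
  shows "(\<integral>\<^sup>+R. \<Phi> (R *v x, R *v y) \<partial>\<mu>) = (\<integral>\<^sup>+x. (\<integral>\<^sup>+z. \<Phi> (x, Y x z) \<partial>U) \<partial>U)"
proof -
  have const: "(\<integral>\<^sup>+R. \<Phi> (R *v x', R *v y') \<partial>\<mu>) = (\<integral>\<^sup>+R. \<Phi> (R *v x, R *v y) \<partial>\<mu>)"
    if xy': "norm x' = 1" "norm y' = 1" "h x' y' = 0" for x' y'
  proof -
    obtain A where A: "A \<in> G" "A *v x = x'" "A *v y = y'" using ex_G_pair[OF xy xy'] by blast
    show ?thesis
      using nn_integral_mu_right[of "\<lambda>R. \<Phi> (R *v x, R *v y)", OF _ A(1)]
      by (simp add: matrix_vector_mul_assoc[symmetric] A)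
  qed
  have "(\<integral>\<^sup>+x. (\<integral>\<^sup>+z. \<Phi> (x, Y x z) \<partial>U) \<partial>U) = (\<integral>\<^sup>+R. (\<integral>\<^sup>+x. (\<integral>\<^sup>+z. \<Phi> (x, Y x z) \<partial>U) \<partial>U) \<partial>\<mu>)"
    by simp
  also have "\<dots> = (\<integral>\<^sup>+R. (\<integral>\<^sup>+x. (\<integral>\<^sup>+z. \<Phi> (R *v x, R *v Y x z) \<partial>U) \<partial>U) \<partial>\<mu>)"
  proof (rule nn_integral_cong_AE)
    have *: "(\<integral>\<^sup>+x. (\<integral>\<^sup>+z. \<Phi> (x, Y x z) \<partial>U) \<partial>U) = (\<integral>\<^sup>+x. (\<integral>\<^sup>+z. \<Phi> (R *v x, R *v Y x z) \<partial>U) \<partial>U)"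
      if R: "R \<in> G" for R
    proof -
      have "(\<integral>\<^sup>+x. (\<integral>\<^sup>+z. \<Phi> (x, Y x z) \<partial>U) \<partial>U) = (\<integral>\<^sup>+x. (\<integral>\<^sup>+z. \<Phi> (R *v x, Y (R *v x) z) \<partial>U) \<partial>U)"
        by (rule nn_integral_U[OF _ R, symmetric]) measurable
      also have "\<dots> = (\<integral>\<^sup>+x. (\<integral>\<^sup>+z. \<Phi> (R *v x, Y (R *v x) (R *v z)) \<partial>U) \<partial>U)"
        by (intro nn_integral_cong nn_integral_U[OF _ R, symmetric]) measurable
      finally show ?thesis by (simp add: G_Y R)
    qed
    show "AE R in \<mu>. (\<integral>\<^sup>+x. (\<integral>\<^sup>+z. \<Phi> (x, Y x z) \<partial>U) \<partial>U) =
        (\<integral>\<^sup>+x. (\<integral>\<^sup>+z. \<Phi> (R *v x, R *v Y x z) \<partial>U) \<partial>U)"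
      using AE_mu by eventually_elim (rule *)
  qed
  also have "\<dots> = (\<integral>\<^sup>+x. (\<integral>\<^sup>+R. (\<integral>\<^sup>+z. \<Phi> (R *v x, R *v Y x z) \<partial>U) \<partial>\<mu>) \<partial>U)"
    by (rule mu_U.Fubini'[symmetric]) measurable
  also have "\<dots> = (\<integral>\<^sup>+x. (\<integral>\<^sup>+z. (\<integral>\<^sup>+R. \<Phi> (R *v x, R *v Y x z) \<partial>\<mu>) \<partial>U) \<partial>U)"
    by (intro nn_integral_cong mu_U.Fubini'[symmetric]) measurable
  also have "\<dots> = (\<integral>\<^sup>+x'. (\<integral>\<^sup>+z. (\<integral>\<^sup>+R. \<Phi> (R *v x, R *v y) \<partial>\<mu>) \<partial>U) \<partial>U)"
  proof (rule nn_integral_cong_AE)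
    have *: "(\<integral>\<^sup>+z. (\<integral>\<^sup>+R. \<Phi> (R *v x', R *v Y x' z) \<partial>\<mu>) \<partial>U) =
          (\<integral>\<^sup>+z. (\<integral>\<^sup>+R. \<Phi> (R *v x, R *v y) \<partial>\<mu>) \<partial>U)" if x': "norm x' = 1" for x'
      by (rule nn_integral_cong_AE)
         (use AE_rej[OF x'] in eventually_elim, simp add: const norm_Y h_Y x')
    show "AE x' in U. (\<integral>\<^sup>+z. (\<integral>\<^sup>+R. \<Phi> (R *v x', R *v Y x' z) \<partial>\<mu>) \<partial>U) =
          (\<integral>\<^sup>+z. (\<integral>\<^sup>+R. \<Phi> (R *v x, R *v y) \<partial>\<mu>) \<partial>U)"
      using AE_U by eventually_elim (rule *)
  qed
  also have "\<dots> = (\<integral>\<^sup>+R. \<Phi> (R *v x, R *v y) \<partial>\<mu>)"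
    by simp
  finally show ?thesis ..
qed

text \<open>The first marginal of \<open>nn_integral_pair\<close>, with some unit vector orthogonal
  to \<open>x\<close> as the partner.\<close>

lemma distr_mu_U:
  assumes x: "norm x = 1"
  shows "distr \<mu> borel (\<lambda>R. R *v x) = U"
proof (rule measure_eqI)
  fix A assume "A \<in> sets (distr \<mu> borel (\<lambda>R. R *v x))"
  then have [measurable]: "A \<in> sets borel" by simp
  obtain y :: "'a ^ 'n" where y: "norm y = 1" "h x y = 0" using ex_orthogonal[OF x] .
  have [measurable]: "(fst :: ('a ^ 'n) \<times> ('a ^ 'n) \<Rightarrow> _) \<in> borel_measurable borel"
    by (intro borel_measurable_continuous_onI continuous_intros)
  have "emeasure (distr \<mu> borel (\<lambda>R. R *v x)) A = (\<integral>\<^sup>+R. indicator A (fst (R *v x, R *v y)) \<partial>\<mu>)"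
    by (subst emeasure_distr_nn_integral) simp_all
  also have "\<dots> = (\<integral>\<^sup>+x. (\<integral>\<^sup>+z. indicator A (fst (x, Y x z)) \<partial>U) \<partial>U)"
    by (rule nn_integral_pair[OF _ x y]) measurable
  also have "\<dots> = emeasure U A"
    by simp
  finally show "emeasure (distr \<mu> borel (\<lambda>R. R *v x)) A = emeasure U A" .
qed simp

text \<open>Indicator functions in \<open>nn_integral_pair\<close> identify the law of the random
  pair with that of \<open>(x, Y x z)\<close>. Equal laws then give equal Bochner integrals, and
  Fubini splits the right hand side.\<close>

lemma integral_pair:
  fixes \<Phi> :: "('a ^ 'n) \<times> ('a ^ 'n) \<Rightarrow> real"
  assumes [measurable]: "\<Phi> \<in> borel_measurable borel"
    and bd: "\<And>p. \<bar>\<Phi> p\<bar> \<le> C"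
    and xy: "norm x = 1" "norm y = 1" "h x y = 0"
  shows "(\<integral>R. \<Phi> (R *v x, R *v y) \<partial>\<mu>) = (\<integral>x. (\<integral>z. \<Phi> (x, Y x z) \<partial>U) \<partial>U)"
proof -
  have eq: "distr \<mu> borel (\<lambda>R. (R *v x, R *v y)) = distr (U \<Otimes>\<^sub>M U) borel (\<lambda>(x, z). (x, Y x z))"
  proof (rule measure_eqI)
    fix A assume "A \<in> sets (distr \<mu> borel (\<lambda>R. (R *v x, R *v y)))"
    then have [measurable]: "A \<in> sets borel" by simp
    have "emeasure (distr \<mu> borel (\<lambda>R. (R *v x, R *v y))) A = (\<integral>\<^sup>+R. indicator A (R *v x, R *v y) \<partial>\<mu>)"
      by (subst emeasure_distr_nn_integral) simp_all
    also have "\<dots> = (\<integral>\<^sup>+x. (\<integral>\<^sup>+z. indicator A (x, Y x z) \<partial>U) \<partial>U)"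
      by (rule nn_integral_pair[OF _ xy]) measurable
    also have "\<dots> = (\<integral>\<^sup>+p. indicator A (case p of (x, z) \<Rightarrow> (x, Y x z)) \<partial>(U \<Otimes>\<^sub>M U))"
      by (subst U.nn_integral_fst[symmetric]) simp_all
    also have "\<dots> = emeasure (distr (U \<Otimes>\<^sub>M U) borel (\<lambda>(x, z). (x, Y x z))) A"
      by (subst emeasure_distr_nn_integral) simp_all
    finally show "emeasure (distr \<mu> borel (\<lambda>R. (R *v x, R *v y))) A =
        emeasure (distr (U \<Otimes>\<^sub>M U) borel (\<lambda>(x, z). (x, Y x z))) A" .
  qed simp
  have "(\<integral>R. \<Phi> (R *v x, R *v y) \<partial>\<mu>) = integral\<^sup>L (distr \<mu> borel (\<lambda>R. (R *v x, R *v y))) \<Phi>"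
    by (simp add: integral_distr)
  also have "\<dots> = (\<integral>p. \<Phi> (case p of (x, z) \<Rightarrow> (x, Y x z)) \<partial>(U \<Otimes>\<^sub>M U))"
    unfolding eq by (rule integral_distr) measurable
  also have "\<dots> = (\<integral>p. (case p of (x, z) \<Rightarrow> \<Phi> (x, Y x z)) \<partial>(U \<Otimes>\<^sub>M U))"
    by (simp add: case_prod_beta)
  also have "\<dots> = (\<integral>x. (\<integral>z. \<Phi> (x, Y x z) \<partial>U) \<partial>U)"
    by (rule U_U.integral_fst[symmetric], rule U_U.integrable_const_bound[of _ C]) (auto simp: bd)
  finally show ?thesis .
qed

end


section \<open>Averaging over the orthogonal complement\<close>

text \<open>The integral of \<open>(f x - t * g x)\<^sup>2\<close> is a nonnegative quadratic
  polynomial in \<open>t\<close>; its value at the minimum \<open>t = I / H\<close> gives the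
  bound.\<close>

lemma Cauchy_Schwarz_integral:
  fixes f g :: "'b \<Rightarrow> real"
  assumes f: "integrable M (\<lambda>x. (f x)\<^sup>2)" and g: "integrable M (\<lambda>x. (g x)\<^sup>2)"
    and fg: "integrable M (\<lambda>x. f x * g x)"
  shows "(\<integral>x. f x * g x \<partial>M)\<^sup>2 \<le> (\<integral>x. (f x)\<^sup>2 \<partial>M) * (\<integral>x. (g x)\<^sup>2 \<partial>M)"
proof -
  define F I H where "F = (\<integral>x. (f x)\<^sup>2 \<partial>M)" and "I = (\<integral>x. f x * g x \<partial>M)" and "H = (\<integral>x. (g x)\<^sup>2 \<partial>M)"
  have quad: "0 \<le> F - 2 * t * I + t\<^sup>2 * H" for t
  proof -
    have "0 \<le> (\<integral>x. (f x - t * g x)\<^sup>2 \<partial>M)" by simp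
    also have "(\<lambda>x. (f x - t * g x)\<^sup>2) = (\<lambda>x. (f x)\<^sup>2 - (2 * t) * (f x * g x) + t\<^sup>2 * (g x)\<^sup>2)"
      by (simp add: fun_eq_iff power2_eq_square algebra_simps)
    also have "(\<integral>x. (f x)\<^sup>2 - (2 * t) * (f x * g x) + t\<^sup>2 * (g x)\<^sup>2 \<partial>M) = F - 2 * t * I + t\<^sup>2 * H"
      using f g fg by (simp add: F_def I_def H_def)
    finally show ?thesis .
  qed
  have "I\<^sup>2 \<le> F * H"
  proof (cases "H = 0")
    case True
    have "I = 0"
    proof (rule ccontr)
      assume "I \<noteq> 0"
      \<comment> \<open>Without the quadratic term the polynomial is affine in \<open>t\<close>, and
        at this \<open>t\<close> its value is -1.\<close>
      then show False using quad[of "(F + 1) / (2 * I)"] True by simp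
    qed
    then show ?thesis using True by simp
  next
    case False
    moreover have "0 \<le> H" by (simp add: H_def)
    ultimately have "0 < H" by simp
    have "F - 2 * (I / H) * I + (I / H)\<^sup>2 * H = F - I\<^sup>2 / H"
      using False by (simp add: power2_eq_square field_simps)
    then have "I\<^sup>2 / H \<le> F" using quad[of "I / H"] by simp
    then show ?thesis using \<open>0 < H\<close> by (simp add: field_simps)
  qed
  then show ?thesis by (simp add: F_def I_def H_def)
qed

text \<open>Log-convexity makes the ratios of successive terms nondecreasing. A first ratio
  \<open>r\<close> above \<open>q\<close> would therefore force growth at least like
  \<open>r ^ n\<close>, which outruns \<open>C * q ^ n\<close> for every \<open>C\<close>.\<close>

lemma log_convex_bounded_imp_ratio_le:
  fixes a :: "nat \<Rightarrow> real"
  assumes nonneg: "\<And>n. 0 \<le> a n" and conv: "\<And>n. (a (Suc n))\<^sup>2 \<le> a n * a (Suc (Suc n))"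
    and bd: "\<And>n. a n \<le> C * q ^ n" and q: "0 < q"
  shows "a 1 \<le> q * a 0"
proof (rule ccontr)
  assume "\<not> a 1 \<le> q * a 0"
  then have gt: "q * a 0 < a 1" by simp
  have a0: "0 < a 0"
  proof (rule ccontr)
    assume "\<not> 0 < a 0"
    then have "a 0 = 0" using nonneg[of 0] by simp
    then show False using conv[of 0] gt by simp
  qed
  define r where "r = a 1 / a 0"
  have r: "q < r" using gt a0 by (simp add: r_def field_simps)
  have step: "0 < a n \<and> r * a n \<le> a (Suc n)" for n
  proof (induction n)
    case 0
    then show ?case using a0 by (simp add: r_def)
  next
    case (Suc n)
    then have pos: "0 < a (Suc n)" using r q
      by (meson less_le_trans mult_pos_pos order_less_trans)
    have "r * a n * a (Suc n) \<le> a (Suc n) * a (Suc n)"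
      using Suc pos by (intro mult_right_mono) auto
    also have "\<dots> \<le> a n * a (Suc (Suc n))" using conv[of n] by (simp add: power2_eq_square)
    finally have "a n * (r * a (Suc n)) \<le> a n * a (Suc (Suc n))" by (simp add: mult_ac)
    then show ?case using pos Suc by simp
  qed
  have low: "a 0 * r ^ n \<le> a n" for n
  proof (induction n)
    case (Suc n)
    have "a 0 * r ^ Suc n = r * (a 0 * r ^ n)" by simp
    also have "\<dots> \<le> r * a n" using Suc r q by (intro mult_left_mono) auto
    also have "\<dots> \<le> a (Suc n)" using step by blast
    finally show ?case .
  qed simp
  have "1 < r / q" using r q by simp
  then obtain n where n: "C / a 0 < (r / q) ^ n" using real_arch_pow by blast
  have "a 0 * r ^ n \<le> C * q ^ n" using low bd order_trans by blast
  then have "(r / q) ^ n \<le> C / a 0" using q a0 by (simp add: power_divide field_simps)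
  with n show False by simp
qed

text \<open>Boundedness everywhere, not just almost everywhere, keeps this class stable under
  products, compositions and the operators \<open>T\<close> and \<open>K\<close>, so integrability
  against \<open>U\<close> follows from closure rules.\<close>

definition bounded_borel :: "('b::topological_space \<Rightarrow> real) \<Rightarrow> bool" where
  "bounded_borel f \<longleftrightarrow> f \<in> borel_measurable borel \<and> (\<exists>C. \<forall>x. \<bar>f x\<bar> \<le> C)"

lemma bounded_borelI: "f \<in> borel_measurable borel \<Longrightarrow> (\<And>x. \<bar>f x\<bar> \<le> C) \<Longrightarrow> bounded_borel f"
  by (auto simp: bounded_borel_def)

lemma bounded_borelE:
  assumes "bounded_borel f"
  obtains C where "f \<in> borel_measurable borel" "\<And>x. \<bar>f x\<bar> \<le> C" "0 \<le> C"
  using assms unfolding bounded_borel_def by (metis abs_ge_zero order_trans)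

lemma bounded_borel_measurable [measurable_dest]: "bounded_borel f \<Longrightarrow> f \<in> borel_measurable borel"
  by (auto simp: bounded_borel_def)

lemma bounded_borel_const: "bounded_borel (\<lambda>x. c)"
  by (rule bounded_borelI[of _ "\<bar>c\<bar>"]) auto

lemma bounded_borel_mult:
  assumes "bounded_borel f" "bounded_borel g" shows "bounded_borel (\<lambda>x. f x * g x)"
proof -
  obtain C where [measurable]: "f \<in> borel_measurable borel" and C: "\<And>x. \<bar>f x\<bar> \<le> C" "0 \<le> C"
    using bounded_borelE[OF assms(1)] by blast
  obtain D where [measurable]: "g \<in> borel_measurable borel" and D: "\<And>x. \<bar>g x\<bar> \<le> D" "0 \<le> D"
    using bounded_borelE[OF assms(2)] by blast
  show ?thesis
    by (rule bounded_borelI[of _ "C * D"]) (auto simp: abs_mult intro!: mult_mono C D)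
qed

lemma bounded_borel_diff:
  assumes "bounded_borel f" "bounded_borel g" shows "bounded_borel (\<lambda>x. f x - g x)"
proof -
  obtain C where [measurable]: "f \<in> borel_measurable borel" and C: "\<And>x. \<bar>f x\<bar> \<le> C"
    using bounded_borelE[OF assms(1)] by blast
  obtain D where [measurable]: "g \<in> borel_measurable borel" and D: "\<And>x. \<bar>g x\<bar> \<le> D"
    using bounded_borelE[OF assms(2)] by blast
  have "\<bar>f x - g x\<bar> \<le> C + D" for x
    using C[of x] D[of x] by linarith
  then show ?thesis
    by (intro bounded_borelI[of _ "C + D"]) auto
qed

lemma bounded_borel_power2: "bounded_borel f \<Longrightarrow> bounded_borel (\<lambda>x. (f x)\<^sup>2)"
  unfolding power2_eq_square by (rule bounded_borel_mult)

lemma bounded_borel_abs: "bounded_borel f \<Longrightarrow> bounded_borel (\<lambda>x. \<bar>f x\<bar>)"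
  by (elim bounded_borelE, rule bounded_borelI) auto

lemma bounded_borel_compose:
  assumes "bounded_borel f" and [measurable]: "g \<in> borel_measurable borel"
  shows "bounded_borel (\<lambda>x. f (g x))"
proof -
  obtain C where [measurable]: "f \<in> borel_measurable borel" and "\<And>x. \<bar>f x\<bar> \<le> C"
    using bounded_borelE[OF assms(1)] by blast
  then show ?thesis by (intro bounded_borelI[of _ C]) auto
qed

section \<open>The operator \<open>T\<close>: self-adjointness, and contraction from decay of its
  powers\<close>

context haar_sphere
begin

lemma prob_U_UNIV [simp]: "measure U UNIV = 1"
  using U.prob_space by simp

lemma integrable_bounded_borel: "bounded_borel \<phi> \<Longrightarrow> integrable U \<phi>"
  by (elim bounded_borelE, rule U.integrable_const_bound) auto

lemma integrable_pair_bounded_borel: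
  fixes \<Phi> :: "'a ^ 'n \<Rightarrow> 'a ^ 'n \<Rightarrow> real"
  assumes [measurable]: "case_prod \<Phi> \<in> borel_measurable (U \<Otimes>\<^sub>M U)" and "\<And>x y. \<bar>\<Phi> x y\<bar> \<le> C"
  shows "integrable (U \<Otimes>\<^sub>M U) (case_prod \<Phi>)"
  by (rule U_U.integrable_const_bound[of _ C]) (use assms in auto)

lemma abs_integral_le:
  assumes "bounded_borel \<phi>" "AE x in U. \<bar>\<phi> x\<bar> \<le> C"
  shows "\<bar>\<integral>x. \<phi> x \<partial>U\<bar> \<le> C"
proof -
  have "\<bar>\<integral>x. \<phi> x \<partial>U\<bar> \<le> (\<integral>x. \<bar>\<phi> x\<bar> \<partial>U)" by simp
  also have "\<dots> \<le> (\<integral>x. C \<partial>U)"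
    by (rule integral_mono_AE) (use assms in \<open>auto intro!: integrable_bounded_borel bounded_borel_abs\<close>)
  finally show ?thesis by simp
qed

lemma h_axis: "h (axis j 1) y = cj (y $ j)" "h y (axis j 1) = y $ j"
proof -
  show *: "h y (axis j 1) = y $ j"
  proof -
    have "h y (axis j 1) = (\<Sum>i\<in>UNIV. if i = j then y $ i else 0)"
      unfolding h_def by (intro sum.cong) (auto simp: axis_def)
    then show ?thesis by simp
  qed
  show "h (axis j 1) y = cj (y $ j)" using h_commute[of "axis j 1" y] * by simp
qed

lemma norm_axis_one [simp]: "norm (axis i (1::'a)) = 1"
  by (rule norm_eq_1_if_h_self) (simp add: h_axis)

text \<open>The conditional mean of \<phi> at the second vector of a uniformly random orthonormal
  pair, given that the first one is \<open>x\<close>.\<close>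

definition T :: "('a ^ 'n \<Rightarrow> real) \<Rightarrow> 'a ^ 'n \<Rightarrow> real" where
  "T \<phi> x = (\<integral>z. \<phi> (Y x z) \<partial>U)"

lemma bounded_borel_comp_Y: "bounded_borel \<phi> \<Longrightarrow> bounded_borel (\<lambda>z. \<phi> (Y x z))"
  by (rule bounded_borel_compose) measurable

lemma bounded_borel_T: assumes "bounded_borel \<phi>" shows "bounded_borel (T \<phi>)"
proof -
  obtain C where C[measurable]: "\<phi> \<in> borel_measurable borel" and "\<And>x. \<bar>\<phi> x\<bar> \<le> C"
    using bounded_borelE[OF assms] by blast
  then show ?thesis
    by (intro bounded_borelI[of _ C])
       (unfold T_def, measurable, intro abs_integral_le bounded_borel_comp_Y assms, auto)
qed

lemma T_cong:
  assumes "bounded_borel \<phi>" "bounded_borel \<psi>" "\<And>x. norm x = 1 \<Longrightarrow> \<phi> x = \<psi> x" "norm x = 1"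
  shows "T \<phi> x = T \<psi> x"
  unfolding T_def
proof (rule integral_cong_AE)
  show "AE z in U. \<phi> (Y x z) = \<psi> (Y x z)"
    using AE_rej[OF assms(4)] by eventually_elim (simp add: assms(3) norm_Y)
qed (use bounded_borel_measurable[OF assms(1)] bounded_borel_measurable[OF assms(2)] in measurable)

lemma T_diff_bound:
  assumes "bounded_borel \<phi>" "bounded_borel \<psi>" "\<And>x. norm x = 1 \<Longrightarrow> \<bar>\<phi> x - \<psi> x\<bar> \<le> e" "norm x = 1"
  shows "\<bar>T \<phi> x - T \<psi> x\<bar> \<le> e"
proof -
  have "T \<phi> x - T \<psi> x = (\<integral>z. \<phi> (Y x z) - \<psi> (Y x z) \<partial>U)"
    unfolding T_def
    by (rule Bochner_Integration.integral_diff[symmetric];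
        intro integrable_bounded_borel bounded_borel_comp_Y assms(1,2))
  also have "\<bar>\<dots>\<bar> \<le> e"
  proof (rule abs_integral_le)
    show "AE z in U. \<bar>\<phi> (Y x z) - \<psi> (Y x z)\<bar> \<le> e"
      using AE_rej[OF assms(4)] by eventually_elim (simp add: assms(3) norm_Y)
  qed (intro bounded_borel_diff bounded_borel_comp_Y assms(1,2))
  finally show ?thesis .
qed

text \<open>The link between the random frame and \<open>T\<close>: \<open>integral_pair\<close> for
  the product of \<phi> at the first and \<psi> at the second vector.\<close>

lemma integral_T:
  assumes "bounded_borel \<phi>" "bounded_borel \<psi>" and xy: "norm x = 1" "norm y = 1" "h x y = 0"
  shows "(\<integral>R. \<phi> (R *v x) * \<psi> (R *v y) \<partial>\<mu>) = (\<integral>x. \<phi> x * T \<psi> x \<partial>U)"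
proof -
  obtain C where [measurable]: "\<phi> \<in> borel_measurable borel" and C: "\<And>x. \<bar>\<phi> x\<bar> \<le> C" "0 \<le> C"
    using bounded_borelE[OF assms(1)] by blast
  obtain D where [measurable]: "\<psi> \<in> borel_measurable borel" and D: "\<And>x. \<bar>\<psi> x\<bar> \<le> D"
    using bounded_borelE[OF assms(2)] by blast
  have [measurable]: "(fst :: ('a ^ 'n) \<times> ('a ^ 'n) \<Rightarrow> _) \<in> borel_measurable borel"
    "(snd :: ('a ^ 'n) \<times> ('a ^ 'n) \<Rightarrow> _) \<in> borel_measurable borel"
    by (intro borel_measurable_continuous_onI continuous_intros)+
  have "(\<integral>R. \<phi> (R *v x) * \<psi> (R *v y) \<partial>\<mu>) =
      (\<integral>R. (\<lambda>p. \<phi> (fst p) * \<psi> (snd p)) (R *v x, R *v y) \<partial>\<mu>)" by simp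
  also have "\<dots> = (\<integral>x. (\<integral>z. (\<lambda>p. \<phi> (fst p) * \<psi> (snd p)) (x, Y x z) \<partial>U) \<partial>U)"
    by (rule integral_pair[of _ "C * D", OF _ _ xy])
       (measurable, auto simp: abs_mult intro!: mult_mono C D)
  also have "\<dots> = (\<integral>x. \<phi> x * T \<psi> x \<partial>U)"
    by (simp add: T_def)
  finally show ?thesis .
qed

text \<open>By \<open>integral_T\<close> both sides are expectations over a random orthonormal pair,
  one being the other with the two vectors exchanged; the law does not see the exchange.\<close>

lemma T_self_adjoint:
  assumes "bounded_borel \<phi>" "bounded_borel \<psi>"
  shows "(\<integral>x. \<phi> x * T \<psi> x \<partial>U) = (\<integral>x. T \<phi> x * \<psi> x \<partial>U)"
proof -
  obtain i :: 'n where True by simp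
  have x: "norm (axis i (1::'a)) = 1" by simp
  obtain y where y: "norm y = 1" "h (axis i 1) y = 0" using ex_orthogonal[OF x] .
  have y': "h y (axis i 1) = 0" using y h_commute[of y] by simp
  have "(\<integral>x. \<phi> x * T \<psi> x \<partial>U) = (\<integral>R. \<phi> (R *v axis i 1) * \<psi> (R *v y) \<partial>\<mu>)"
    by (rule integral_T[symmetric]) (use assms x y in auto)
  also have "\<dots> = (\<integral>R. \<psi> (R *v y) * \<phi> (R *v axis i 1) \<partial>\<mu>)"
    by (simp add: mult.commute)
  also have "\<dots> = (\<integral>x. \<psi> x * T \<phi> x \<partial>U)"
    by (rule integral_T) (use assms x y y' in auto)
  finally show ?thesis by (simp add: mult.commute)
qed

text \<open>Self-adjointness tested against the constant 1, which \<open>T\<close> fixes.\<close>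

lemma integral_T_eq: assumes "bounded_borel \<phi>" shows "(\<integral>x. T \<phi> x \<partial>U) = (\<integral>x. \<phi> x \<partial>U)"
proof -
  have "T (\<lambda>_. 1) x = 1" for x by (simp add: T_def)
  then show ?thesis
    using T_self_adjoint[OF bounded_borel_const[of 1] assms] by simp
qed

text \<open>Let \<open>a n\<close> be the squared norm of the \<open>n\<close>-th iterate.
  Self-adjointness writes \<open>a (Suc n)\<close> as the inner product of the iterates
  \<open>n\<close> and \<open>n + 2\<close>, so Cauchy-Schwarz makes \<open>a\<close> log-convex,
  while the decay bounds it by a multiple of \<open>(q\<^sup>2) ^ n\<close>. The constant
  \<open>C\<close> disappears in \<open>log_convex_bounded_imp_ratio_le\<close>.\<close>

lemma T_contraction_if_decay:
  assumes \<phi>: "bounded_borel \<phi>" and q: "0 < q"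
    and decay: "\<And>n x. norm x = 1 \<Longrightarrow> \<bar>(T ^^ n) \<phi> x\<bar> \<le> C * q ^ n"
  shows "(\<integral>x. (T \<phi> x)\<^sup>2 \<partial>U) \<le> q\<^sup>2 * (\<integral>x. (\<phi> x)\<^sup>2 \<partial>U)"
proof -
  define a where "a n = (\<integral>x. ((T ^^ n) \<phi> x)\<^sup>2 \<partial>U)" for n
  have bb: "bounded_borel ((T ^^ n) \<phi>)" for n
    by (induction n) (auto intro: \<phi> bounded_borel_T)
  have "a 1 \<le> q\<^sup>2 * a 0"
  proof (rule log_convex_bounded_imp_ratio_le)
    fix n
    show "0 \<le> a n" by (simp add: a_def)
    have "a (Suc n) = (\<integral>x. T ((T ^^ n) \<phi>) x * (T ^^ Suc n) \<phi> x \<partial>U)"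
      by (simp add: a_def power2_eq_square)
    also have "\<dots> = (\<integral>x. (T ^^ n) \<phi> x * T ((T ^^ Suc n) \<phi>) x \<partial>U)"
      by (rule T_self_adjoint[symmetric]) (rule bb)+
    also have "\<dots> = (\<integral>x. (T ^^ n) \<phi> x * (T ^^ Suc (Suc n)) \<phi> x \<partial>U)" by simp
    finally have eq: "a (Suc n) = (\<integral>x. (T ^^ n) \<phi> x * (T ^^ Suc (Suc n)) \<phi> x \<partial>U)" .
    show "(a (Suc n))\<^sup>2 \<le> a n * a (Suc (Suc n))"
      unfolding eq unfolding a_def
      by (intro Cauchy_Schwarz_integral integrable_bounded_borel bounded_borel_power2
        bounded_borel_mult bb)
    have "a n = \<bar>a n\<bar>" by (simp add: a_def)
    also have "\<dots> \<le> (C * q ^ n)\<^sup>2"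
      unfolding a_def
    proof (rule abs_integral_le)
      show "AE x in U. \<bar>((T ^^ n) \<phi> x)\<^sup>2\<bar> \<le> (C * q ^ n)\<^sup>2"
        using AE_U
      proof eventually_elim
        case (elim x)
        have "\<bar>(T ^^ n) \<phi> x\<bar>\<^sup>2 \<le> (C * q ^ n)\<^sup>2" by (rule power_mono) (use decay elim in auto)
        then show ?case by simp
      qed
    qed (intro bounded_borel_power2 bb)
    also have "(C * q ^ n)\<^sup>2 = C\<^sup>2 * (q\<^sup>2) ^ n"
      by (simp add: power_mult_distrib flip: power_mult) (simp add: mult.commute)
    finally show "a n \<le> C\<^sup>2 * (q\<^sup>2) ^ n" .
  qed (use q in simp)
  then show ?thesis by (simp add: a_def)
qed

text \<open>The mean of \<open>(norm (h v (Y x z)))\<^sup>2\<close> for an orthonormal pair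
  \<open>x\<close>, \<open>v\<close>, as \<open>integral_h_Y\<close> shows.\<close>

definition kappa :: real where "kappa = 1 / (real CARD('n) - 1)"

lemma kappa_pos: "0 < kappa" using card by (simp add: kappa_def)

text \<open>Some group element maps one orthonormal pair to the other; it preserves
  \<open>h\<close>, commutes with \<open>Y\<close> and leaves \<open>U\<close> invariant.\<close>

lemma integral_h_Y_const:
  fixes F :: "real \<Rightarrow> real"
  assumes [measurable]: "F \<in> borel_measurable borel"
    and xv: "norm x = 1" "norm v = 1" "h x v = 0" and xv': "norm x' = 1" "norm v' = 1" "h x' v' = 0"
  shows "(\<integral>z. F ((norm (h v (Y x z)))\<^sup>2) \<partial>U) = (\<integral>z. F ((norm (h v' (Y x' z)))\<^sup>2) \<partial>U)"
proof -
  obtain A where A: "A \<in> G" "A *v x = x'" "A *v v = v'" using ex_G_pair[OF xv xv'] by blast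
  have "(\<integral>z. F ((norm (h v' (Y x' z)))\<^sup>2) \<partial>U) = (\<integral>z. F ((norm (h v' (Y x' (A *v z))))\<^sup>2) \<partial>U)"
    by (rule integral_U[OF _ A(1), symmetric]) measurable
  also have "\<dots> = (\<integral>z. F ((norm (h v (Y x z)))\<^sup>2) \<partial>U)"
    unfolding A(2,3)[symmetric] G_Y[OF A(1), symmetric] h_G[OF A(1)] ..
  finally show ?thesis ..
qed

lemma norm_h_Y_le: "norm v = 1 \<Longrightarrow> (norm (h v (Y x z)))\<^sup>2 \<le> 1"
proof (cases "rej x z = 0")
  case False
  assume "norm v = 1"
  then show ?thesis using norm_h_le[of "Y x z" v] norm_Y[OF False] by simp
qed (simp add: Y_def)

lemma bounded_borel_h_Y: "norm v = 1 \<Longrightarrow> bounded_borel (\<lambda>z. (norm (h v (Y x z)))\<^sup>2)"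
  by (rule bounded_borelI[of _ 1]) (use norm_h_Y_le[of v x] in auto)

text \<open>Take \<open>x\<close> to be the axis \<open>i\<close>. The remaining axes all have the
  same mean by \<open>integral_h_Y_const\<close>, and these means add up to 1, because
  \<open>Y ?x z\<close> is almost surely a unit vector with vanishing coordinate
  \<open>i\<close>.\<close>

lemma integral_h_Y:
  assumes xv: "norm x = 1" "norm v = 1" "h x v = 0"
  shows "(\<integral>z. (norm (h v (Y x z)))\<^sup>2 \<partial>U) = kappa"
proof -
  obtain i :: 'n where True by simp
  let ?x = "axis i (1::'a)"
  have each: "(\<integral>z. (norm (h (axis j 1) (Y ?x z)))\<^sup>2 \<partial>U) = (\<integral>z. (norm (h v (Y x z)))\<^sup>2 \<partial>U)"
    if "j \<in> UNIV - {i}" for j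
  proof (rule integral_h_Y_const[of "\<lambda>s. s"])
    show "h ?x (axis j 1) = 0" using that unfolding h_axis by (auto simp: axis_def)
  qed (use xv in auto)
  have "(real CARD('n) - 1) * (\<integral>z. (norm (h v (Y x z)))\<^sup>2 \<partial>U)
      = (\<Sum>j\<in>UNIV - {i}. (\<integral>z. (norm (h (axis j 1) (Y ?x z)))\<^sup>2 \<partial>U))"
    using card by (simp add: each card_Diff_singleton of_nat_diff)
  also have "\<dots> = (\<integral>z. (\<Sum>j\<in>UNIV - {i}. (norm (h (axis j 1) (Y ?x z)))\<^sup>2) \<partial>U)"
    by (subst Bochner_Integration.integral_sum)
       (auto intro!: integrable_bounded_borel bounded_borel_h_Y)
  also have "\<dots> = (\<integral>z. 1 \<partial>U)"
  proof (rule integral_cong_AE)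
    have "(\<Sum>j\<in>UNIV - {i}. (norm (h (axis j 1) (Y ?x z)))\<^sup>2) = 1" if "rej ?x z \<noteq> 0" for z
    proof -
      have "Y ?x z $ i = 0" using h_Y(1)[of ?x z] by (simp add: h_axis)
      then have "(\<Sum>j\<in>UNIV - {i}. (norm (h (axis j 1) (Y ?x z)))\<^sup>2) = (\<Sum>j\<in>UNIV. (norm (Y ?x z $ j))\<^sup>2)"
        by (subst (2) sum.remove[of _ i]) (auto simp: h_axis)
      also have "\<dots> = (norm (Y ?x z))\<^sup>2"
        by (simp add: norm_vec_def L2_set_def sum_nonneg)
      finally show ?thesis using norm_Y[OF that] by simp
    qed
    then show "AE z in U. (\<Sum>j\<in>UNIV - {i}. (norm (h (axis j 1) (Y ?x z)))\<^sup>2) = 1"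
      using AE_rej[of ?x] by (auto elim!: eventually_mono)
  qed measurable
  finally show ?thesis using card by (simp add: kappa_def field_simps)
qed

end


section \<open>Contraction on mixtures of zonal functions\<close>

text \<open>Imposed on the whole real line, so that the arguments
  \<open>(1 - s) * (norm (h v (Y x z)))\<^sup>2\<close> in \<open>S\<close> below need no range
  check.\<close>

definition bounded_lipschitz :: "real \<Rightarrow> (real \<Rightarrow> real) \<Rightarrow> bool" where
  "bounded_lipschitz L f \<longleftrightarrow> bounded_borel f \<and> (\<forall>s t. \<bar>f s - f t\<bar> \<le> L * \<bar>s - t\<bar>)"

lemma bounded_lipschitz_nonneg: "bounded_lipschitz L f \<Longrightarrow> 0 \<le> L"
  unfolding bounded_lipschitz_def
  by (metis abs_ge_zero abs_one diff_zero mult.right_neutral order_trans)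

context haar_sphere
begin

text \<open>The action of \<open>T\<close> on zonal functions, written in the variable
  \<open>s = (norm (h a y))\<^sup>2\<close>. The parameters stand for any orthonormal pair, and by
  \<open>integral_h_Y_const\<close> the choice of the pair does not matter for Borel
  \<open>f\<close>.\<close>

definition S :: "'a ^ 'n \<Rightarrow> 'a ^ 'n \<Rightarrow> (real \<Rightarrow> real) \<Rightarrow> real \<Rightarrow> real" where
  "S x v f s = (\<integral>z. f ((1 - s) * (norm (h v (Y x z)))\<^sup>2) \<partial>U)"

lemma bounded_borel_comp_h_Y:
  "bounded_borel f \<Longrightarrow> bounded_borel (\<lambda>z. f (c * (norm (h v (Y x z)))\<^sup>2))"
  by (rule bounded_borel_compose) measurable

text \<open>Passing from \<open>s\<close> to \<open>t\<close> moves the argument of \<open>f\<close>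
  by \<open>\<bar>s - t\<bar>\<close> times a random variable whose mean is
  \<open>kappa\<close>.\<close>

lemma bounded_lipschitz_S:
  assumes f: "bounded_lipschitz L f" and xv: "norm x = 1" "norm v = 1" "h x v = 0"
  shows "bounded_lipschitz (L * kappa) (S x v f)"
  unfolding bounded_lipschitz_def
proof (intro conjI allI)
  have bb: "bounded_borel f" and lip: "\<And>s t. \<bar>f s - f t\<bar> \<le> L * \<bar>s - t\<bar>"
    using f by (auto simp: bounded_lipschitz_def)
  obtain C where [measurable]: "f \<in> borel_measurable borel" and C: "\<And>x. \<bar>f x\<bar> \<le> C"
    using bounded_borelE[OF bb] by blast
  show "bounded_borel (S x v f)"
  proof (rule bounded_borelI)
    show "S x v f \<in> borel_measurable borel" unfolding S_def by measurable
    show "\<bar>S x v f s\<bar> \<le> C" for s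
      unfolding S_def by (intro abs_integral_le bounded_borel_comp_h_Y bb) (simp add: C)
  qed
  fix s t
  have "S x v f s - S x v f t =
      (\<integral>z. f ((1 - s) * (norm (h v (Y x z)))\<^sup>2) - f ((1 - t) * (norm (h v (Y x z)))\<^sup>2) \<partial>U)"
    unfolding S_def
    by (rule Bochner_Integration.integral_diff[symmetric];
        intro integrable_bounded_borel bounded_borel_comp_h_Y bb)
  also have "\<bar>\<dots>\<bar> \<le> (\<integral>z. \<bar>f ((1 - s) * (norm (h v (Y x z)))\<^sup>2) - f ((1 - t) * (norm (h v (Y x z)))\<^sup>2)\<bar> \<partial>U)"
    by simp
  also have "\<dots> \<le> (\<integral>z. (L * \<bar>s - t\<bar>) * (norm (h v (Y x z)))\<^sup>2 \<partial>U)"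
  proof (rule integral_mono)
    fix z
    have "(1 - s) * (norm (h v (Y x z)))\<^sup>2 - (1 - t) * (norm (h v (Y x z)))\<^sup>2 =
        - ((s - t) * (norm (h v (Y x z)))\<^sup>2)" by (simp add: algebra_simps)
    then show "\<bar>f ((1 - s) * (norm (h v (Y x z)))\<^sup>2) - f ((1 - t) * (norm (h v (Y x z)))\<^sup>2)\<bar> \<le>
        L * \<bar>s - t\<bar> * (norm (h v (Y x z)))\<^sup>2"
      using lip[of "(1 - s) * (norm (h v (Y x z)))\<^sup>2" "(1 - t) * (norm (h v (Y x z)))\<^sup>2"]
      by (simp add: abs_mult)
  next
    show "integrable U (\<lambda>z. \<bar>f ((1 - s) * (norm (h v (Y x z)))\<^sup>2) - f ((1 - t) * (norm (h v (Y x z)))\<^sup>2)\<bar>)"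
      by (intro integrable_bounded_borel bounded_borel_abs bounded_borel_diff bounded_borel_comp_h_Y bb)
    show "integrable U (\<lambda>z. L * \<bar>s - t\<bar> * (norm (h v (Y x z)))\<^sup>2)"
      by (intro integrable_bounded_borel bounded_borel_mult bounded_borel_const bounded_borel_h_Y xv)
  qed
  also have "\<dots> = L * kappa * \<bar>s - t\<bar>"
    by (simp add: integral_h_Y[OF xv])
  finally show "\<bar>S x v f s - S x v f t\<bar> \<le> L * kappa * \<bar>s - t\<bar>" .
qed

lemma bounded_lipschitz_S_pow:
  assumes "bounded_lipschitz L f" and xv: "norm x = 1" "norm v = 1" "h x v = 0"
  shows "bounded_lipschitz (L * kappa ^ n) ((S x v ^^ n) f)"
proof (induction n)
  case (Suc n)
  then show ?case using bounded_lipschitz_S[OF Suc xv] by (simp add: mult_ac)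
qed (use assms in simp)

text \<open>\<open>Y y z\<close> sees only the component of \<open>a\<close> orthogonal to
  \<open>y\<close>, whose squared norm is \<open>1 - (norm (h a y))\<^sup>2\<close>. Normalized,
  this component forms an orthonormal pair with \<open>y\<close>, which may be exchanged for
  \<open>x\<close>, \<open>v\<close>.\<close>

lemma integral_f_h_Y:
  assumes f: "bounded_borel f" and xv: "norm x = 1" "norm v = 1" "h x v = 0"
    and a: "norm a = 1" and y: "norm y = 1"
  shows "(\<integral>z. f ((norm (h a (Y y z)))\<^sup>2) \<partial>U) = S x v f ((norm (h a y))\<^sup>2)"
proof -
  have [measurable]: "f \<in> borel_measurable borel" using f by (rule bounded_borel_measurable)
  let ?s = "(norm (h a y))\<^sup>2"
  have s: "(norm (rej y a))\<^sup>2 = 1 - ?s" using norm_rej[OF y, of a] a by simp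
  have ha: "h a (Y y z) = h (rej y a) (Y y z)" for z
    by (simp add: rej_def h_diff_left h_scale_left h_Y y)
  show ?thesis
  proof (cases "rej y a = 0")
    \<comment> \<open>Here \<open>a\<close> is a multiple of \<open>y\<close>, and both sides equal
      \<open>f 0\<close>.\<close>
    case True
    then have "1 - ?s = 0" using s by simp
    then show ?thesis by (simp add: ha True S_def)
  next
    case False
    define w where "w = (1 / norm (rej y a)) *\<^sub>R rej y a"
    have w: "norm w = 1" "h y w = 0"
      using False by (simp_all add: w_def h_scaleR_right h_rej y)
    have "rej y a = norm (rej y a) *\<^sub>R w" using False by (simp add: w_def)
    then have "h (rej y a) (Y y z) = of_real (norm (rej y a)) * h w (Y y z)" for z
      by (metis h_scaleR_left)
    then have "(norm (h a (Y y z)))\<^sup>2 = (1 - ?s) * (norm (h w (Y y z)))\<^sup>2" for z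
      by (simp add: ha norm_mult power_mult_distrib s)
    then have "(\<integral>z. f ((norm (h a (Y y z)))\<^sup>2) \<partial>U) = (\<integral>z. f ((1 - ?s) * (norm (h w (Y y z)))\<^sup>2) \<partial>U)"
      by simp
    also have "\<dots> = (\<integral>z. f ((1 - ?s) * (norm (h v (Y x z)))\<^sup>2) \<partial>U)"
      by (rule integral_h_Y_const[of "\<lambda>t. f ((1 - ?s) * t)"]) (use y w xv in simp_all)
    finally show ?thesis by (simp add: S_def)
  qed
qed

text \<open>The mixture of the zonal functions with profile \<open>f\<close> and centers
  \<open>a\<close>, with signed weights \<open>\<phi> a\<close>.\<close>

definition K :: "(real \<Rightarrow> real) \<Rightarrow> ('a ^ 'n \<Rightarrow> real) \<Rightarrow> 'a ^ 'n \<Rightarrow> real" where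
  "K f \<phi> x = (\<integral>a. f ((norm (h a x))\<^sup>2) * \<phi> a \<partial>U)"

lemma bounded_borel_comp_h: "bounded_borel f \<Longrightarrow> bounded_borel (\<lambda>a. f ((norm (h a x))\<^sup>2))"
  by (rule bounded_borel_compose) measurable

lemma bounded_borel_K:
  assumes f: "bounded_borel f" and \<phi>: "bounded_borel \<phi>"
  shows "bounded_borel (K f \<phi>)"
proof -
  obtain C where [measurable]: "f \<in> borel_measurable borel" and C: "\<And>x. \<bar>f x\<bar> \<le> C" "0 \<le> C"
    using bounded_borelE[OF f] by blast
  obtain D where [measurable]: "\<phi> \<in> borel_measurable borel" and D: "\<And>x. \<bar>\<phi> x\<bar> \<le> D"
    using bounded_borelE[OF \<phi>] by blast
  show ?thesis
  proof (rule bounded_borelI[of _ "C * D"])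
    show "K f \<phi> \<in> borel_measurable borel" unfolding K_def by measurable
    show "\<bar>K f \<phi> x\<bar> \<le> C * D" for x
      unfolding K_def
      by (intro abs_integral_le bounded_borel_mult bounded_borel_comp_h f \<phi>)
         (auto simp: abs_mult intro!: mult_mono C D)
  qed
qed

text \<open>Fubini moves \<open>T\<close> inside the mixture, where \<open>integral_f_h_Y\<close>
  turns the profile \<open>f\<close> into \<open>S x v f\<close> for almost every center.\<close>

lemma T_K:
  assumes f: "bounded_borel f" and \<phi>: "bounded_borel \<phi>"
    and xv: "norm x = 1" "norm v = 1" "h x v = 0" and y: "norm y = 1"
    and Sf: "bounded_borel (S x v f)"
  shows "T (K f \<phi>) y = K (S x v f) \<phi> y"
proof -
  obtain C where [measurable]: "f \<in> borel_measurable borel" and C: "\<And>x. \<bar>f x\<bar> \<le> C" "0 \<le> C"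
    using bounded_borelE[OF f] by blast
  obtain D where [measurable]: "\<phi> \<in> borel_measurable borel" and D: "\<And>x. \<bar>\<phi> x\<bar> \<le> D"
    using bounded_borelE[OF \<phi>] by blast
  have [measurable]: "S x v f \<in> borel_measurable borel"
    using Sf by (rule bounded_borel_measurable)
  have "T (K f \<phi>) y = (\<integral>z. (\<integral>a. f ((norm (h a (Y y z)))\<^sup>2) * \<phi> a \<partial>U) \<partial>U)"
    by (simp add: T_def K_def)
  also have "\<dots> = (\<integral>a. (\<integral>z. f ((norm (h a (Y y z)))\<^sup>2) * \<phi> a \<partial>U) \<partial>U)"
    by (rule U_U.Fubini_integral, rule integrable_pair_bounded_borel[of _ "C * D"])
       (measurable, auto simp: abs_mult intro!: mult_mono C D)
  also have "\<dots> = (\<integral>a. S x v f ((norm (h a y))\<^sup>2) * \<phi> a \<partial>U)"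
  proof (rule integral_cong_AE)
    show "AE a in U. (\<integral>z. f ((norm (h a (Y y z)))\<^sup>2) * \<phi> a \<partial>U) = S x v f ((norm (h a y))\<^sup>2) * \<phi> a"
      using AE_U by eventually_elim (simp add: integral_f_h_Y[OF f xv _ y])
  qed measurable
  finally show ?thesis by (simp add: K_def)
qed

lemma T_pow_K:
  assumes f: "bounded_lipschitz L f" and \<phi>: "bounded_borel \<phi>"
    and xv: "norm x = 1" "norm v = 1" "h x v = 0" and y: "norm y = 1"
  shows "(T ^^ n) (K f \<phi>) y = K ((S x v ^^ n) f) \<phi> y"
  using y
proof (induction n arbitrary: y)
  case (Suc n)
  have bS: "bounded_borel ((S x v ^^ m) f)" for m
    using bounded_lipschitz_S_pow[OF f xv] by (auto simp: bounded_lipschitz_def)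
  have bT: "bounded_borel ((T ^^ m) (K f \<phi>))" for m
    by (induction m) (use bS[of 0] \<phi> in \<open>auto intro: bounded_borel_K bounded_borel_T\<close>)
  have "(T ^^ Suc n) (K f \<phi>) y = T ((T ^^ n) (K f \<phi>)) y" by simp
  \<comment> \<open>The induction hypothesis holds at unit vectors only, and \<open>T\<close>
    depends only on the values there.\<close>
  also have "\<dots> = T (K ((S x v ^^ n) f) \<phi>) y"
    by (rule T_cong) (use Suc in \<open>auto intro: bT bS \<phi> bounded_borel_K\<close>)
  also have "\<dots> = K (S x v ((S x v ^^ n) f)) \<phi> y"
    by (rule T_K[OF bS \<phi> xv Suc.prems]) (use bS[of "Suc n"] in simp)
  finally show ?case by simp
qed simp

text \<open>Weights of mean zero allow the constant \<open>f 0\<close> to be subtracted from the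
  profile; what remains is at most \<open>L\<close>, since \<open>(norm (h a x))\<^sup>2\<close>
  lies between 0 and 1.\<close>

lemma abs_K_le:
  assumes f: "bounded_lipschitz L f" and \<phi>: "bounded_borel \<phi>" and mean: "(\<integral>x. \<phi> x \<partial>U) = 0"
    and x: "norm x = 1"
  shows "\<bar>K f \<phi> x\<bar> \<le> L * (\<integral>x. \<bar>\<phi> x\<bar> \<partial>U)"
proof -
  have bb: "bounded_borel f" and lip: "\<And>s t. \<bar>f s - f t\<bar> \<le> L * \<bar>s - t\<bar>"
    using f by (auto simp: bounded_lipschitz_def)
  have L: "0 \<le> L" using f by (rule bounded_lipschitz_nonneg)
  have b1: "bounded_borel (\<lambda>a. f ((norm (h a x))\<^sup>2) * \<phi> a)"
    by (intro bounded_borel_mult bounded_borel_comp_h bb \<phi>)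
  have b2: "bounded_borel (\<lambda>a. (f ((norm (h a x))\<^sup>2) - f 0) * \<phi> a)"
    by (intro bounded_borel_mult bounded_borel_diff bounded_borel_const bounded_borel_comp_h bb \<phi>)
  have "K f \<phi> x = (\<integral>a. f ((norm (h a x))\<^sup>2) * \<phi> a \<partial>U) - (\<integral>a. f 0 * \<phi> a \<partial>U)"
    by (simp add: K_def mean)
  also have "\<dots> = (\<integral>a. (f ((norm (h a x))\<^sup>2) - f 0) * \<phi> a \<partial>U)"
    unfolding left_diff_distrib
    by (rule Bochner_Integration.integral_diff[symmetric])
       (intro integrable_bounded_borel b1 bounded_borel_mult bounded_borel_const \<phi>)+
  also have "\<bar>\<dots>\<bar> \<le> (\<integral>a. \<bar>(f ((norm (h a x))\<^sup>2) - f 0) * \<phi> a\<bar> \<partial>U)" by simp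
  also have "\<dots> \<le> (\<integral>a. L * \<bar>\<phi> a\<bar> \<partial>U)"
  proof (rule integral_mono_AE)
    show "AE a in U. \<bar>(f ((norm (h a x))\<^sup>2) - f 0) * \<phi> a\<bar> \<le> L * \<bar>\<phi> a\<bar>"
      using AE_U
    proof eventually_elim
      case (elim a)
      have "\<bar>f ((norm (h a x))\<^sup>2) - f 0\<bar> \<le> L * \<bar>(norm (h a x))\<^sup>2 - 0\<bar>" by (rule lip)
      also have "\<dots> \<le> L * 1" using norm_h_le[OF x elim] L by (intro mult_left_mono) auto
      finally show ?case by (simp add: abs_mult mult_right_mono)
    qed
  qed (intro integrable_bounded_borel bounded_borel_abs bounded_borel_mult bounded_borel_const b2 \<phi>)+
  finally show ?thesis by simp
qed

text \<open>The \<open>n\<close>-th iterate is the mixture with profile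
  \<open>(S y v ^^ n) f\<close>, whose Lipschitz constant is \<open>L * kappa ^ n\<close>. With
  \<open>abs_K_le\<close> this is the decay that \<open>T_contraction_if_decay\<close> asks
  for.\<close>

lemma T_contraction_K:
  assumes f: "bounded_lipschitz L f" and \<phi>: "bounded_borel \<phi>" and mean: "(\<integral>x. \<phi> x \<partial>U) = 0"
  shows "(\<integral>x. (T (K f \<phi>) x)\<^sup>2 \<partial>U) \<le> kappa\<^sup>2 * (\<integral>x. (K f \<phi> x)\<^sup>2 \<partial>U)"
proof (rule T_contraction_if_decay[where C = "L * (\<integral>x. \<bar>\<phi> x\<bar> \<partial>U)"])
  show "bounded_borel (K f \<phi>)"
    using f \<phi> by (auto simp: bounded_lipschitz_def intro: bounded_borel_K)
  show "0 < kappa" by (rule kappa_pos)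
  fix n and y :: "'a ^ 'n" assume y: "norm y = 1"
  \<comment> \<open>The pair that defines \<open>S\<close> may depend on the point \<open>y\<close>,
    as the resulting bound does not.\<close>
  obtain v :: "'a ^ 'n" where v: "norm v = 1" "h y v = 0" using ex_orthogonal[OF y] .
  have "\<bar>K ((S y v ^^ n) f) \<phi> y\<bar> \<le> L * kappa ^ n * (\<integral>x. \<bar>\<phi> x\<bar> \<partial>U)"
    by (rule abs_K_le[OF bounded_lipschitz_S_pow[OF f y v] \<phi> mean y])
  then show "\<bar>(T ^^ n) (K f \<phi>) y\<bar> \<le> L * (\<integral>x. \<bar>\<phi> x\<bar> \<partial>U) * kappa ^ n"
    by (simp add: T_pow_K[OF f \<phi> y v y] mult_ac)
qed

lemma integral_cap_const:
  fixes g :: "real \<Rightarrow> real"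
  assumes [measurable]: "g \<in> borel_measurable borel" and "norm x = 1" "norm y = 1"
  shows "(\<integral>a. g ((norm (h a x))\<^sup>2) \<partial>U) = (\<integral>a. g ((norm (h a y))\<^sup>2) \<partial>U)"
proof -
  obtain A where A: "A \<in> G" "A *v x = y" using ex_reflect assms(2,3) by metis
  have "(\<integral>a. g ((norm (h a y))\<^sup>2) \<partial>U) = (\<integral>a. g ((norm (h (A *v a) y))\<^sup>2) \<partial>U)"
    by (rule integral_U[OF _ A(1), symmetric]) measurable
  also have "\<dots> = (\<integral>a. g ((norm (h a x))\<^sup>2) \<partial>U)"
    unfolding A(2)[symmetric] h_G[OF A(1)] ..
  finally show ?thesis ..
qed

text \<open>By compactness finitely many caps of a given size cover the sphere, so they cannot all
  be null sets. \<open>K_approx\<close> uses this to normalize its profile.\<close>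

lemma AE_cap_imp_False:
  assumes "\<And>x. norm x = 1 \<Longrightarrow> AE a in U. (norm (h a x))\<^sup>2 \<le> q" and q: "q < 1"
  shows False
proof -
  define O' where "O' x = {a. q < (norm (h a x))\<^sup>2}" for x :: "'a ^ 'n"
  have "open (O' x)" for x
    unfolding O'_def by (intro open_Collect_less continuous_intros)
  moreover have "sphere 0 1 \<subseteq> (\<Union>x\<in>sphere 0 1. O' x)"
    using q by (force simp: O'_def h_self_unit)
  ultimately obtain D where D: "D \<subseteq> sphere 0 1" "finite D" "sphere 0 1 \<subseteq> (\<Union>x\<in>D. O' x)"
    using compactE_image[OF compact_sphere, of "sphere 0 1" O'] by metis
  have "AE a in U. \<forall>x\<in>D. (norm (h a x))\<^sup>2 \<le> q"
    using D(1,2) assms(1) by (intro AE_finite_allI) auto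
  with AE_U have "AE a in U. False"
  proof eventually_elim
    case (elim a)
    then obtain x where "x \<in> D" "a \<in> O' x" using D(3) by force
    then show False using elim by (force simp: O'_def)
  qed
  then show False by simp
qed

text \<open>Caps around \<open>x\<close> form an approximate identity on phase invariant functions.\<close>

lemma K_approx:
  assumes \<phi>: "bounded_borel \<phi>" and cont: "continuous_on (sphere 0 1) \<phi>"
    and phase: "\<And>c x. norm c = 1 \<Longrightarrow> norm x = 1 \<Longrightarrow> \<phi> (c *s x) = \<phi> x"
    and e: "0 < e"
  obtains L f where "bounded_lipschitz L f" "\<And>x. norm x = 1 \<Longrightarrow> \<bar>K f \<phi> x - \<phi> x\<bar> \<le> e"
proof -
  have "uniformly_continuous_on (sphere 0 1) \<phi>"
    by (rule compact_uniformly_continuous[OF cont compact_sphere])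
  then obtain \<delta> where \<delta>: "0 < \<delta>" "\<And>x y. norm x = 1 \<Longrightarrow> norm y = 1 \<Longrightarrow> dist x y < \<delta> \<Longrightarrow> \<bar>\<phi> x - \<phi> y\<bar> < e"
    using e unfolding uniformly_continuous_on_def by (auto simp: dist_real_def)
  \<comment> \<open>\<open>m\<close> is the slope of the tent \<open>g\<close> below, which is
    positive exactly where \<open>\<bar>1 - s\<bar>\<close> is less than \<open>1 / m\<close>. It is
    so large that vectors \<open>a\<close>, \<open>x\<close> with
    \<open>g ((norm (h a x))\<^sup>2) \<noteq> 0\<close> are within \<delta> of each other up to a
    phase.\<close>
  define m where "m = 2 / \<delta>\<^sup>2 + 2"
  have m2: "2 \<le> m" by (simp add: m_def)
  have m\<delta>: "2 / m < \<delta>\<^sup>2"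
  proof -
    have "2 < m * \<delta>\<^sup>2" using \<delta>(1) by (simp add: m_def algebra_simps)
    then show ?thesis using m2 by (simp add: field_simps)
  qed
  define g where "g s = max 0 (1 - m * \<bar>1 - s\<bar>)" for s :: real
  have g01: "0 \<le> g s" "g s \<le> 1" for s using m2 by (auto simp: g_def)
  have g_meas [measurable]: "g \<in> borel_measurable borel" unfolding g_def by measurable
  have bg: "bounded_borel g"
    by (rule bounded_borelI[of _ 1]) (use g01 in auto)
  have g_lip: "\<bar>g s - g t\<bar> \<le> m * \<bar>s - t\<bar>" for s t
  proof -
    have "\<bar>max 0 (1 - p) - max 0 (1 - q)\<bar> \<le> \<bar>p - q\<bar>" for p q :: real
      by (auto simp: max_def)
    then have "\<bar>g s - g t\<bar> \<le> \<bar>m * \<bar>1 - s\<bar> - m * \<bar>1 - t\<bar>\<bar>" by (simp add: g_def)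
    also have "\<dots> = m * \<bar>\<bar>1 - s\<bar> - \<bar>1 - t\<bar>\<bar>"
      using m2 by (simp add: abs_mult flip: right_diff_distrib)
    also have "\<dots> \<le> m * \<bar>s - t\<bar>" using m2 by (intro mult_left_mono) auto
    finally show ?thesis .
  qed
  have near: "\<bar>\<phi> a - \<phi> x\<bar> \<le> e" if a: "norm a = 1" and x: "norm x = 1" and g: "g ((norm (h a x))\<^sup>2) \<noteq> 0" for a x
  proof -
    define t where "t = norm (h a x)"
    have t1: "t\<^sup>2 \<le> 1" using norm_h_le[OF x a] by (simp add: t_def)
    have "m * (1 - t\<^sup>2) < 1" using g t1 by (auto simp: g_def t_def max_def split: if_splits)
    then have t2: "1 - t\<^sup>2 < 1 / m" using m2 by (simp add: field_simps)
    have "t \<noteq> 0"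
    proof
      assume "t = 0"
      then have "1 < 1 / m" using t2 by simp
      then show False using m2 by (simp add: field_simps)
    qed
    then have t0: "0 < t" by (simp add: t_def)
    have t_le: "t \<le> 1" using t1 by (intro power2_le_imp_le[of t 1]) auto
    \<comment> \<open>The phase of \<open>h a x\<close>. Among the unit multiples of
      \<open>x\<close>, \<open>p *s x\<close> is the one closest to \<open>a\<close>, at squared
      distance \<open>2 - 2 * t\<close>.\<close>
    define p where "p = h a x / of_real t"
    have p: "norm p = 1" using t0 by (simp add: p_def norm_divide t_def)
    have pp: "cj p * h a x = of_real t"
    proof -
      have "cj (p * of_real t) = cj (h a x)" using t0 by (simp add: p_def)
      then have "cj p * of_real t = cj (h a x)" by (simp add: cj_mult)
      then have "h a x * (cj p * of_real t) = of_real (t\<^sup>2)"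
        using mult_cj[of "h a x"] by (simp add: t_def)
      then have "(cj p * h a x) * of_real t = of_real (t\<^sup>2)" by (simp add: mult_ac)
      then have "(cj p * h a x) * of_real t = of_real t * of_real t" by (simp add: power2_eq_square)
      then show ?thesis using t0 by simp
    qed
    have pp': "p * h x a = of_real t"
      using arg_cong[OF pp, of cj] h_commute[of x a] by (simp add: cj_mult)
    have "h (a - p *s x) (a - p *s x) = 1 - cj p * h a x - p * h x a + p * cj p"
      by (simp add: h_diff_left h_diff_right h_scale_left h_scale_right h_self_unit a x algebra_simps)
    also have "\<dots> = of_real (2 - 2 * t)" using mult_cj[of p] p by (simp add: pp pp')
    finally have "(norm (a - p *s x))\<^sup>2 = 2 - 2 * t" by (simp only: h_self of_real_eq_iff)
    also have "\<dots> \<le> 2 * (1 - t\<^sup>2)"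
      using t0 t_le by (simp add: power2_eq_square mult_left_le)
    also have "\<dots> < \<delta>\<^sup>2" using t2 m\<delta> by simp
    finally have "dist a (p *s x) < \<delta>"
      using \<delta>(1) by (simp add: dist_norm power2_less_imp_less)
    then have "\<bar>\<phi> a - \<phi> (p *s x)\<bar> < e"
      using a x p by (intro \<delta>(2)) (auto simp: norm_vscale)
    then show ?thesis using phase[OF p x] by simp
  qed
  obtain i :: 'n where True by simp
  define c where "c = (\<integral>a. g ((norm (h a (axis i 1)))\<^sup>2) \<partial>U)"
  have cx: "(\<integral>a. g ((norm (h a x))\<^sup>2) \<partial>U) = c" if "norm x = 1" for x
    unfolding c_def by (rule integral_cap_const) (use that in simp_all)
  have int_g: "integrable U (\<lambda>a. g ((norm (h a x))\<^sup>2))" for x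
    by (intro integrable_bounded_borel bounded_borel_comp_h bg)
  \<comment> \<open>Otherwise the nonnegative tent would vanish almost everywhere around each
    center, and all caps of this size would be null sets.\<close>
  have "c \<noteq> 0"
  proof
    assume "c = 0"
    have "AE a in U. (norm (h a x))\<^sup>2 \<le> 1 - 1 / m" if x: "norm x = 1" for x
    proof -
      have "AE a in U. g ((norm (h a x))\<^sup>2) = 0"
        using cx[OF x] \<open>c = 0\<close> integral_nonneg_eq_0_iff_AE[OF int_g[of x]] g01 by simp
      with AE_U show ?thesis
      proof eventually_elim
        case (elim a)
        have "(norm (h a x))\<^sup>2 \<le> 1" using norm_h_le[OF x] elim by simp
        then have "1 \<le> m * (1 - (norm (h a x))\<^sup>2)" using elim(2) by (simp add: g_def max_def split: if_splits)
        then show ?case using m2 by (simp add: field_simps)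
      qed
    qed
    then show False by (rule AE_cap_imp_False) (use m2 in auto)
  qed
  moreover have "0 \<le> c" unfolding c_def by (intro integral_nonneg_AE) (simp add: g01)
  ultimately have c: "0 < c" by simp
  define f where "f s = g s / c" for s
  have f0: "0 \<le> f s" for s using g01 c by (simp add: f_def)
  have bf: "bounded_borel f"
    unfolding f_def using bounded_borel_mult[OF bg bounded_borel_const[of "1 / c"]] by simp
  have "bounded_lipschitz (m / c) f"
    unfolding bounded_lipschitz_def
  proof (intro conjI allI bf)
    fix s t
    have "\<bar>f s - f t\<bar> = \<bar>g s - g t\<bar> / c" using c by (simp add: f_def flip: diff_divide_distrib)
    also have "\<dots> \<le> m * \<bar>s - t\<bar> / c" using c g_lip by (intro divide_right_mono) auto
    finally show "\<bar>f s - f t\<bar> \<le> m / c * \<bar>s - t\<bar>" by simp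
  qed
  moreover have "\<bar>K f \<phi> x - \<phi> x\<bar> \<le> e" if x: "norm x = 1" for x
  proof -
    have int_f: "(\<integral>a. f ((norm (h a x))\<^sup>2) \<partial>U) = 1"
      using cx[OF x] c by (simp add: f_def)
    have bfx: "bounded_borel (\<lambda>a. f ((norm (h a x))\<^sup>2))" by (rule bounded_borel_comp_h[OF bf])
    have b: "bounded_borel (\<lambda>a. f ((norm (h a x))\<^sup>2) * (\<phi> a - \<phi> x))"
      by (intro bounded_borel_mult bfx bounded_borel_diff bounded_borel_const \<phi>)
    have "K f \<phi> x - \<phi> x = (\<integral>a. f ((norm (h a x))\<^sup>2) * \<phi> a \<partial>U) - (\<integral>a. f ((norm (h a x))\<^sup>2) * \<phi> x \<partial>U)"
      by (simp add: K_def int_f)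
    also have "\<dots> = (\<integral>a. f ((norm (h a x))\<^sup>2) * (\<phi> a - \<phi> x) \<partial>U)"
      unfolding right_diff_distrib
      by (rule Bochner_Integration.integral_diff[symmetric])
         (intro integrable_bounded_borel bounded_borel_mult bounded_borel_const bfx \<phi>)+
    also have "\<bar>\<dots>\<bar> \<le> (\<integral>a. \<bar>f ((norm (h a x))\<^sup>2) * (\<phi> a - \<phi> x)\<bar> \<partial>U)" by simp
    also have "\<dots> \<le> (\<integral>a. f ((norm (h a x))\<^sup>2) * e \<partial>U)"
    proof (rule integral_mono_AE)
      show "AE a in U. \<bar>f ((norm (h a x))\<^sup>2) * (\<phi> a - \<phi> x)\<bar> \<le> f ((norm (h a x))\<^sup>2) * e"
        using AE_U
      proof eventually_elim
        case (elim a)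
        show ?case
        proof (cases "g ((norm (h a x))\<^sup>2) = 0")
          case False
          then show ?thesis using near[OF elim x False] f0
            by (simp add: abs_mult mult_left_mono)
        qed (simp add: f_def)
      qed
    qed (intro integrable_bounded_borel bounded_borel_abs b bounded_borel_mult bounded_borel_const bfx)+
    also have "\<dots> = e" by (simp add: int_f)
    finally show ?thesis .
  qed
  ultimately show ?thesis using that by blast
qed

end


section \<open>The covariance bound\<close>

text \<open>For an indicator, regularity encloses the set between a compact \<open>K\<close> and an
  open \<open>V\<close> of nearly equal measure; a Urysohn function between them errs only on
  \<open>V - K\<close>. Sums and dominated limits are handled by
  \<open>integrable_induct\<close>.\<close>

lemma continuous_dense_L1:
  fixes M :: "'b::euclidean_space measure" and f :: "'b \<Rightarrow> real"
  assumes fin: "finite_measure M" and sets_M [measurable_cong]: "sets M = sets borel"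
    and f: "integrable M f" and e: "0 < e"
  shows "\<exists>g. continuous_on UNIV g \<and> integrable M g \<and> (\<integral>x. \<bar>f x - g x\<bar> \<partial>M) < e"
  using f e
proof (induction f arbitrary: e rule: integrable_induct)
  case (base A c)
  interpret finite_measure M by (fact fin)
  have [measurable]: "A \<in> sets borel" using base by (simp add: sets_M)
  \<comment> \<open>Two regularity errors of size \<open>r\<close>, weighted by
    \<open>\<bar>c\<bar>\<close>, stay below \<open>e\<close>; the added 1 covers
    \<open>c = 0\<close>.\<close>
  define r where "r = e / (2 * (\<bar>c\<bar> + 1))"
  have r: "0 < r" using base by (simp add: r_def)
  have finA: "emeasure M A \<noteq> \<infinity>" "emeasure M (space M) \<noteq> \<infinity>"
    by (simp_all add: emeasure_eq_measure)
  have "{K. K \<subseteq> A \<and> compact K} \<noteq> {}" using compact_empty by blast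
  then obtain K where K: "K \<subseteq> A" "compact K" "emeasure M A < emeasure M K + r"
    using SUP_approx_ennreal[OF r _ inner_regular[OF sets_M finA(2) \<open>A \<in> sets borel\<close>] finA(1)] by auto
  obtain V where V: "A \<subseteq> V" "open V" "emeasure M V < emeasure M A + r"
    using INF_approx_ennreal[OF r outer_regular[OF sets_M finA(2) \<open>A \<in> sets borel\<close>] finA(1)] by auto
  have [measurable]: "K \<in> sets borel" "V \<in> sets borel"
    using K(2) V(2) by (auto intro: borel_closed compact_imp_closed)
  have mK: "measure M A < measure M K + r" and mV: "measure M V < measure M A + r"
    using K(3) V(3) r by (simp_all add: emeasure_eq_measure ennreal_less_iff flip: ennreal_plus)
  have "K \<inter> - V = {}" using K(1) V(1) by auto
  then obtain g0 :: "'b \<Rightarrow> real" where g0: "continuous_on UNIV g0" "\<And>x. g0 x \<in> closed_segment 1 0"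
    "\<And>x. x \<in> K \<Longrightarrow> g0 x = 1" "\<And>x. x \<in> - V \<Longrightarrow> g0 x = 0"
    using Urysohn[of K "- V" 1 0] K(2) V(2) compact_imp_closed by (metis closed_Compl)
  have g01: "0 \<le> g0 x" "g0 x \<le> 1" for x
    using g0(2)[of x] by (auto simp: closed_segment_eq_real_ivl)
  have [measurable]: "g0 \<in> borel_measurable borel" by (rule borel_measurable_continuous_onI[OF g0(1)])
  define g where "g x = g0 x * c" for x
  have [measurable]: "g \<in> borel_measurable borel" unfolding g_def by measurable
  have int_g: "integrable M g"
    by (rule integrable_const_bound[of _ "\<bar>c\<bar>"])
       (use g01 in \<open>auto simp: g_def abs_mult mult_left_le_one_le\<close>)
  have le: "\<bar>indicator A x *\<^sub>R c - g x\<bar> \<le> indicator (V - K) x * \<bar>c\<bar>" for x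
  proof -
    consider "x \<in> K" | "x \<in> - V" | "x \<in> V - K" by blast
    then show ?thesis
    proof cases
      case 3
      have "\<bar>indicator A x - g0 x\<bar> \<le> 1" using g01[of x] by (auto simp: indicator_def)
      then have "\<bar>indicator A x - g0 x\<bar> * \<bar>c\<bar> \<le> 1 * \<bar>c\<bar>" by (rule mult_right_mono) simp
      then show ?thesis using 3 by (simp add: g_def abs_mult flip: left_diff_distrib)
    qed (use g0 K(1) V(1) in \<open>auto simp: g_def indicator_def\<close>)
  qed
  have int1: "integrable M (\<lambda>x. \<bar>indicator A x *\<^sub>R c - g x\<bar>)"
    by (intro integrable_abs Bochner_Integration.integrable_diff int_g integrable_scaleR_left)
       (use base in \<open>auto simp: emeasure_eq_measure sets_M\<close>)
  have "(\<integral>x. \<bar>indicator A x *\<^sub>R c - g x\<bar> \<partial>M) \<le> (\<integral>x. indicator (V - K) x * \<bar>c\<bar> \<partial>M)"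
    by (rule integral_mono[OF int1 _ le])
       (auto simp: emeasure_eq_measure sets_M)
  also have "\<dots> = measure M (V - K) * \<bar>c\<bar>"
    using sets_eq_imp_space_eq[OF sets_M] by simp
  also have "measure M (V - K) = measure M V - measure M K"
    by (rule finite_measure_Diff) (use K(1) V(1) in \<open>auto simp: sets_M\<close>)
  also have "(measure M V - measure M K) * \<bar>c\<bar> \<le> 2 * r * \<bar>c\<bar>"
    using mK mV by (intro mult_right_mono) auto
  also have "2 * r * \<bar>c\<bar> < e"
    using base by (simp add: r_def field_simps)
  finally have "(\<integral>x. \<bar>indicator A x *\<^sub>R c - g x\<bar> \<partial>M) < e" .
  moreover have "continuous_on UNIV g" unfolding g_def by (intro continuous_intros g0(1))
  ultimately show ?case using int_g by blast
next
  case (add f1 f2)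
  obtain g1 where g1: "continuous_on UNIV g1" "integrable M g1" "(\<integral>x. \<bar>f1 x - g1 x\<bar> \<partial>M) < e / 2"
    using add.IH(1)[of "e / 2"] add.prems by auto
  obtain g2 where g2: "continuous_on UNIV g2" "integrable M g2" "(\<integral>x. \<bar>f2 x - g2 x\<bar> \<partial>M) < e / 2"
    using add.IH(2)[of "e / 2"] add.prems by auto
  have "(\<integral>x. \<bar>f1 x + f2 x - (g1 x + g2 x)\<bar> \<partial>M) \<le> (\<integral>x. \<bar>f1 x - g1 x\<bar> + \<bar>f2 x - g2 x\<bar> \<partial>M)"
    by (rule integral_mono) (use add.hyps g1 g2 in auto)
  also have "\<dots> = (\<integral>x. \<bar>f1 x - g1 x\<bar> \<partial>M) + (\<integral>x. \<bar>f2 x - g2 x\<bar> \<partial>M)"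
    by (rule Bochner_Integration.integral_add) (use add.hyps g1 g2 in auto)
  also have "\<dots> < e" using g1 g2 by simp
  finally show ?case
    using g1 g2 by (intro exI[of _ "\<lambda>x. g1 x + g2 x"]) (auto intro!: continuous_intros)
next
  case (lim f s)
  have "(\<lambda>i. (\<integral>x. \<bar>f x - s i x\<bar> \<partial>M)) \<longlonglongrightarrow> (\<integral>x. 0 \<partial>M)"
  proof (rule integral_dominated_convergence[where w = "\<lambda>x. 3 * \<bar>f x\<bar>"])
    show "AE x in M. (\<lambda>i. \<bar>f x - s i x\<bar>) \<longlonglongrightarrow> 0"
    proof (rule AE_I2)
      fix x assume "x \<in> space M"
      then have "(\<lambda>i. \<bar>f x - s i x\<bar>) \<longlonglongrightarrow> \<bar>f x - f x\<bar>"
        by (intro tendsto_intros lim.hyps)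
      then show "(\<lambda>i. \<bar>f x - s i x\<bar>) \<longlonglongrightarrow> 0" by simp
    qed
    show "AE x in M. norm \<bar>f x - s i x\<bar> \<le> 3 * \<bar>f x\<bar>" for i
    proof (rule AE_I2)
      fix x assume "x \<in> space M"
      then have "\<bar>s i x\<bar> \<le> 2 * \<bar>f x\<bar>" using lim.hyps(3)[of x i] by simp
      then show "norm \<bar>f x - s i x\<bar> \<le> 3 * \<bar>f x\<bar>" by simp
    qed
  qed (use lim.hyps in \<open>auto intro: borel_measurable_integrable\<close>)
  then have "(\<lambda>i. (\<integral>x. \<bar>f x - s i x\<bar> \<partial>M)) \<longlonglongrightarrow> 0" by simp
  then have "\<forall>\<^sub>F i in sequentially. (\<integral>x. \<bar>f x - s i x\<bar> \<partial>M) < e / 2"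
    by (rule order_tendstoD) (use lim.prems in simp)
  then obtain i where i: "(\<integral>x. \<bar>f x - s i x\<bar> \<partial>M) < e / 2"
    by (auto simp: eventually_sequentially)
  obtain g where g: "continuous_on UNIV g" "integrable M g" "(\<integral>x. \<bar>s i x - g x\<bar> \<partial>M) < e / 2"
    using lim.IH[of "e / 2" i] lim.prems by auto
  have "(\<integral>x. \<bar>f x - g x\<bar> \<partial>M) \<le> (\<integral>x. \<bar>f x - s i x\<bar> + \<bar>s i x - g x\<bar> \<partial>M)"
    by (rule integral_mono) (use lim.hyps g in auto)
  also have "\<dots> = (\<integral>x. \<bar>f x - s i x\<bar> \<partial>M) + (\<integral>x. \<bar>s i x - g x\<bar> \<partial>M)"
    by (rule Bochner_Integration.integral_add) (use lim.hyps g in auto)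
  also have "\<dots> < e" using g i by simp
  finally show ?case using g by blast
qed

text \<open>Truncate \<open>f\<close> at a high level \<open>N\<close>, approximate the truncation
  in mean, and truncate the approximation too. The difference is then at most \<open>2 * N\<close>,
  so its square is controlled by its absolute value.\<close>

lemma continuous_dense_L2:
  fixes M :: "'b::euclidean_space measure" and f :: "'b \<Rightarrow> real"
  assumes fin: "finite_measure M" and sets_M [measurable_cong]: "sets M = sets borel"
    and [measurable]: "f \<in> borel_measurable borel" and f: "integrable M (\<lambda>x. (f x)\<^sup>2)" and e: "0 < e"
  obtains g where "continuous_on UNIV g" "bounded_borel g" "(\<integral>x. (f x - g x)\<^sup>2 \<partial>M) < e"
proof -
  interpret finite_measure M by (fact fin)
  define cl where "cl N t = max (- N) (min N t)" for N t :: real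
  have cl_abs: "\<bar>cl N t\<bar> \<le> N" if "0 \<le> N" for N t using that by (auto simp: cl_def)
  have cl_lip: "\<bar>cl N s - cl N t\<bar> \<le> \<bar>s - t\<bar>" for N s t by (auto simp: cl_def max_def min_def)
  have cl_meas [measurable]: "cl N \<in> borel_measurable borel" for N unfolding cl_def by measurable
  have "(\<lambda>n. (\<integral>x. (f x - cl (real n) (f x))\<^sup>2 \<partial>M)) \<longlonglongrightarrow> (\<integral>x. 0 \<partial>M)"
  proof (rule integral_dominated_convergence[where w = "\<lambda>x. (f x)\<^sup>2"])
    show "AE x in M. (\<lambda>n. (f x - cl (real n) (f x))\<^sup>2) \<longlonglongrightarrow> 0"
    proof (rule AE_I2, rule tendsto_eventually)
      fix x
      obtain n0 :: nat where "\<bar>f x\<bar> \<le> real n0" using real_arch_simple by blast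
      then show "\<forall>\<^sub>F n in sequentially. (f x - cl (real n) (f x))\<^sup>2 = 0"
        by (intro eventually_sequentiallyI[of n0]) (auto simp: cl_def max_def min_def)
    qed
    show "AE x in M. norm ((f x - cl (real n) (f x))\<^sup>2) \<le> (f x)\<^sup>2" for n
    proof (rule AE_I2)
      fix x
      have "\<bar>f x - cl (real n) (f x)\<bar> \<le> \<bar>f x\<bar>" by (auto simp: cl_def max_def min_def)
      then show "norm ((f x - cl (real n) (f x))\<^sup>2) \<le> (f x)\<^sup>2"
        by (simp add: abs_le_square_iff)
    qed
  qed (use f in measurable)
  then have "\<forall>\<^sub>F n in sequentially. (\<integral>x. (f x - cl (real n) (f x))\<^sup>2 \<partial>M) < e / 4"
    by (intro order_tendstoD) (use e in auto)
  then obtain n0 where n0: "\<And>n. n \<ge> n0 \<Longrightarrow> (\<integral>x. (f x - cl (real n) (f x))\<^sup>2 \<partial>M) < e / 4"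
    by (auto simp: eventually_sequentially)
  define N where "N = real (Suc n0)"
  have N: "0 < N" by (simp add: N_def)
  have f1: "(\<integral>x. (f x - cl N (f x))\<^sup>2 \<partial>M) < e / 4" unfolding N_def by (rule n0) simp
  have int_cl: "integrable M (\<lambda>x. cl N (f x))"
    by (rule integrable_const_bound[of _ N]) (use N cl_abs in auto)
  \<comment> \<open>The factor \<open>2 * N\<close> from \<open>pt\<close> turns this error into
    \<open>e / 4\<close>. The truncation error is another \<open>e / 4\<close>, and the inequality
    \<open>sq\<close> doubles both.\<close>
  obtain g0 where g0: "continuous_on UNIV g0" "integrable M g0"
      "(\<integral>x. \<bar>cl N (f x) - g0 x\<bar> \<partial>M) < e / (8 * N)"
    using continuous_dense_L1[OF fin sets_M int_cl, of "e / (8 * N)"] e N by auto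
  have [measurable]: "g0 \<in> borel_measurable borel" by (rule borel_measurable_continuous_onI[OF g0(1)])
  define g where "g x = cl N (g0 x)" for x
  have cont_g: "continuous_on UNIV g"
    unfolding g_def cl_def by (intro continuous_intros g0(1))
  have [measurable]: "g \<in> borel_measurable borel" unfolding g_def by measurable
  have bg: "bounded_borel g"
    by (rule bounded_borelI[of _ N]) (use N cl_abs in \<open>auto simp: g_def\<close>)
  have pt: "(cl N (f x) - g x)\<^sup>2 \<le> 2 * N * \<bar>cl N (f x) - g0 x\<bar>" for x
  proof -
    have "\<bar>cl N (f x)\<bar> \<le> N" "\<bar>g x\<bar> \<le> N" using cl_abs N by (auto simp: g_def)
    then have "\<bar>cl N (f x) - g x\<bar> \<le> 2 * N" by linarith
    moreover have "\<bar>cl N (f x) - g x\<bar> \<le> \<bar>cl N (f x) - g0 x\<bar>"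
    proof -
      have "cl N (f x) = cl N (cl N (f x))" using N by (auto simp: cl_def max_def min_def)
      then show ?thesis unfolding g_def using cl_lip by metis
    qed
    ultimately have "\<bar>cl N (f x) - g x\<bar> * \<bar>cl N (f x) - g x\<bar> \<le> 2 * N * \<bar>cl N (f x) - g0 x\<bar>"
      by (intro mult_mono) auto
    then show ?thesis by (simp add: power2_eq_square)
  qed
  have int2: "integrable M (\<lambda>x. (cl N (f x) - g x)\<^sup>2)"
  proof (rule integrable_const_bound[of _ "(2 * N)\<^sup>2"])
    show "AE x in M. norm ((cl N (f x) - g x)\<^sup>2) \<le> (2 * N)\<^sup>2"
    proof (rule AE_I2)
      fix x
      have "\<bar>cl N (f x)\<bar> \<le> N" "\<bar>g x\<bar> \<le> N" using cl_abs N by (auto simp: g_def)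
      then have "\<bar>cl N (f x) - g x\<bar> \<le> \<bar>2 * N\<bar>" by linarith
      then show "norm ((cl N (f x) - g x)\<^sup>2) \<le> (2 * N)\<^sup>2" by (simp only: abs_le_square_iff) simp
    qed
  qed measurable
  have "(\<integral>x. (cl N (f x) - g x)\<^sup>2 \<partial>M) \<le> (\<integral>x. 2 * N * \<bar>cl N (f x) - g0 x\<bar> \<partial>M)"
    by (rule integral_mono[OF int2 _ pt]) (use int_cl g0(2) in auto)
  also have "\<dots> = 2 * N * (\<integral>x. \<bar>cl N (f x) - g0 x\<bar> \<partial>M)" by simp
  also have "\<dots> < 2 * N * (e / (8 * N))" using g0(3) N by (intro mult_strict_left_mono) auto
  also have "\<dots> = e / 4" using N by simp
  finally have f2: "(\<integral>x. (cl N (f x) - g x)\<^sup>2 \<partial>M) < e / 4" .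
  have int1: "integrable M (\<lambda>x. (f x - cl N (f x))\<^sup>2)"
  proof (rule Bochner_Integration.integrable_bound[OF f])
    show "AE x in M. norm ((f x - cl N (f x))\<^sup>2) \<le> norm ((f x)\<^sup>2)"
    proof (rule AE_I2)
      fix x
      have "\<bar>f x - cl N (f x)\<bar> \<le> \<bar>f x\<bar>" using N by (auto simp: cl_def max_def min_def)
      then show "norm ((f x - cl N (f x))\<^sup>2) \<le> norm ((f x)\<^sup>2)"
        by (simp add: abs_le_square_iff)
    qed
  qed measurable
  have sq: "(p + q)\<^sup>2 \<le> 2 * p\<^sup>2 + 2 * q\<^sup>2" for p q :: real
    using sum_squares_bound[of p q] by (simp add: power2_sum)
  have pt2: "(f x - g x)\<^sup>2 \<le> 2 * (f x - cl N (f x))\<^sup>2 + 2 * (cl N (f x) - g x)\<^sup>2" for x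
    using sq[of "f x - cl N (f x)" "cl N (f x) - g x"] by simp
  have int3: "integrable M (\<lambda>x. 2 * (f x - cl N (f x))\<^sup>2 + 2 * (cl N (f x) - g x)\<^sup>2)"
    using int1 int2 by simp
  have "(\<integral>x. (f x - g x)\<^sup>2 \<partial>M) \<le> (\<integral>x. 2 * (f x - cl N (f x))\<^sup>2 + 2 * (cl N (f x) - g x)\<^sup>2 \<partial>M)"
  proof (rule integral_mono[OF _ int3 pt2])
    show "integrable M (\<lambda>x. (f x - g x)\<^sup>2)"
      by (rule Bochner_Integration.integrable_bound[OF int3]) (use pt2 in \<open>auto simp: abs_of_nonneg\<close>)
  qed
  also have "\<dots> < e" using int1 int2 f1 f2 by simp
  finally show ?thesis using that cont_g bg by blast
qed

section \<open>From mixtures to phase invariant, continuous and finally square integrable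
  functions\<close>

context haar_sphere
begin

text \<open>\<open>K_approx\<close> replaces \<phi> by a mixture that is uniformly within
  \<open>e\<close>, and \<open>T\<close> does not enlarge this distance. The contraction of the
  mixture then passes to \<phi> with an error linear in \<open>e\<close>.\<close>

lemma T_contraction_phase_invariant:
  assumes \<phi>: "bounded_borel \<phi>" and cont: "continuous_on (sphere 0 1) \<phi>"
    and phase: "\<And>c x. norm c = 1 \<Longrightarrow> norm x = 1 \<Longrightarrow> \<phi> (c *s x) = \<phi> x"
    and mean: "(\<integral>x. \<phi> x \<partial>U) = 0"
  shows "(\<integral>x. (T \<phi> x)\<^sup>2 \<partial>U) \<le> kappa\<^sup>2 * (\<integral>x. (\<phi> x)\<^sup>2 \<partial>U)"
proof -
  obtain C where C: "\<And>x. \<bar>\<phi> x\<bar> \<le> C" "0 \<le> C" using bounded_borelE[OF \<phi>] by blast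
  have TC: "\<bar>T \<phi> x\<bar> \<le> C" for x
    unfolding T_def by (intro abs_integral_le bounded_borel_comp_Y \<phi>) (simp add: C)
  \<comment> \<open>Factor the difference of squares; since one of the numbers is bounded by
    \<open>C\<close> and they differ by at most 1, their sum is at most \<open>2 * C + 1\<close> in
    absolute value.\<close>
  have sq: "p\<^sup>2 \<le> q\<^sup>2 + e * (2 * C + 1)"
    if "\<bar>p - q\<bar> \<le> e" "\<bar>p\<bar> \<le> C \<or> \<bar>q\<bar> \<le> C" "e \<le> 1" for p q e :: real
  proof -
    have "p\<^sup>2 - q\<^sup>2 \<le> \<bar>p - q\<bar> * \<bar>p + q\<bar>"
      by (simp add: power2_eq_square square_diff_square_factored flip: abs_mult) (simp add: mult.commute)
    also have "\<dots> \<le> e * (2 * C + 1)" using that by (intro mult_mono) auto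
    finally show ?thesis by simp
  qed
  have main: "(\<integral>x. (T \<phi> x)\<^sup>2 \<partial>U) \<le> kappa\<^sup>2 * (\<integral>x. (\<phi> x)\<^sup>2 \<partial>U) + e * ((kappa\<^sup>2 + 1) * (2 * C + 1))"
    if e: "0 < e" "e \<le> 1" for e
  proof -
    obtain L f where f: "bounded_lipschitz L f" and close: "\<And>x. norm x = 1 \<Longrightarrow> \<bar>K f \<phi> x - \<phi> x\<bar> \<le> e"
      using K_approx[OF \<phi> cont phase e(1)] by blast
    have bK: "bounded_borel (K f \<phi>)"
      using f \<phi> by (auto simp: bounded_lipschitz_def intro: bounded_borel_K)
    have "(\<integral>x. (T \<phi> x)\<^sup>2 \<partial>U) \<le> (\<integral>x. (T (K f \<phi>) x)\<^sup>2 + e * (2 * C + 1) \<partial>U)"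
    proof (rule integral_mono_AE)
      show "AE x in U. (T \<phi> x)\<^sup>2 \<le> (T (K f \<phi>) x)\<^sup>2 + e * (2 * C + 1)"
        using AE_U
      proof eventually_elim
        case (elim x)
        have "\<bar>T (K f \<phi>) x - T \<phi> x\<bar> \<le> e" by (rule T_diff_bound[OF bK \<phi> close elim])
        then show ?case using TC e by (intro sq) (auto simp: abs_minus_commute)
      qed
    qed (intro integrable_bounded_borel Bochner_Integration.integrable_add bounded_borel_power2
          bounded_borel_const bounded_borel_T \<phi> bK)+
    also have "\<dots> = (\<integral>x. (T (K f \<phi>) x)\<^sup>2 \<partial>U) + e * (2 * C + 1)"
      by (subst Bochner_Integration.integral_add)
         (auto intro!: integrable_bounded_borel bounded_borel_power2 bounded_borel_T bK)
    also have "\<dots> \<le> kappa\<^sup>2 * (\<integral>x. (K f \<phi> x)\<^sup>2 \<partial>U) + e * (2 * C + 1)"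
      using T_contraction_K[OF f \<phi> mean] by simp
    finally have 1: "(\<integral>x. (T \<phi> x)\<^sup>2 \<partial>U) \<le> kappa\<^sup>2 * (\<integral>x. (K f \<phi> x)\<^sup>2 \<partial>U) + e * (2 * C + 1)" .
    have "(\<integral>x. (K f \<phi> x)\<^sup>2 \<partial>U) \<le> (\<integral>x. (\<phi> x)\<^sup>2 + e * (2 * C + 1) \<partial>U)"
    proof (rule integral_mono_AE)
      show "AE x in U. (K f \<phi> x)\<^sup>2 \<le> (\<phi> x)\<^sup>2 + e * (2 * C + 1)"
        using AE_U by eventually_elim (use close C e in \<open>auto intro!: sq\<close>)
    qed (intro integrable_bounded_borel Bochner_Integration.integrable_add bounded_borel_power2
          bounded_borel_const \<phi> bK)+
    also have "\<dots> = (\<integral>x. (\<phi> x)\<^sup>2 \<partial>U) + e * (2 * C + 1)"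
      by (subst Bochner_Integration.integral_add)
         (auto intro!: integrable_bounded_borel bounded_borel_power2 \<phi>)
    finally have "kappa\<^sup>2 * (\<integral>x. (K f \<phi> x)\<^sup>2 \<partial>U) \<le> kappa\<^sup>2 * ((\<integral>x. (\<phi> x)\<^sup>2 \<partial>U) + e * (2 * C + 1))"
      by (rule mult_left_mono) simp
    with 1 show ?thesis by (simp add: algebra_simps)
  qed
  define D where "D = (kappa\<^sup>2 + 1) * (2 * C + 1)"
  have D: "0 < D" using C by (simp add: D_def add_nonneg_pos)
  show ?thesis
  proof (rule field_le_epsilon)
    fix e :: real assume "0 < e"
    define e' where "e' = min 1 (e / D)"
    have "0 < e'" "e' \<le> 1" "e' * D \<le> e"
      using \<open>0 < e\<close> D by (auto simp: e'_def min_def field_simps)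
    then show "(\<integral>x. (T \<phi> x)\<^sup>2 \<partial>U) \<le> kappa\<^sup>2 * (\<integral>x. (\<phi> x)\<^sup>2 \<partial>U) + e"
      using main[of e'] by (simp add: D_def)
  qed
qed

lemma T_phase: "norm c = 1 \<Longrightarrow> T \<phi> (c *s x) = T \<phi> x"
  by (simp add: T_def Y_phase)

text \<open>For almost every \<open>z\<close> the map \<open>Y\<close> is continuous in its first
  argument at \<open>x\<close>, namely whenever \<open>rej x z\<close> is nonzero; dominated
  convergence does the rest.\<close>

lemma continuous_on_T:
  assumes \<phi>: "bounded_borel \<phi>" and cont: "continuous_on UNIV \<phi>"
  shows "continuous_on (sphere 0 1) (T \<phi>)"
  unfolding continuous_on_sequentially comp_def
proof (intro allI ballI impI)
  fix X and x :: "'a ^ 'n"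
  assume x: "x \<in> sphere 0 1" and "(\<forall>n. X n \<in> sphere 0 1) \<and> X \<longlonglongrightarrow> x"
  then have X: "X \<longlonglongrightarrow> x" and x1: "norm x = 1" by auto
  obtain C where [measurable]: "\<phi> \<in> borel_measurable borel" and C: "\<And>x. \<bar>\<phi> x\<bar> \<le> C"
    using bounded_borelE[OF \<phi>] by blast
  show "(\<lambda>n. T \<phi> (X n)) \<longlonglongrightarrow> T \<phi> x"
    unfolding T_def
  proof (rule integral_dominated_convergence[where w = "\<lambda>_. C"])
    show "AE z in U. (\<lambda>n. \<phi> (Y (X n) z)) \<longlonglongrightarrow> \<phi> (Y x z)"
      using AE_rej[OF x1]
    proof eventually_elim
      case (elim z)
      have "continuous_on UNIV (\<lambda>x. rej x z)" by (intro continuous_intros)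
      then have "(\<lambda>n. rej (X n) z) \<longlonglongrightarrow> rej x z"
        using X by (rule continuous_on_tendsto_compose) auto
      then have "(\<lambda>n. Y (X n) z) \<longlonglongrightarrow> Y x z"
        unfolding Y_def using elim by (intro tendsto_intros) auto
      with cont show ?case by (rule continuous_on_tendsto_compose) auto
    qed
  qed (use C in auto)
qed

text \<open>\<phi> itself need not be phase invariant, but \<open>T \<phi>\<close> is. The
  contraction is therefore applied to \<open>T \<phi>\<close> and carried back by writing
  \<open>b\<close> as the inner product of \<phi> with \<open>T (T \<phi>)\<close>.\<close>

lemma integral_T_le_continuous:
  assumes \<phi>: "bounded_borel \<phi>" and cont: "continuous_on UNIV \<phi>" and mean: "(\<integral>x. \<phi> x \<partial>U) = 0"
  shows "(\<integral>x. \<phi> x * T \<phi> x \<partial>U) \<le> kappa * (\<integral>x. (\<phi> x)\<^sup>2 \<partial>U)"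
proof -
  define a where "a = (\<integral>x. (\<phi> x)\<^sup>2 \<partial>U)"
  define b where "b = (\<integral>x. (T \<phi> x)\<^sup>2 \<partial>U)"
  have a0: "0 \<le> a" and b0: "0 \<le> b" by (simp_all add: a_def b_def)
  have bT: "bounded_borel (T \<phi>)" and bTT: "bounded_borel (T (T \<phi>))"
    using \<phi> by (auto intro: bounded_borel_T)
  have contr: "(\<integral>x. (T (T \<phi>) x)\<^sup>2 \<partial>U) \<le> kappa\<^sup>2 * b"
    unfolding b_def
    by (rule T_contraction_phase_invariant[OF bT continuous_on_T[OF \<phi> cont]])
       (simp_all add: T_phase integral_T_eq \<phi> mean)
  have "b = (\<integral>x. \<phi> x * T (T \<phi>) x \<partial>U)"
    using T_self_adjoint[OF \<phi> bT] by (simp add: b_def power2_eq_square)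
  then have "b\<^sup>2 \<le> a * (\<integral>x. (T (T \<phi>) x)\<^sup>2 \<partial>U)"
    unfolding a_def
    by (simp only:) (intro Cauchy_Schwarz_integral integrable_bounded_borel bounded_borel_power2
        bounded_borel_mult \<phi> bTT)
  also have "\<dots> \<le> a * (kappa\<^sup>2 * b)" using contr a0 by (rule mult_left_mono)
  finally have "b * b \<le> (a * kappa\<^sup>2) * b" by (simp add: power2_eq_square mult_ac)
  then have b_le: "b \<le> a * kappa\<^sup>2"
    using a0 b0 by (cases "b = 0") auto
  have "(\<integral>x. \<phi> x * T \<phi> x \<partial>U)\<^sup>2 \<le> a * b"
    unfolding a_def b_def
    by (intro Cauchy_Schwarz_integral integrable_bounded_borel bounded_borel_power2
        bounded_borel_mult \<phi> bT)
  also have "\<dots> \<le> a * (a * kappa\<^sup>2)" using b_le a0 by (rule mult_left_mono)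
  also have "\<dots> = (kappa * a)\<^sup>2" by (simp add: power2_eq_square mult_ac)
  finally show ?thesis
    unfolding a_def[symmetric] by (rule power2_le_imp_le) (use a0 kappa_pos in simp)
qed

lemma integrable_mu_iff:
  fixes F :: "'a ^ 'n \<Rightarrow> real"
  assumes [measurable]: "F \<in> borel_measurable borel" and x: "norm x = 1"
  shows "integrable \<mu> (\<lambda>R. F (R *v x)) \<longleftrightarrow> integrable U F"
  by (subst distr_mu_U[OF x, symmetric]) (simp add: integrable_distr_eq)

lemma integral_mu:
  fixes F :: "'a ^ 'n \<Rightarrow> real"
  assumes [measurable]: "F \<in> borel_measurable borel" and x: "norm x = 1"
  shows "(\<integral>R. F (R *v x) \<partial>\<mu>) = (\<integral>x. F x \<partial>U)"
  by (subst distr_mu_U[OF x, symmetric]) (simp add: integral_distr)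

lemma integrable_pair_L2:
  fixes \<psi> \<theta> :: "'a ^ 'n \<Rightarrow> real"
  assumes [measurable]: "\<psi> \<in> borel_measurable borel" "\<theta> \<in> borel_measurable borel"
    and "integrable U (\<lambda>x. (\<psi> x)\<^sup>2)" "integrable U (\<lambda>x. (\<theta> x)\<^sup>2)"
    and x: "norm x = 1" and y: "norm y = 1"
  shows "integrable \<mu> (\<lambda>R. \<psi> (R *v x) * \<theta> (R *v y))"
proof (rule Bochner_Integration.integrable_bound)
  have "integrable \<mu> (\<lambda>R. (\<psi> (R *v x))\<^sup>2)" "integrable \<mu> (\<lambda>R. (\<theta> (R *v y))\<^sup>2)"
    using integrable_mu_iff[of "\<lambda>x. (\<psi> x)\<^sup>2", OF _ x] integrable_mu_iff[of "\<lambda>x. (\<theta> x)\<^sup>2", OF _ y] assms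
    by auto
  then show "integrable \<mu> (\<lambda>R. (\<psi> (R *v x))\<^sup>2 + (\<theta> (R *v y))\<^sup>2)" by simp
  have "\<bar>p * q\<bar> \<le> p\<^sup>2 + q\<^sup>2" for p q :: real
  proof -
    have "2 * \<bar>p * q\<bar> \<le> p\<^sup>2 + q\<^sup>2"
      using sum_squares_bound[of "\<bar>p\<bar>" "\<bar>q\<bar>"] by (simp add: abs_mult)
    then show ?thesis using abs_ge_zero[of "p * q"] by linarith
  qed
  then show "AE R in \<mu>. norm (\<psi> (R *v x) * \<theta> (R *v y)) \<le> norm ((\<psi> (R *v x))\<^sup>2 + (\<theta> (R *v y))\<^sup>2)"
    by simp
qed measurable

text \<open>Replace \<psi> by a continuous \<open>g\<close> of mean zero at squared distance at most
  \<open>t\<^sup>2\<close>. The cross terms and the return from \<open>g\<close> to \<psi> cost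
  errors that vanish with \<open>t\<close>.\<close>

lemma correlation_le:
  fixes \<psi> :: "'a ^ 'n \<Rightarrow> real"
  assumes [measurable]: "\<psi> \<in> borel_measurable borel" and sq: "integrable U (\<lambda>x. (\<psi> x)\<^sup>2)"
    and mean: "(\<integral>x. \<psi> x \<partial>U) = 0"
    and xy: "norm x = 1" "norm y = 1" "h x y = 0"
  shows "(\<integral>R. \<psi> (R *v x) * \<psi> (R *v y) \<partial>\<mu>) \<le> kappa * (\<integral>x. (\<psi> x)\<^sup>2 \<partial>U)"
proof -
  define A where "A = (\<integral>x. (\<psi> x)\<^sup>2 \<partial>U)"
  have int_psi: "integrable U \<psi>"
    using sq by (rule U.square_integrable_imp_integrable[rotated]) simp
  have main: "(\<integral>R. \<psi> (R *v x) * \<psi> (R *v y) \<partial>\<mu>) \<le>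
      (kappa + t) * ((1 + t) * A + (1 + 1 / t) * t\<^sup>2) + (1 + 1 / t) * t\<^sup>2" if t: "0 < t" for t
  proof -
    obtain g0 where g0: "continuous_on UNIV g0" "bounded_borel g0" "(\<integral>x. (\<psi> x - g0 x)\<^sup>2 \<partial>U) < t\<^sup>2"
      using continuous_dense_L2[OF U.finite_measure_axioms sets_U _ sq, of "t\<^sup>2"] t by auto
    define m where "m = (\<integral>x. g0 x \<partial>U)"
    define g where "g x = g0 x - m" for x
    have bg: "bounded_borel g" unfolding g_def by (intro bounded_borel_diff bounded_borel_const g0)
    have [measurable]: "g \<in> borel_measurable borel" "g0 \<in> borel_measurable borel"
      using bg g0(2) by (auto intro: bounded_borel_measurable)
    have int_g0: "integrable U g0" using g0(2) by (rule integrable_bounded_borel)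
    have mean_g: "(\<integral>x. g x \<partial>U) = 0"
      unfolding g_def using int_g0 by (simp add: m_def)
    have cont_g: "continuous_on UNIV g" unfolding g_def by (intro continuous_intros g0)
    have sq_g: "integrable U (\<lambda>x. (g x)\<^sup>2)" by (intro integrable_bounded_borel bounded_borel_power2 bg)
    define d where "d x = \<psi> x - g x" for x
    have [measurable]: "d \<in> borel_measurable borel" unfolding d_def by measurable
    have sq_diff: "integrable U (\<lambda>x. (\<psi> x - k x)\<^sup>2)" if "bounded_borel k" for k
    proof (rule Bochner_Integration.integrable_bound)
      have [measurable]: "k \<in> borel_measurable borel" using that by (rule bounded_borel_measurable)
      show "integrable U (\<lambda>x. 2 * (\<psi> x)\<^sup>2 + 2 * (k x)\<^sup>2)"
        using sq integrable_bounded_borel[OF bounded_borel_power2[OF that]] by simp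
      have "(p - q)\<^sup>2 \<le> 2 * p\<^sup>2 + 2 * q\<^sup>2" for p q :: real
        using sum_squares_bound[of p "- q"] by (simp add: power2_diff)
      then show "AE x in U. norm ((\<psi> x - k x)\<^sup>2) \<le> norm (2 * (\<psi> x)\<^sup>2 + 2 * (k x)\<^sup>2)" by simp
      show "(\<lambda>x. (\<psi> x - k x)\<^sup>2) \<in> borel_measurable U" by measurable
    qed
    have sq_d: "integrable U (\<lambda>x. (d x)\<^sup>2)" unfolding d_def by (rule sq_diff[OF bg])
    \<comment> \<open>Centering does not spoil the approximation: as \<psi> has mean zero,
      subtracting the mean \<open>m\<close> of \<open>g0\<close> lowers the squared distance by
      \<open>m\<^sup>2\<close>.\<close>
    have D: "(\<integral>x. (d x)\<^sup>2 \<partial>U) \<le> t\<^sup>2"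
    proof -
      have "(\<integral>x. (d x)\<^sup>2 \<partial>U) = (\<integral>x. (\<psi> x - g0 x)\<^sup>2 + (2 * m) * (\<psi> x - g0 x) + m\<^sup>2 \<partial>U)"
        unfolding d_def g_def by (intro Bochner_Integration.integral_cong) (auto simp: power2_eq_square algebra_simps)
      also have "\<dots> = (\<integral>x. (\<psi> x - g0 x)\<^sup>2 \<partial>U) + 2 * m * (\<integral>x. \<psi> x - g0 x \<partial>U) + m\<^sup>2"
        using sq_diff[OF g0(2)] int_psi int_g0 by simp
      also have "(\<integral>x. \<psi> x - g0 x \<partial>U) = - m"
        using int_psi int_g0 mean by (simp add: m_def)
      finally have "(\<integral>x. (d x)\<^sup>2 \<partial>U) = (\<integral>x. (\<psi> x - g0 x)\<^sup>2 \<partial>U) - m\<^sup>2"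
        by (simp add: power2_eq_square)
      then show ?thesis using g0(3) zero_le_power2[of m] by linarith
    qed
    \<comment> \<open>The weight puts the small factor on \<psi> and \<open>g\<close> and the large
      factor \<open>1 / t\<close> on the error \<open>d\<close>, whose squared norm
      \<open>t\<^sup>2\<close> compensates it.\<close>
    have amgm: "p * q \<le> t / 2 * p\<^sup>2 + 1 / (2 * t) * q\<^sup>2" for p q :: real
    proof -
      have "0 \<le> (t * p - q)\<^sup>2" by simp
      then have "2 * t * (p * q) \<le> t\<^sup>2 * p\<^sup>2 + q\<^sup>2" by (simp add: power2_diff power_mult_distrib algebra_simps)
      then show ?thesis using t by (simp add: field_simps power2_eq_square)
    qed
    have pt: "\<psi> u * \<psi> v \<le> g u * g v + (t / 2 * ((g u)\<^sup>2 + (g v)\<^sup>2) + (1 + 1 / t) / 2 * ((d u)\<^sup>2 + (d v)\<^sup>2))" for u v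
    proof -
      have "\<psi> u * \<psi> v = g u * g v + g u * d v + g v * d u + d u * d v"
        by (simp add: d_def algebra_simps)
      moreover have "d u * d v \<le> 1 / 2 * ((d u)\<^sup>2 + (d v)\<^sup>2)"
        using sum_squares_bound[of "d u" "d v"] by simp
      moreover note amgm[of "g u" "d v"] amgm[of "g v" "d u"]
      moreover have "(1 + 1 / t) / 2 * ((d u)\<^sup>2 + (d v)\<^sup>2) =
          1 / 2 * ((d u)\<^sup>2 + (d v)\<^sup>2) + (1 / (2 * t) * (d u)\<^sup>2 + 1 / (2 * t) * (d v)\<^sup>2)"
        using t by (simp add: field_simps)
      moreover have "t / 2 * ((g u)\<^sup>2 + (g v)\<^sup>2) = t / 2 * (g u)\<^sup>2 + t / 2 * (g v)\<^sup>2"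
        by (rule distrib_left)
      ultimately show ?thesis by linarith
    qed
    have gx: "integrable \<mu> (\<lambda>R. (g (R *v x))\<^sup>2)" "integrable \<mu> (\<lambda>R. (g (R *v y))\<^sup>2)"
      "integrable \<mu> (\<lambda>R. (d (R *v x))\<^sup>2)" "integrable \<mu> (\<lambda>R. (d (R *v y))\<^sup>2)"
      using integrable_mu_iff[of "\<lambda>x. (g x)\<^sup>2"] integrable_mu_iff[of "\<lambda>x. (d x)\<^sup>2"] sq_g sq_d xy by auto
    have ig: "(\<integral>R. (g (R *v x))\<^sup>2 \<partial>\<mu>) = (\<integral>x. (g x)\<^sup>2 \<partial>U)" "(\<integral>R. (g (R *v y))\<^sup>2 \<partial>\<mu>) = (\<integral>x. (g x)\<^sup>2 \<partial>U)"
      "(\<integral>R. (d (R *v x))\<^sup>2 \<partial>\<mu>) = (\<integral>x. (d x)\<^sup>2 \<partial>U)" "(\<integral>R. (d (R *v y))\<^sup>2 \<partial>\<mu>) = (\<integral>x. (d x)\<^sup>2 \<partial>U)"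
      using integral_mu[of "\<lambda>x. (g x)\<^sup>2"] integral_mu[of "\<lambda>x. (d x)\<^sup>2"] xy by auto
    have gg: "integrable \<mu> (\<lambda>R. g (R *v x) * g (R *v y))"
      by (rule integrable_pair_L2) (use sq_g xy in auto)
    have "(\<integral>R. \<psi> (R *v x) * \<psi> (R *v y) \<partial>\<mu>) \<le>
        (\<integral>R. g (R *v x) * g (R *v y) + (t / 2 * ((g (R *v x))\<^sup>2 + (g (R *v y))\<^sup>2)
          + (1 + 1 / t) / 2 * ((d (R *v x))\<^sup>2 + (d (R *v y))\<^sup>2)) \<partial>\<mu>)"
      by (rule integral_mono[OF _ _ pt])
         (intro integrable_pair_L2 sq xy Bochner_Integration.integrable_add gg integrable_mult_right gx; measurable)+
    also have "\<dots> = (\<integral>R. g (R *v x) * g (R *v y) \<partial>\<mu>) + (t * (\<integral>x. (g x)\<^sup>2 \<partial>U) + (1 + 1 / t) * (\<integral>x. (d x)\<^sup>2 \<partial>U))"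
      using gg gx by (simp add: ig)
    finally have 0: "(\<integral>R. \<psi> (R *v x) * \<psi> (R *v y) \<partial>\<mu>) \<le> (\<integral>R. g (R *v x) * g (R *v y) \<partial>\<mu>) +
        (t * (\<integral>x. (g x)\<^sup>2 \<partial>U) + (1 + 1 / t) * (\<integral>x. (d x)\<^sup>2 \<partial>U))" .
    have "(\<integral>R. g (R *v x) * g (R *v y) \<partial>\<mu>) \<le> kappa * (\<integral>x. (g x)\<^sup>2 \<partial>U)"
      unfolding integral_T[OF bg bg xy] by (rule integral_T_le_continuous[OF bg cont_g mean_g])
    with 0 have 1: "(\<integral>R. \<psi> (R *v x) * \<psi> (R *v y) \<partial>\<mu>) \<le>
        (kappa + t) * (\<integral>x. (g x)\<^sup>2 \<partial>U) + (1 + 1 / t) * (\<integral>x. (d x)\<^sup>2 \<partial>U)"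
      by (simp add: algebra_simps)
    have pg: "(g u)\<^sup>2 \<le> (1 + t) * (\<psi> u)\<^sup>2 + (1 + 1 / t) * (d u)\<^sup>2" for u
    proof -
      have "(g u)\<^sup>2 = (\<psi> u)\<^sup>2 + (d u)\<^sup>2 + 2 * (\<psi> u * - d u)"
        by (simp add: d_def power2_eq_square algebra_simps)
      moreover have "2 * (\<psi> u * - d u) \<le> t * (\<psi> u)\<^sup>2 + 1 / t * (d u)\<^sup>2"
        using amgm[of "\<psi> u" "- d u"] by simp
      ultimately show ?thesis by (simp add: distrib_right)
    qed
    have "(\<integral>x. (g x)\<^sup>2 \<partial>U) \<le> (\<integral>x. (1 + t) * (\<psi> x)\<^sup>2 + (1 + 1 / t) * (d x)\<^sup>2 \<partial>U)"
      by (rule integral_mono[OF sq_g _ pg])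
         (intro Bochner_Integration.integrable_add integrable_mult_right sq sq_d)
    also have "\<dots> = (1 + t) * A + (1 + 1 / t) * (\<integral>x. (d x)\<^sup>2 \<partial>U)"
      using sq sq_d by (simp add: A_def)
    also have "\<dots> \<le> (1 + t) * A + (1 + 1 / t) * t\<^sup>2"
      using D t by (intro add_left_mono mult_left_mono) auto
    finally have 2: "(\<integral>x. (g x)\<^sup>2 \<partial>U) \<le> (1 + t) * A + (1 + 1 / t) * t\<^sup>2" .
    note 1
    also have "(kappa + t) * (\<integral>x. (g x)\<^sup>2 \<partial>U) + (1 + 1 / t) * (\<integral>x. (d x)\<^sup>2 \<partial>U) \<le>
        (kappa + t) * ((1 + t) * A + (1 + 1 / t) * t\<^sup>2) + (1 + 1 / t) * t\<^sup>2"
      using 2 D t kappa_pos by (intro add_mono mult_left_mono) auto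
    finally show ?thesis .
  qed
  \<comment> \<open>The bound of \<open>main\<close> after
    \<open>(1 + 1 / t) * t\<^sup>2 = t\<^sup>2 + t\<close>, which removes the singularity at
    0.\<close>
  have "((\<lambda>t. (kappa + t) * ((1 + t) * A + (t\<^sup>2 + t)) + (t\<^sup>2 + t)) \<longlongrightarrow>
      (kappa + 0) * ((1 + 0) * A + (0\<^sup>2 + 0)) + (0\<^sup>2 + 0)) (at_right 0)"
    by (intro tendsto_intros)
  then have "((\<lambda>t. (kappa + t) * ((1 + t) * A + (t\<^sup>2 + t)) + (t\<^sup>2 + t)) \<longlongrightarrow> kappa * A) (at_right 0)"
    by simp
  moreover have "\<forall>\<^sub>F t in at_right 0. (\<integral>R. \<psi> (R *v x) * \<psi> (R *v y) \<partial>\<mu>) \<le>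
      (kappa + t) * ((1 + t) * A + (t\<^sup>2 + t)) + (t\<^sup>2 + t)"
    unfolding eventually_at_right_field
  proof (intro exI[of _ 1] conjI allI impI)
    fix t :: real assume t: "0 < t"
    have "(1 + 1 / t) * t\<^sup>2 = t\<^sup>2 + t" using t by (simp add: field_simps power2_eq_square)
    then show "(\<integral>R. \<psi> (R *v x) * \<psi> (R *v y) \<partial>\<mu>) \<le>
        (kappa + t) * ((1 + t) * A + (t\<^sup>2 + t)) + (t\<^sup>2 + t)"
      using main[OF t] by simp
  qed simp
  ultimately show ?thesis
    unfolding A_def[symmetric] by (rule tendsto_lowerbound) simp
qed


section \<open>Second moment of the frame average and Chebyshev's inequality\<close>

lemma frame_second_moment_le:
  fixes b :: "nat \<Rightarrow> 'a ^ 'n" and \<psi> :: "'a ^ 'n \<Rightarrow> real"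
  assumes d: "d = CARD('n)"
    and b: "\<And>i j. i \<in> {1..d} \<Longrightarrow> j \<in> {1..d} \<Longrightarrow> h (b i) (b j) = (if i = j then 1 else 0)"
    and [measurable]: "\<psi> \<in> borel_measurable borel" and sq: "integrable U (\<lambda>x. (\<psi> x)\<^sup>2)"
    and mean: "(\<integral>x. \<psi> x \<partial>U) = 0"
  shows "integrable \<mu> (\<lambda>R. ((1 / real d) * (\<Sum>j=1..d. \<psi> (R *v b j)))\<^sup>2)"
    and "(\<integral>R. ((1 / real d) * (\<Sum>j=1..d. \<psi> (R *v b j)))\<^sup>2 \<partial>\<mu>) \<le> 2 / real d * (\<integral>x. (\<psi> x)\<^sup>2 \<partial>U)"
proof -
  define V where "V = (\<integral>x. (\<psi> x)\<^sup>2 \<partial>U)"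
  have d2: "2 \<le> d" using card d by simp
  have unit: "norm (b j) = 1" if "j \<in> {1..d}" for j
    using b that by (intro norm_eq_1_if_h_self) simp
  have expand: "((1 / real d) * (\<Sum>j=1..d. \<psi> (R *v b j)))\<^sup>2 =
      (1 / (real d)\<^sup>2) * (\<Sum>i=1..d. \<Sum>j=1..d. \<psi> (R *v b i) * \<psi> (R *v b j))" for R
    by (simp add: power_mult_distrib power_divide) (simp add: power2_eq_square sum_product)
  have int: "integrable \<mu> (\<lambda>R. \<psi> (R *v b i) * \<psi> (R *v b j))" if "i \<in> {1..d}" "j \<in> {1..d}" for i j
    by (rule integrable_pair_L2) (use sq unit that in auto)
  \<comment> \<open>One bound for both kinds of pairs: on the diagonal the terms
    \<open>kappa * V\<close> cancel and the variance \<open>V\<close> is left.\<close>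
  have le: "(\<integral>R. \<psi> (R *v b i) * \<psi> (R *v b j) \<partial>\<mu>) \<le> kappa * V + (if i = j then V - kappa * V else 0)"
    if ij: "i \<in> {1..d}" "j \<in> {1..d}" for i j
  proof (cases "i = j")
    case True
    have "(\<integral>R. (\<psi> (R *v b j))\<^sup>2 \<partial>\<mu>) = V"
      unfolding V_def by (rule integral_mu[of "\<lambda>x. (\<psi> x)\<^sup>2"]) (use unit ij in auto)
    then show ?thesis using True by (simp add: power2_eq_square)
  next
    case False
    have "(\<integral>R. \<psi> (R *v b i) * \<psi> (R *v b j) \<partial>\<mu>) \<le> kappa * V"
      unfolding V_def by (rule correlation_le) (use sq mean unit ij b[OF ij] False in auto)
    then show ?thesis using False by simp
  qed
  show "integrable \<mu> (\<lambda>R. ((1 / real d) * (\<Sum>j=1..d. \<psi> (R *v b j)))\<^sup>2)"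
    unfolding expand using int by (intro integrable_mult_right Bochner_Integration.integrable_sum) auto
  have "(\<integral>R. ((1 / real d) * (\<Sum>j=1..d. \<psi> (R *v b j)))\<^sup>2 \<partial>\<mu>) =
      1 / (real d)\<^sup>2 * (\<integral>R. (\<Sum>i=1..d. \<Sum>j=1..d. \<psi> (R *v b i) * \<psi> (R *v b j)) \<partial>\<mu>)"
    unfolding expand by simp
  also have "(\<integral>R. (\<Sum>i=1..d. \<Sum>j=1..d. \<psi> (R *v b i) * \<psi> (R *v b j)) \<partial>\<mu>) =
      (\<Sum>i=1..d. (\<integral>R. (\<Sum>j=1..d. \<psi> (R *v b i) * \<psi> (R *v b j)) \<partial>\<mu>))"
    by (rule Bochner_Integration.integral_sum) (intro Bochner_Integration.integrable_sum int)
  also have "\<dots> = (\<Sum>i=1..d. \<Sum>j=1..d. (\<integral>R. \<psi> (R *v b i) * \<psi> (R *v b j) \<partial>\<mu>))"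
    by (intro sum.cong refl Bochner_Integration.integral_sum int)
  finally have eq: "(\<integral>R. ((1 / real d) * (\<Sum>j=1..d. \<psi> (R *v b j)))\<^sup>2 \<partial>\<mu>) =
      1 / (real d)\<^sup>2 * (\<Sum>i=1..d. \<Sum>j=1..d. (\<integral>R. \<psi> (R *v b i) * \<psi> (R *v b j) \<partial>\<mu>))" .
  have "(\<Sum>i=1..d. \<Sum>j=1..d. (\<integral>R. \<psi> (R *v b i) * \<psi> (R *v b j) \<partial>\<mu>)) \<le>
      (\<Sum>i=1..d. \<Sum>j=1..d. kappa * V + (if i = j then V - kappa * V else 0))"
    by (intro sum_mono le)
  also have "\<dots> = real d * (real d * (kappa * V) + (V - kappa * V))"
    by (simp add: sum.distrib)
  \<comment> \<open>The diagonal contributes one \<open>V\<close>; the \<open>d - 1\<close> partners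
    of each index together contribute at most another, by the value of \<open>kappa\<close>. This is
    the origin of the constant 2.\<close>
  also have "\<dots> = real d * (V + ((real d - 1) * kappa) * V)" by (simp add: algebra_simps)
  also have "(real d - 1) * kappa = 1" using d2 d by (simp add: kappa_def)
  finally have "(\<Sum>i=1..d. \<Sum>j=1..d. (\<integral>R. \<psi> (R *v b i) * \<psi> (R *v b j) \<partial>\<mu>)) \<le> 2 * real d * V" by simp
  then have "1 / (real d)\<^sup>2 * (\<Sum>i=1..d. \<Sum>j=1..d. (\<integral>R. \<psi> (R *v b i) * \<psi> (R *v b j) \<partial>\<mu>)) \<le>
      1 / (real d)\<^sup>2 * (2 * real d * V)"
    by (rule mult_left_mono) simp
  also have "\<dots> = 2 / real d * V" using d2 by (simp add: power2_eq_square)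
  finally show "(\<integral>R. ((1 / real d) * (\<Sum>j=1..d. \<psi> (R *v b j)))\<^sup>2 \<partial>\<mu>) \<le> 2 / real d * (\<integral>x. (\<psi> x)\<^sup>2 \<partial>U)"
    unfolding eq V_def .
qed

text \<open>Chebyshev's inequality for the centered average \<open>Z\<close>: the failure
  probability is at most the second moment divided by \<open>\<delta>\<^sup>2 * V\<close>, hence at
  most \<open>2 / (real d * \<delta>\<^sup>2)\<close>.\<close>

lemma frame_concentration:
  fixes b :: "nat \<Rightarrow> 'a ^ 'n" and \<phi> :: "'a ^ 'n \<Rightarrow> real"
  assumes d: "d = CARD('n)"
    and b: "\<And>i j. i \<in> {1..d} \<Longrightarrow> j \<in> {1..d} \<Longrightarrow> h (b i) (b j) = (if i = j then 1 else 0)"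
    and [measurable]: "\<phi> \<in> borel_measurable borel" and sq: "integrable U (\<lambda>x. (\<phi> x)\<^sup>2)"
    and \<epsilon>: "0 < \<epsilon>" and \<delta>: "0 < \<delta>" and d_ge: "2 / (\<delta>\<^sup>2 * \<epsilon>) \<le> real d"
  shows "1 - \<epsilon> \<le> measure \<mu> {R. \<bar>(1 / real d) * (\<Sum>j=1..d. \<phi> (R *v b j)) - (\<integral>x. \<phi> x \<partial>U)\<bar>
      \<le> \<delta> * sqrt (\<integral>x. (\<phi> x - (\<integral>x. \<phi> x \<partial>U))\<^sup>2 \<partial>U)}" (is "_ \<le> measure \<mu> ?E")
proof -
  have d2: "2 \<le> d" using card d by simp
  define m where "m = (\<integral>x. \<phi> x \<partial>U)"
  define \<psi> where "\<psi> x = \<phi> x - m" for x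
  have int_phi: "integrable U \<phi>"
    using sq by (rule U.square_integrable_imp_integrable[rotated]) simp
  have [measurable]: "\<psi> \<in> borel_measurable borel" unfolding \<psi>_def by measurable
  have "(\<lambda>x. (\<psi> x)\<^sup>2) = (\<lambda>x. (\<phi> x)\<^sup>2 - (2 * m) * \<phi> x + m\<^sup>2)"
    by (simp add: fun_eq_iff \<psi>_def power2_eq_square algebra_simps)
  then have sq': "integrable U (\<lambda>x. (\<psi> x)\<^sup>2)" using sq int_phi by simp
  have mean: "(\<integral>x. \<psi> x \<partial>U) = 0" using int_phi by (simp add: \<psi>_def m_def)
  define V where "V = (\<integral>x. (\<psi> x)\<^sup>2 \<partial>U)"
  have V0: "0 \<le> V" by (simp add: V_def)
  define Z where "Z R = (1 / real d) * (\<Sum>j=1..d. \<psi> (R *v b j))" for R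
  have [measurable]: "Z \<in> borel_measurable borel" unfolding Z_def by measurable
  have Z: "Z R = (1 / real d) * (\<Sum>j=1..d. \<phi> (R *v b j)) - m" for R
    using d2 by (simp add: Z_def \<psi>_def sum_subtractf right_diff_distrib)
  have E: "?E = {R. \<bar>Z R\<bar> \<le> \<delta> * sqrt V}"
    by (simp add: Z V_def \<psi>_def m_def)
  have int_Z: "integrable \<mu> (\<lambda>R. (Z R)\<^sup>2)" and Z_le: "(\<integral>R. (Z R)\<^sup>2 \<partial>\<mu>) \<le> 2 / real d * V"
    unfolding Z_def V_def by (rule frame_second_moment_le[OF d b _ sq' mean]; simp)+
  show ?thesis
  \<comment> \<open>Markov's inequality divides by \<open>\<delta>\<^sup>2 * V\<close>. With zero
    variance the second moment bound itself makes \<open>Z\<close> vanish almost surely.\<close>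
  proof (cases "V = 0")
    case True
    then have "(\<integral>R. (Z R)\<^sup>2 \<partial>\<mu>) = 0" using Z_le by (intro antisym) auto
    then have "AE R in \<mu>. (Z R)\<^sup>2 = 0"
      using integral_nonneg_eq_0_iff_AE[OF int_Z] by simp
    then have "AE R in \<mu>. R \<in> ?E" unfolding E by eventually_elim (use True in simp)
    then have "measure \<mu> ?E = 1" unfolding E by (subst mu.prob_eq_1) auto
    then show ?thesis using \<epsilon> by simp
  next
    case False
    then have V: "0 < V" using V0 by simp
    have "1 - measure \<mu> ?E = measure \<mu> (space \<mu> - ?E)"
      unfolding E by (rule mu.prob_compl[symmetric]) measurable
    also have "\<dots> \<le> measure \<mu> {R \<in> space \<mu>. \<delta>\<^sup>2 * V \<le> (Z R)\<^sup>2}"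
    proof (rule mu.finite_measure_mono)
      show "space \<mu> - ?E \<subseteq> {R \<in> space \<mu>. \<delta>\<^sup>2 * V \<le> (Z R)\<^sup>2}"
      proof
        fix R assume "R \<in> space \<mu> - ?E"
        then have "\<delta> * sqrt V \<le> \<bar>Z R\<bar>" unfolding E by simp
        then have "(\<delta> * sqrt V)\<^sup>2 \<le> \<bar>Z R\<bar>\<^sup>2" by (rule power_mono) (use \<delta> V0 in simp)
        then show "R \<in> {R \<in> space \<mu>. \<delta>\<^sup>2 * V \<le> (Z R)\<^sup>2}"
          using V0 by (simp add: power_mult_distrib)
      qed
    qed measurable
    also have "\<dots> \<le> (\<integral>R. (Z R)\<^sup>2 \<partial>\<mu>) / (\<delta>\<^sup>2 * V)"
      by (rule integral_Markov_inequality_measure[OF int_Z, of "{}"]) (use \<delta> V in auto)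
    also have "\<dots> \<le> (2 / real d * V) / (\<delta>\<^sup>2 * V)"
      using Z_le \<delta> V by (intro divide_right_mono) auto
    also have "\<dots> = 2 / (real d * \<delta>\<^sup>2)" using V by simp
    also have "\<dots> \<le> \<epsilon>" using d_ge d2 \<delta> \<epsilon> by (simp add: field_simps)
    finally show ?thesis by simp
  qed
qed

end

section \<open>Rotation invariance of the uniform measure\<close>

text \<open>The image \<open>N\<close> of \<open>lborel\<close> is translation invariant and agrees with \<open>lborel\<close> on balls around the
  origin. Evaluating \<open>(N \<times> lborel) {(x, y). x \<in> A \<and> x - y \<in> B}\<close> in both orders for the unit ball \<open>B\<close>
  gives \<open>N A * lborel B = lborel A * N B\<close>.\<close>

lemma distr_isometry_lborel:
  fixes f :: "'b::euclidean_space \<Rightarrow> 'b"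
  assumes lin: "linear f" and iso: "\<And>x. norm (f x) = norm x"
  shows "distr lborel borel f = lborel"
proof -
  have [measurable]: "f \<in> borel_measurable borel"
    using lin by (intro borel_measurable_continuous_onI linear_continuous_on linear_conv_bounded_linear[THEN iffD1])
  have "inj f" using lin iso by (metis linear_injective_0 norm_eq_zero)
  then have surj: "surj f" using lin linear_injective_imp_surjective by blast
  define N where "N = distr lborel borel f"
  define B where "B = ball (0::'b) 1"
  have [measurable]: "B \<in> sets borel" by (simp add: B_def)
  have sets_N [measurable_cong, simp]: "sets N = sets borel" by (simp add: N_def)
  have f_ball: "f -` ball 0 r = ball 0 r" for r using iso by auto
  have N_ball: "emeasure N (ball 0 r) = emeasure lborel (ball (0::'b) r)" for r
    unfolding N_def by (subst emeasure_distr) (auto simp: f_ball)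
  interpret N: sigma_finite_measure N
  proof
    show "\<exists>A. countable A \<and> A \<subseteq> sets N \<and> \<Union>A = space N \<and> (\<forall>a\<in>A. emeasure N a \<noteq> \<infinity>)"
    proof (intro exI[of _ "range (\<lambda>n::nat. ball 0 (real n))"] conjI ballI)
      show "\<Union> (range (\<lambda>n::nat. ball (0::'b) (real n))) = space N"
        using reals_Archimedean2 by (auto simp: N_def)
      fix a assume "a \<in> range (\<lambda>n::nat. ball (0::'b) (real n))"
      then show "emeasure N a \<noteq> \<infinity>"
        using emeasure_bounded_finite[of a] by (auto simp: N_ball)
    qed auto
  qed
  interpret P: pair_sigma_finite N lborel ..
  have transl: "(\<integral>\<^sup>+y. F (c + y) \<partial>lborel) = (\<integral>\<^sup>+y. F y \<partial>lborel)"
    if [measurable]: "F \<in> borel_measurable borel" for F :: "'b \<Rightarrow> ennreal" and c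
    by (subst (2) lborel_distr_plus[of c, symmetric]) (simp add: nn_integral_distr)
  have transl_N: "(\<integral>\<^sup>+x. F (x + c) \<partial>N) = (\<integral>\<^sup>+x. F x \<partial>N)"
    if [measurable]: "F \<in> borel_measurable borel" for F :: "'b \<Rightarrow> ennreal" and c
  proof -
    \<comment> \<open>Pulled back along \<open>f\<close>, translation by \<open>c\<close> becomes
      translation by \<open>c'\<close>, under which \<open>lborel\<close> is invariant.\<close>
    obtain c' where c': "c = f c'" using surj by blast
    have "(\<integral>\<^sup>+x. F (x + c) \<partial>N) = (\<integral>\<^sup>+x. F (f (c' + x)) \<partial>lborel)"
      unfolding N_def by (simp add: nn_integral_distr c' linear_add[OF lin] add.commute)
    also have "\<dots> = (\<integral>\<^sup>+x. F (f x) \<partial>lborel)" by (rule transl) measurable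
    also have "\<dots> = (\<integral>\<^sup>+x. F x \<partial>N)" unfolding N_def by (simp add: nn_integral_distr)
    finally show ?thesis .
  qed
  have "emeasure N A = emeasure lborel A" if [measurable]: "A \<in> sets borel" for A
  proof -
    have inner: "(\<integral>\<^sup>+y. indicator B (x - y) \<partial>lborel) = emeasure lborel B" for x
    proof -
      have "(\<integral>\<^sup>+y. indicator B (x - y) \<partial>lborel) = (\<integral>\<^sup>+y. indicator B (- x + y) \<partial>lborel)"
        by (intro nn_integral_cong) (auto simp: B_def indicator_def norm_minus_commute)
      also have "\<dots> = (\<integral>\<^sup>+y. indicator B y \<partial>lborel)" by (rule transl) measurable
      finally show ?thesis by simp
    qed
    have "emeasure N A * emeasure lborel B = (\<integral>\<^sup>+x. indicator A x * emeasure lborel B \<partial>N)"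
      by (simp add: nn_integral_multc)
    also have "\<dots> = (\<integral>\<^sup>+x. (\<integral>\<^sup>+y. indicator A x * indicator B (x - y) \<partial>lborel) \<partial>N)"
      by (simp add: nn_integral_cmult inner)
    also have "\<dots> = (\<integral>\<^sup>+y. (\<integral>\<^sup>+x. indicator A x * indicator B (x - y) \<partial>N) \<partial>lborel)"
      by (rule P.Fubini'[symmetric]) measurable
    also have "\<dots> = (\<integral>\<^sup>+y. (\<integral>\<^sup>+x. indicator A (x + y) * indicator B (x + y - y) \<partial>N) \<partial>lborel)"
      by (intro nn_integral_cong transl_N[symmetric]) measurable
    also have "\<dots> = (\<integral>\<^sup>+y. (\<integral>\<^sup>+x. indicator A (x + y) * indicator B x \<partial>N) \<partial>lborel)"
      by simp
    also have "\<dots> = (\<integral>\<^sup>+x. (\<integral>\<^sup>+y. indicator A (x + y) * indicator B x \<partial>lborel) \<partial>N)"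
      by (rule P.Fubini') measurable
    also have "\<dots> = (\<integral>\<^sup>+x. emeasure lborel A * indicator B x \<partial>N)"
    proof (intro nn_integral_cong)
      fix x
      have "(\<integral>\<^sup>+y. indicator A (x + y) \<partial>lborel) = (\<integral>\<^sup>+y. indicator A y \<partial>lborel)"
        by (rule transl) measurable
      then show "(\<integral>\<^sup>+y. indicator A (x + y) * indicator B x \<partial>lborel) = emeasure lborel A * indicator B x"
        by (simp add: nn_integral_multc)
    qed
    also have "\<dots> = emeasure lborel A * emeasure N B" by (simp add: nn_integral_cmult)
    also have "emeasure N B = emeasure lborel B" unfolding B_def by (rule N_ball)
    finally have "emeasure N A * emeasure lborel B = emeasure lborel A * emeasure lborel B" .
    moreover have "emeasure lborel B \<noteq> \<top>"
      using emeasure_bounded_finite[of B] by (auto simp: B_def)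
    moreover have "emeasure lborel B \<noteq> 0"
    proof -
      have "0 < measure lebesgue (ball (0::'b) 1)" by (simp add: content_ball_pos)
      then show ?thesis by (auto simp: measure_def B_def)
    qed
    ultimately show ?thesis by (simp add: mult.commute[of _ "emeasure lborel B"] ennreal_mult_cancel_left)
  qed
  then show ?thesis unfolding N_def[symmetric] by (intro measure_eqI) simp_all
qed

text \<open>A linear isometry commutes with the formation of cones over the origin, so the
  invariance of Lebesgue measure passes to the sphere.\<close>

lemma emeasure_uniform_sphere_isometry:
  fixes f :: "'b::euclidean_space \<Rightarrow> 'b"
  assumes lin: "linear f" and iso: "\<And>x. norm (f x) = norm x"
    and A: "A \<in> sets borel" "A \<subseteq> sphere 0 1"
  shows "emeasure uniform_sphere (f -` A) = emeasure uniform_sphere A"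
proof -
  have f [measurable]: "f \<in> borel_measurable borel"
    using lin by (intro borel_measurable_continuous_onI linear_continuous_on linear_conv_bounded_linear[THEN iffD1])
  have A': "f -` A \<in> sets borel" "f -` A \<subseteq> sphere 0 1"
    using measurable_sets_borel[OF f A(1)] A(2) iso by auto
  define cone where "cone A = {r *\<^sub>R x | r x. 0 < r \<and> r \<le> 1 \<and> x \<in> A}" for A :: "'b set"
  have cone_iff: "y \<in> cone A \<longleftrightarrow> y \<noteq> 0 \<and> norm y \<le> 1 \<and> y /\<^sub>R norm y \<in> A" if "A \<subseteq> sphere 0 1" for A y
  proof
    assume "y \<in> cone A"
    then obtain r x where rx: "y = r *\<^sub>R x" "0 < r" "r \<le> 1" "x \<in> A" by (auto simp: cone_def)
    with that have "norm x = 1" by auto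
    with rx show "y \<noteq> 0 \<and> norm y \<le> 1 \<and> y /\<^sub>R norm y \<in> A" by auto
  next
    assume "y \<noteq> 0 \<and> norm y \<le> 1 \<and> y /\<^sub>R norm y \<in> A"
    then have "y = norm y *\<^sub>R (y /\<^sub>R norm y)" "0 < norm y" "norm y \<le> 1" "y /\<^sub>R norm y \<in> A" by auto
    then show "y \<in> cone A" unfolding cone_def by blast
  qed
  have cone_meas: "cone A \<in> sets borel"
  proof -
    have "cone A = {y. y \<noteq> 0 \<and> norm y \<le> 1 \<and> y /\<^sub>R norm y \<in> A}" using cone_iff[OF A(2)] by auto
    also have "\<dots> \<in> sets borel" using A(1) by measurable
    finally show ?thesis .
  qed
  have "cone (f -` A) = f -` cone A"
  proof (rule set_eqI)
    fix y
    have "f y = 0 \<longleftrightarrow> y = 0" using iso by (metis norm_eq_zero)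
    then show "y \<in> cone (f -` A) \<longleftrightarrow> y \<in> f -` cone A"
      using cone_iff[OF A(2)] cone_iff[OF A'(2)] by (simp add: iso linear_scale[OF lin])
  qed
  then have "emeasure lborel (cone (f -` A)) = emeasure (distr lborel borel f) (cone A)"
    using cone_meas by (simp add: emeasure_distr)
  then have "emeasure sphere_area (f -` A) = emeasure sphere_area A"
    using emeasure_sphere_area[OF A] emeasure_sphere_area[OF A']
    by (simp add: distr_isometry_lborel[OF lin iso] cone_def)
  moreover have "sphere 0 1 \<inter> A = A" "sphere 0 1 \<inter> f -` A = f -` A" using A(2) A'(2) by auto
  moreover have "A \<in> sets sphere_area" "f -` A \<in> sets sphere_area" "sphere 0 1 \<in> sets (sphere_area :: 'b measure)"
    using A A' by (auto simp: sets_restrict_space_iff)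
  ultimately show ?thesis by (simp add: uniform_sphere_def)
qed

section \<open>Transfer to measures living on the group and on the sphere\<close>

context conj_field
begin

lemma closed_G: "closed G"
proof -
  have "continuous_on UNIV (\<lambda>A :: 'a ^ 'n ^ 'n. ctr A ** A)" "continuous_on UNIV (\<lambda>A :: 'a ^ 'n ^ 'n. A ** ctr A)"
    by (auto simp: matrix_matrix_mult_def ctr_def intro!: continuous_intros)
  then show ?thesis
    unfolding G_def by (intro closed_Collect_conj closed_Collect_eq continuous_intros)
qed

lemma linear_G: "linear ((*v) (A :: 'a ^ 'n ^ 'n))"
  by (rule linearI) (simp_all add: matrix_vector_right_distrib G_scaleR)

lemma haar_sphere_of_normalized_haar:
  fixes uG :: "('a ^ 'n ^ 'n) measure"
  assumes haar: "normalized_haar G uG" and card: "2 \<le> CARD('n)"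
  shows "haar_sphere cj (distr uG borel (\<lambda>x. x)) (distr (uniform_sphere :: ('a ^ 'n) measure) borel (\<lambda>x. x))"
proof -
  interpret uG: prob_space uG using haar by (simp add: normalized_haar_def)
  interpret uS: prob_space "uniform_sphere :: ('a ^ 'n) measure" by (rule prob_space_uniform_sphere)
  have sets_uG [measurable_cong]: "sets uG = sets (restrict_space borel G)"
    and inv: "\<And>g A. g \<in> G \<Longrightarrow> A \<in> sets uG \<Longrightarrow> emeasure uG ((\<lambda>h. g ** h) ` A) = emeasure uG A"
    using haar by (auto simp: normalized_haar_def)
  have G [measurable]: "(G :: ('a ^ 'n ^ 'n) set) \<in> sets borel" by (rule borel_closed[OF closed_G])
  have space_uG: "space uG = G"
    using sets_eq_imp_space_eq[OF sets_uG] by (simp add: space_restrict_space)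
  have in_uG: "A \<in> sets uG \<longleftrightarrow> A \<in> sets borel \<and> A \<subseteq> G" for A
    unfolding sets_uG by (subst sets_restrict_space_iff) auto
  have id [measurable]: "(\<lambda>x. x) \<in> uG \<rightarrow>\<^sub>M borel"
    unfolding measurable_cong_sets[OF sets_uG refl] by (rule measurable_restrict_space1) simp
  have idS [measurable]: "(\<lambda>x. x) \<in> (uniform_sphere :: ('a ^ 'n) measure) \<rightarrow>\<^sub>M borel"
    unfolding measurable_cong_sets[OF sets_uniform_sphere refl] by (rule measurable_restrict_space1) simp
  show ?thesis
  proof (intro haar_sphere.intro haar_sphere_axioms.intro conj_field_axioms)
    show "prob_space (distr uG borel (\<lambda>x. x))" by (rule uG.prob_space_distr) (rule id)
    show "prob_space (distr (uniform_sphere :: ('a ^ 'n) measure) borel (\<lambda>x. x))"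
      by (rule uS.prob_space_distr) (rule idS)
    show "AE g in distr uG borel (\<lambda>x. x). g \<in> G"
      by (subst AE_distr_iff) (auto simp: space_uG)
    show "AE x in distr (uniform_sphere :: ('a ^ 'n) measure) borel (\<lambda>x. x). norm x = 1"
      by (subst AE_distr_iff) auto
    show "2 \<le> CARD('n)" by (rule card)
  next
    fix g :: "'a ^ 'n ^ 'n" assume g: "g \<in> G"
    show "distr (distr uG borel (\<lambda>x. x)) borel ((**) g) = distr uG borel (\<lambda>x. x)"
    proof (rule measure_eqI)
      fix A assume "A \<in> sets (distr (distr uG borel (\<lambda>x. x)) borel ((**) g))"
      then have A [measurable]: "A \<in> sets borel" by simp
      \<comment> \<open>\<open>normalized_haar\<close> speaks of images, \<open>distr\<close> of
        preimages. Multiplication by \<open>g\<close> maps this preimage onto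
        \<open>A \<inter> G\<close>.\<close>
      define B where "B = {k \<in> G. g ** k \<in> A}"
      have B: "B \<in> sets uG"
        unfolding in_uG B_def by (auto intro!: measurable)
      have img: "(\<lambda>k. g ** k) ` B = A \<inter> G"
      proof (intro equalityI subsetI)
        fix k assume "k \<in> A \<inter> G"
        moreover have "k = g ** (ctr g ** k)"
          using g by (simp add: matrix_mul_assoc G_def)
        ultimately show "k \<in> (\<lambda>k. g ** k) ` B"
          using G_mult[OF G_ctr[OF g]] by (intro image_eqI[of _ _ "ctr g ** k"]) (auto simp: B_def)
      qed (use G_mult[OF g] in \<open>auto simp: B_def\<close>)
      have "emeasure (distr (distr uG borel (\<lambda>x. x)) borel ((**) g)) A = emeasure uG B"
        by (simp add: emeasure_distr space_uG B_def vimage_def Int_def conj_commute)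
      also have "\<dots> = emeasure uG (A \<inter> G)" using inv[OF g B] by (simp add: img)
      also have "\<dots> = emeasure (distr uG borel (\<lambda>x. x)) A"
        by (simp add: emeasure_distr space_uG)
      finally show "emeasure (distr (distr uG borel (\<lambda>x. x)) borel ((**) g)) A =
          emeasure (distr uG borel (\<lambda>x. x)) A" .
    qed simp
    show "distr (distr (uniform_sphere :: ('a ^ 'n) measure) borel (\<lambda>x. x)) borel ((*v) g) =
        distr uniform_sphere borel (\<lambda>x. x)"
    proof (rule measure_eqI)
      fix A assume "A \<in> sets (distr (distr (uniform_sphere :: ('a ^ 'n) measure) borel (\<lambda>x. x)) borel ((*v) g))"
      then have A [measurable]: "A \<in> sets borel" by simp
      have "emeasure (distr (distr (uniform_sphere :: ('a ^ 'n) measure) borel (\<lambda>x. x)) borel ((*v) g)) A =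
          emeasure uniform_sphere ((*v) g -` A \<inter> sphere 0 1)"
        by (subst distr_distr) (simp_all add: comp_def emeasure_distr)
      also have "(*v) g -` A \<inter> sphere 0 1 = (*v) g -` (A \<inter> sphere 0 1)"
        using norm_G[OF g] by auto
      also have "emeasure uniform_sphere \<dots> = emeasure uniform_sphere (A \<inter> sphere 0 1)"
        by (rule emeasure_uniform_sphere_isometry[OF linear_G norm_G[OF g]]) auto
      also have "\<dots> = emeasure (distr (uniform_sphere :: ('a ^ 'n) measure) borel (\<lambda>x. x)) A"
        by (simp add: emeasure_distr)
      finally show "emeasure (distr (distr (uniform_sphere :: ('a ^ 'n) measure) borel (\<lambda>x. x)) borel ((*v) g)) A =
          emeasure (distr uniform_sphere borel (\<lambda>x. x)) A" .
    qed simp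
  qed simp_all
qed

lemma haar_frame_concentration:
  fixes uG :: "('a ^ 'n ^ 'n) measure" and b :: "nat \<Rightarrow> 'a ^ 'n" and \<phi> :: "'a ^ 'n \<Rightarrow> real"
    and R :: "'w \<Rightarrow> 'a ^ 'n ^ 'n"
  assumes \<epsilon>: "0 < \<epsilon>" and \<delta>: "0 < \<delta>" and d: "d = CARD('n)" and d4: "4 \<le> d"
    and d_ge: "2 / (\<delta>\<^sup>2 * \<epsilon>) \<le> real d"
    and b: "\<forall>i\<in>{1..d}. \<forall>j\<in>{1..d}. h (b i) (b j) = (if i = j then 1 else 0)"
    and haar: "normalized_haar G uG"
    and R [measurable]: "R \<in> M \<rightarrow>\<^sub>M uG" and distr: "distr M uG R = uG"
    and \<phi>: "\<phi> \<in> borel_measurable uniform_sphere" and sq: "integrable uniform_sphere (\<lambda>x. (\<phi> x)\<^sup>2)"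
  shows "\<P>(\<omega> in M. \<bar>(1 / real d) * (\<Sum>j=1..d. \<phi> (R \<omega> *v b j)) - prob_space.expectation uniform_sphere \<phi>\<bar>
            \<le> \<delta> * sqrt (prob_space.variance uniform_sphere \<phi>)) \<ge> 1 - \<epsilon>"
proof -
  define U where "U = distr (uniform_sphere :: ('a ^ 'n) measure) borel (\<lambda>x. x)"
  define \<mu> where "\<mu> = distr uG borel (\<lambda>x. x)"
  interpret H: haar_sphere cj \<mu> U
    unfolding U_def \<mu>_def by (rule haar_sphere_of_normalized_haar[OF haar]) (use d d4 in simp)
  have sets_uG: "sets uG = sets (restrict_space borel G)" using haar by (simp add: normalized_haar_def)
  have space_uG: "space uG = G"
    using sets_eq_imp_space_eq[OF sets_uG] by (simp add: space_restrict_space)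
  have id [measurable]: "(\<lambda>x. x) \<in> uG \<rightarrow>\<^sub>M borel"
    unfolding measurable_cong_sets[OF sets_uG refl] by (rule measurable_restrict_space1) simp
  have idS [measurable]: "(\<lambda>x. x) \<in> (uniform_sphere :: ('a ^ 'n) measure) \<rightarrow>\<^sub>M borel"
    unfolding measurable_cong_sets[OF sets_uniform_sphere refl] by (rule measurable_restrict_space1) simp
  \<comment> \<open>\<phi> is measurable only on the sphere. Extension by 0 gives a Borel function
    on the whole space, equal to \<phi> at all unit vectors and hence at all
    \<open>R \<omega> *v b j\<close>.\<close>
  define \<phi>' where "\<phi>' x = indicator (sphere 0 1) x *\<^sub>R \<phi> x" for x
  have \<phi>'_eq: "\<phi>' x = \<phi> x" if "norm x = 1" for x using that by (simp add: \<phi>'_def)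
  have [measurable]: "\<phi>' \<in> borel_measurable borel"
    using \<phi> unfolding measurable_cong_sets[OF sets_uniform_sphere refl] \<phi>'_def
    by (subst (asm) borel_measurable_restrict_space_iff) auto
  have transfer: "(\<integral>x. F (\<phi>' x) \<partial>U) = (\<integral>x. F (\<phi> x) \<partial>uniform_sphere)"
    if [measurable]: "F \<in> borel_measurable borel" for F :: "real \<Rightarrow> real"
    unfolding U_def
    by (subst integral_distr) (auto intro!: Bochner_Integration.integral_cong simp: \<phi>'_eq)
  have sq': "integrable U (\<lambda>x. (\<phi>' x)\<^sup>2)"
    unfolding U_def
    by (subst integrable_distr_eq, measurable)
       (rule Bochner_Integration.integrable_cong[THEN iffD1, OF refl _ sq], simp add: \<phi>'_eq)
  define m where "m = (\<integral>x. \<phi> x \<partial>uniform_sphere)"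
  have m: "(\<integral>x. \<phi>' x \<partial>U) = m" unfolding m_def using transfer[of "\<lambda>t. t"] by simp
  define V where "V = (\<integral>x. (\<phi> x - m)\<^sup>2 \<partial>uniform_sphere)"
  have V: "(\<integral>x. (\<phi>' x - m)\<^sup>2 \<partial>U) = V" unfolding V_def using transfer[of "\<lambda>t. (t - m)\<^sup>2"] by simp
  define E where "E = {g. \<bar>(1 / real d) * (\<Sum>j=1..d. \<phi>' (g *v b j)) - m\<bar> \<le> \<delta> * sqrt V}"
  have E [measurable]: "E \<in> sets borel" unfolding E_def by measurable
  have "1 - \<epsilon> \<le> measure \<mu> E"
    using H.frame_concentration[OF d _ _ sq' \<epsilon> \<delta> d_ge, of b] b unfolding m V E_def by simp
  also have "\<dots> = measure uG (E \<inter> G)"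
    unfolding \<mu>_def by (subst measure_distr) (auto simp: space_uG)
  also have "\<dots> = measure (distr M uG R) (E \<inter> G)" by (simp add: distr)
  also have "\<dots> = measure M (R -` (E \<inter> G) \<inter> space M)"
  proof (rule measure_distr[OF R])
    show "E \<inter> G \<in> sets uG"
      unfolding sets_uG using E borel_closed[OF closed_G] by (subst sets_restrict_space_iff) auto
  qed
  also have "R -` (E \<inter> G) \<inter> space M =
      {\<omega> \<in> space M. \<bar>(1 / real d) * (\<Sum>j=1..d. \<phi> (R \<omega> *v b j)) - m\<bar> \<le> \<delta> * sqrt V}"
  proof -
    have unit: "norm (b j) = 1" if "j \<in> {1..d}" for j
      using b that by (intro norm_eq_1_if_h_self) simp
    have RG: "R \<omega> \<in> G" if "\<omega> \<in> space M" for \<omega>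
      using measurable_space[OF R that] by (simp add: space_uG)
    have "(\<Sum>j=1..d. \<phi>' (R \<omega> *v b j)) = (\<Sum>j=1..d. \<phi> (R \<omega> *v b j))" if "\<omega> \<in> space M" for \<omega>
      by (intro sum.cong refl \<phi>'_eq) (simp add: norm_G[OF RG[OF that]] unit)
    then show ?thesis using RG by (auto simp: E_def)
  qed
  finally show ?thesis by (simp only: m_def V_def)
qed

end

section \<open>The real and the complex case\<close>

lemma conj_field_real: "conj_field (\<lambda>x :: real. x)"
proof (rule conj_field.intro)
  show "linear (\<lambda>x :: real. x)" by (rule bounded_linear.linear[OF bounded_linear_ident])
qed (simp_all add: power2_eq_square)

lemma conj_field_complex: "conj_field cnj"
proof (rule conj_field.intro)
  show "linear cnj" by (rule bounded_linear.linear[OF bounded_linear_cnj])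
  show "a * cnj a = of_real ((norm a)\<^sup>2)" for a by (rule complex_norm_square[symmetric])
qed simp_all

lemma orthogonal_group_eq: "(orthogonal_group :: (real ^ 'n ^ 'n) set) = conj_field.G (\<lambda>x. x)"
  by (simp add: orthogonal_group_def orthogonal_matrix_def transpose_def
      conj_field.G_def[OF conj_field_real] conj_field.ctr_def[OF conj_field_real])

lemma unitary_group_eq: "(unitary_group :: (complex ^ 'n ^ 'n) set) = conj_field.G cnj"
  by (simp add: unitary_group_def conj_transpose_def
      conj_field.G_def[OF conj_field_complex] conj_field.ctr_def[OF conj_field_complex])

theorem theorem1:
  fixes \<epsilon> \<delta> :: real and d :: nat
  assumes "\<epsilon> > 0" and "\<delta> > 0"
    and "d = CARD('n::finite)" and "d \<ge> 4" and "real d \<ge> 2 / (\<delta>\<^sup>2 * \<epsilon>)"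
  shows
    "(\<forall>(b :: nat \<Rightarrow> real ^ 'n) (uG :: (real ^ 'n ^ 'n) measure)
        (M :: 'w measure) (R :: 'w \<Rightarrow> real ^ 'n ^ 'n) (\<phi> :: real ^ 'n \<Rightarrow> real).
        real_orthonormal_basis d b \<longrightarrow>
        normalized_haar orthogonal_group uG \<longrightarrow>
        prob_space M \<longrightarrow> R \<in> M \<rightarrow>\<^sub>M uG \<longrightarrow> distr M uG R = uG \<longrightarrow>
        \<phi> \<in> borel_measurable uniform_sphere \<longrightarrow> integrable uniform_sphere (\<lambda>x. (\<phi> x)\<^sup>2) \<longrightarrow>
        \<P>(\<omega> in M. \<bar>(1 / real d) * (\<Sum>j=1..d. \<phi> (R \<omega> *v b j)) - prob_space.expectation uniform_sphere \<phi>\<bar>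
            \<le> \<delta> * sqrt (prob_space.variance uniform_sphere \<phi>)) \<ge> 1 - \<epsilon>)
   \<and> (\<forall>(b :: nat \<Rightarrow> complex ^ 'n) (uG :: (complex ^ 'n ^ 'n) measure)
        (M :: 'w measure) (R :: 'w \<Rightarrow> complex ^ 'n ^ 'n) (\<phi> :: complex ^ 'n \<Rightarrow> real).
        complex_orthonormal_basis d b \<longrightarrow>
        normalized_haar unitary_group uG \<longrightarrow>
        prob_space M \<longrightarrow> R \<in> M \<rightarrow>\<^sub>M uG \<longrightarrow> distr M uG R = uG \<longrightarrow>
        \<phi> \<in> borel_measurable uniform_sphere \<longrightarrow> integrable uniform_sphere (\<lambda>x. (\<phi> x)\<^sup>2) \<longrightarrow>
        \<P>(\<omega> in M. \<bar>(1 / real d) * (\<Sum>j=1..d. \<phi> (R \<omega> *v b j)) - prob_space.expectation uniform_sphere \<phi>\<bar>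
            \<le> \<delta> * sqrt (prob_space.variance uniform_sphere \<phi>)) \<ge> 1 - \<epsilon>)"
proof (intro conjI allI impI)
  fix b :: "nat \<Rightarrow> real ^ 'n" and uG :: "(real ^ 'n ^ 'n) measure" and M :: "'w measure"
    and R :: "'w \<Rightarrow> real ^ 'n ^ 'n" and \<phi> :: "real ^ 'n \<Rightarrow> real"
  assume b: "real_orthonormal_basis d b"
    and *: "normalized_haar orthogonal_group uG" "R \<in> M \<rightarrow>\<^sub>M uG" "distr M uG R = uG"
      "\<phi> \<in> borel_measurable uniform_sphere" "integrable uniform_sphere (\<lambda>x. (\<phi> x)\<^sup>2)"
  have "\<forall>i\<in>{1..d}. \<forall>j\<in>{1..d}. conj_field.h (\<lambda>x. x) (b i) (b j) = (if i = j then 1 else 0)"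
    using b by (simp add: real_orthonormal_basis_def conj_field.h_def[OF conj_field_real] inner_vec_def)
  from conj_field.haar_frame_concentration[OF conj_field_real assms this *[unfolded orthogonal_group_eq]]
  show "\<P>(\<omega> in M. \<bar>(1 / real d) * (\<Sum>j=1..d. \<phi> (R \<omega> *v b j)) - prob_space.expectation uniform_sphere \<phi>\<bar>
            \<le> \<delta> * sqrt (prob_space.variance uniform_sphere \<phi>)) \<ge> 1 - \<epsilon>" .
next
  fix b :: "nat \<Rightarrow> complex ^ 'n" and uG :: "(complex ^ 'n ^ 'n) measure" and M :: "'w measure"
    and R :: "'w \<Rightarrow> complex ^ 'n ^ 'n" and \<phi> :: "complex ^ 'n \<Rightarrow> real"
  assume b: "complex_orthonormal_basis d b"
    and *: "normalized_haar unitary_group uG" "R \<in> M \<rightarrow>\<^sub>M uG" "distr M uG R = uG"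
      "\<phi> \<in> borel_measurable uniform_sphere" "integrable uniform_sphere (\<lambda>x. (\<phi> x)\<^sup>2)"
  have "\<forall>i\<in>{1..d}. \<forall>j\<in>{1..d}. conj_field.h cnj (b i) (b j) = (if i = j then 1 else 0)"
    using b by (simp add: complex_orthonormal_basis_def conj_field.h_def[OF conj_field_complex] hermitian_inner_def)
  from conj_field.haar_frame_concentration[OF conj_field_complex assms this *[unfolded unitary_group_eq]]
  show "\<P>(\<omega> in M. \<bar>(1 / real d) * (\<Sum>j=1..d. \<phi> (R \<omega> *v b j)) - prob_space.expectation uniform_sphere \<phi>\<bar>
            \<le> \<delta> * sqrt (prob_space.variance uniform_sphere \<phi>)) \<ge> 1 - \<epsilon>" .
qed

end
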